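(* Let $G$ be simply connected of type $\mathbf{C}_n$, $n\ge6$. (1) If $n$ is even, then the section given by $\mathcal S(s_i)=t_i\sigma_i$ with $b=-1$ and $a^2=c^2=1$ is an optimal section, whereas the Tits section $\mathcal N_\circ$ is not. If $n$ is odd, then the section given by $\mathcal S(s_i)=t_i\sigma_i$ with $a=-1$ and $b^2=c^2=1$ is an optimal section, whereas the Tits section is not. In both cases, $\mathcal S(s_i)^2=1$ for all $i=1,\dots,n-1$, and $\mathcal S(s_n)^2\ne1$. Moreover $\mathcal N_\circ(s_i)^2\ne1$ for all $i$, in both cases ($n$ even and $n$ odd). Whether $n$ is even or odd, there are only two order profiles of sections. (2) Two sections are $T$-conjugate if and only if they have the same value of $a$, $b$ and $c$.
   Context: $F$ is an algebraically closed field, $G$ an almost-simple connected reductive group over $F$, $T$ a maximal torus, $N=N_G(T)$, $W=N/T$, $\pi:N\to W$ the projection. Let $\alpha_1,\dots,\alpha_n$ be the simple roots in Bourbaki numbering ($\alpha_i=e_i-e_{i+1}$ for $i<n$, $\alpha_n=2e_n$), $s_i$ the corresponding reflections, $\alpha_i^\vee$ the simple coroots. Fix a realization of the root system: isomorphisms $u_\alpha:\mathbf G_a\to U_\alpha$ onto the root subgroups with $tu_\alpha(x)t^{-1}=u_\alpha(\alpha(t)x)$, such that $\sigma_\alpha=u_\alpha(1)u_{-\alpha}(-1)u_\alpha(1)\in N$ maps to $s_\alpha$ and $u_\alpha(x)u_{-\alpha}(-x^{-1})u_\alpha(x)=\alpha^\vee(x)\sigma_\alpha$ for $x\in F^\times$;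 put $\sigma_i=\sigma_{\alpha_i}$. A section is a map $\mathcal S:W\to N$ with $\pi\circ\mathcal S=\mathrm{id}$ satisfying the braid relations (equivalently $\mathcal S$ is multiplicative along reduced expressions). It is determined by $\mathcal S(s_i)=t_i\sigma_i$, $t_i\in T$. The Tits section $\mathcal N_\circ$ is the one with all $t_i=1$. The order profile of $\mathcal S$ is the Dynkin diagram with the node of each $\alpha_i$ labeled by the order of $\mathcal S(s_i)$. For two sections write $\mathcal S'<\mathcal S$ if the order of $\mathcal S'(s_i)$ is greater than the order of $\mathcal S(s_i)$ for all $i$; this translates to a partial order on order profiles, and a section is called optimal if it has the unique maximal order profile with respect to this partial order. Two sections $\mathcal S,\mathcal S'$ are $T$-conjugate if there is $t\in T$ with $t\mathcal S(w)t^{-1}=\mathcal S'(w)$ for all $w\in W$. Coordinates: $(x_1,\dots,x_n)$ denotes $\alpha_1^\vee(x_1)\cdots\alpha_n^\vee(x_n)\in T$. The sections are exactly those given by $t_i$ of the following form, with $a_{i,i}\in F^\times$ arbitrary and $a,b,c\in F^\times$ with $a^2=b^2=c^2=1$. For $1\le i\le n-1$ the $k$-th coordinate of $t_i$ is: for $k<i$, $ab$ if $k$ is odd and $1$ if $k$ is even; for $k=i$, $a_{i,i}$; for $k>i$ and $n$ even, $a$ if $k$ is odd and $b$ if $k$ is even; for $k>i$ and $n$ odd, $b$ if $k$ is odd and $a$ if $k$ is even. The $k$-th coordinate of $t_n$ is, for $k<n$, $c$ if $k$ is odd and $1$ if $k$ is even, and $a_{n,n}$ for $k=n$.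
   Formalization: The characteristic of F is assumed not to be 2 (otherwise -1=1 and S(s_n)^2=1, so part (1) fails), and sections are compared by orders greater than or equal at all nodes rather than strictly greater, since the order at s_n is always 4. *)

theory Defs
  imports
    "HOL-Analysis.Analysis"
    "HOL-Algebra.Algebra"
    "HOL-Library.Extended_Nat"
begin

section \<open>Affine varieties and linear algebraic groups\<close>

text \<open>
  An affine variety over an algebraically closed field \<open>'a\<close> is given classically, by a set of
  points \<open>V\<close> together with a set \<open>C\<close> of coordinate functions; its regular functions are the
  elements of the \<open>'a\<close>-algebra generated by \<open>C\<close>.  As \<open>HOL-Analysis\<close> multiplies vectors
  componentwise, \<open>*\<close> is never used for matrices here.
\<close>

inductive_set regular :: "('v \<Rightarrow> 'a::field) set \<Rightarrow> ('v \<Rightarrow> 'a) set" for C where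
  const: "(\<lambda>_. c) \<in> regular C"
| coord: "f \<in> C \<Longrightarrow> f \<in> regular C"
| add: "f \<in> regular C \<Longrightarrow> g \<in> regular C \<Longrightarrow> (\<lambda>v. f v + g v) \<in> regular C"
| mult: "f \<in> regular C \<Longrightarrow> g \<in> regular C \<Longrightarrow> (\<lambda>v. f v * g v) \<in> regular C"

definition zariski_closed :: "'v set \<Rightarrow> ('v \<Rightarrow> 'a::field) set \<Rightarrow> 'v set \<Rightarrow> bool" where
  "zariski_closed V C Z \<longleftrightarrow> (\<exists>P \<subseteq> regular C. Z = {x \<in> V. \<forall>f\<in>P. f x = 0})"

definition alg_morphism ::
  "'v set \<Rightarrow> ('v \<Rightarrow> 'a::field) set \<Rightarrow> 'w set \<Rightarrow> ('w \<Rightarrow> 'a) set \<Rightarrow> ('v \<Rightarrow> 'w) \<Rightarrow> bool" where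
  "alg_morphism V C Y D \<phi> \<longleftrightarrow>
     \<phi> \<in> V \<rightarrow> Y \<and> (\<forall>d\<in>D. \<exists>f\<in>regular C. \<forall>x\<in>V. d (\<phi> x) = f x)"

definition alg_hom ::
  "('v, 'm) monoid_scheme \<Rightarrow> ('v \<Rightarrow> 'a::field) set \<Rightarrow>
   ('w, 'k) monoid_scheme \<Rightarrow> ('w \<Rightarrow> 'a) set \<Rightarrow> ('v \<Rightarrow> 'w) set" where
  "alg_hom H C K D = {\<phi> \<in> hom H K. alg_morphism (carrier H) C (carrier K) D \<phi>}"

definition alg_iso ::
  "('v, 'm) monoid_scheme \<Rightarrow> ('v \<Rightarrow> 'a::field) set \<Rightarrow>
   ('w, 'k) monoid_scheme \<Rightarrow> ('w \<Rightarrow> 'a) set \<Rightarrow> ('v \<Rightarrow> 'w) set" where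
  "alg_iso H C K D = {\<phi> \<in> alg_hom H C K D. bij_betw \<phi> (carrier H) (carrier K) \<and>
     inv_into (carrier H) \<phi> \<in> alg_hom K D H C}"

definition Ga :: "'a::field monoid" where
  "Ga = \<lparr>carrier = UNIV, mult = (+), one = 0\<rparr>"

definition Ga_coords :: "('a::field \<Rightarrow> 'a) set" where
  "Ga_coords = {\<lambda>x. x}"

definition Gm :: "'a::field monoid" where
  "Gm = \<lparr>carrier = - {0}, mult = (*), one = 1\<rparr>"

definition Gm_coords :: "('a::field \<Rightarrow> 'a) set" where
  "Gm_coords = {\<lambda>x. x, inverse}"

text \<open>The \<open>r\<close>-fold power of \<open>Gm\<close>; a point is padded by \<open>1\<close> beyond the first \<open>r\<close> entries.\<close>

definition Gm_power :: "nat \<Rightarrow> (nat \<Rightarrow> 'a::field) monoid" where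
  "Gm_power r = \<lparr>carrier = {x. (\<forall>i<r. x i \<noteq> 0) \<and> (\<forall>i\<ge>r. x i = 1)},
     mult = (\<lambda>x y i. x i * y i), one = (\<lambda>_. 1)\<rparr>"

definition Gm_power_coords :: "nat \<Rightarrow> ((nat \<Rightarrow> 'a::field) \<Rightarrow> 'a) set" where
  "Gm_power_coords r = {\<lambda>x. x i |i. i < r} \<union> {\<lambda>x. inverse (x i) |i. i < r}"

definition GL :: "('a::field^'m^'m) monoid" where
  "GL = \<lparr>carrier = {A. invertible A}, mult = (**), one = mat 1\<rparr>"

abbreviation sub_GL :: "('a::field^'m^'m) set \<Rightarrow> ('a^'m^'m) monoid" where
  "sub_GL H \<equiv> GL\<lparr>carrier := H\<rparr>"

definition entries :: "('a::field^'m^'m \<Rightarrow> 'a) set" where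
  "entries = {\<lambda>A. A $ i $ j |i j. True}"

definition GL_coords :: "('a::field^'m^'m \<Rightarrow> 'a) set" where
  "GL_coords = entries \<union> {\<lambda>A. inverse (det A)}"

definition algebraic_group :: "('a::field^'m^'m) set \<Rightarrow> bool" where
  "algebraic_group G \<longleftrightarrow> subgroup G GL \<and> zariski_closed (carrier GL) GL_coords G"

definition zariski_connected :: "('a::field^'m^'m) set \<Rightarrow> bool" where
  "zariski_connected V \<longleftrightarrow>
     \<not> (\<exists>A B. zariski_closed V GL_coords A \<and> zariski_closed V GL_coords B \<and>
          A \<noteq> {} \<and> B \<noteq> {} \<and> A \<inter> B = {} \<and> A \<union> B = V)"

definition unipotent :: "'a::field^'m^'m \<Rightarrow> bool" where
  "unipotent g \<longleftrightarrow> (\<exists>k. ((\<lambda>A. A ** (g - mat 1)) ^^ k) (mat 1) = 0)"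

definition connected_reductive :: "('a::field^'m^'m) set \<Rightarrow> bool" where
  "connected_reductive G \<longleftrightarrow> algebraic_group G \<and> zariski_connected G \<and>
     (\<forall>U. algebraic_group U \<and> zariski_connected U \<and> normal U (sub_GL G) \<and>
          (\<forall>g\<in>U. unipotent g) \<longrightarrow> U = {mat 1})"

definition almost_simple :: "('a::field^'m^'m) set \<Rightarrow> bool" where
  "almost_simple G \<longleftrightarrow> \<not> comm_group (sub_GL G) \<and>
     (\<forall>H. algebraic_group H \<and> zariski_connected H \<and> normal H (sub_GL G) \<longrightarrow>
          H = {mat 1} \<or> H = G)"

definition torus :: "('a::field^'m^'m) set \<Rightarrow> bool" where
  "torus T \<longleftrightarrow> algebraic_group T \<and>
     (\<exists>r. alg_iso (Gm_power r) (Gm_power_coords r) (sub_GL T) GL_coords \<noteq> {})"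

definition maximal_torus :: "('a::field^'m^'m) set \<Rightarrow> ('a^'m^'m) set \<Rightarrow> bool" where
  "maximal_torus G T \<longleftrightarrow> torus T \<and> T \<subseteq> G \<and> (\<forall>T'. torus T' \<and> T \<subseteq> T' \<and> T' \<subseteq> G \<longrightarrow> T' = T)"


section \<open>Roots, coroots and root subgroups\<close>

type_synonym ('a, 'm) tchar = "'a^'m^'m \<Rightarrow> 'a"
type_synonym ('a, 'm) tcochar = "'a \<Rightarrow> 'a^'m^'m"

definition characters :: "('a::field^'m^'m) set \<Rightarrow> ('a, 'm) tchar set" where
  "characters T = alg_hom (sub_GL T) GL_coords Gm Gm_coords \<inter> extensional T"

definition cocharacters :: "('a::field^'m^'m) set \<Rightarrow> ('a, 'm) tcochar set" where
  "cocharacters T = alg_hom Gm Gm_coords (sub_GL T) GL_coords \<inter> extensional (- {0})"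

definition cocharacter_group :: "('a::field^'m^'m) set \<Rightarrow> ('a, 'm) tcochar monoid" where
  "cocharacter_group T = \<lparr>carrier = cocharacters T,
     mult = (\<lambda>\<mu> \<nu>. restrict (\<lambda>x. \<mu> x ** \<nu> x) (- {0})),
     one = restrict (\<lambda>_. mat 1) (- {0})\<rparr>"

definition neg_char :: "('a::field^'m^'m) set \<Rightarrow> ('a, 'm) tchar \<Rightarrow> ('a, 'm) tchar" where
  "neg_char T \<alpha> = (\<lambda>t\<in>T. inverse (\<alpha> t))"

text \<open>
  The Lie algebra as the tangent space of \<open>G\<close> at \<open>1\<close>: the differential of \<open>f\<close> at \<open>1\<close> in
  direction \<open>A\<close> is the linear coefficient of the polynomial \<open>f (1 + s A)\<close> in \<open>s\<close>.
\<close>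

definition lie_algebra :: "('a::field^'m^'m) set \<Rightarrow> ('a^'m^'m) set" where
  "lie_algebra G = {A. \<forall>f \<in> regular entries. (\<forall>g\<in>G. f g = 0) \<longrightarrow>
     (\<exists>p. (\<forall>s. poly p s = f (\<chi> i j. (mat 1 :: 'a^'m^'m) $ i $ j + s * A $ i $ j)) \<and>
          Polynomial.coeff p 1 = 0)}"

definition roots :: "('a::field^'m^'m) set \<Rightarrow> ('a^'m^'m) set \<Rightarrow> ('a, 'm) tchar set" where
  "roots G T = {\<alpha> \<in> characters T. (\<exists>t\<in>T. \<alpha> t \<noteq> 1) \<and>
     (\<exists>A \<in> lie_algebra G. A \<noteq> 0 \<and>
        (\<forall>t\<in>T. t ** A ** matrix_inv t = (\<chi> i j. \<alpha> t * A $ i $ j)))}"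

text \<open>
  The reflection attached to \<open>\<alpha>\<close> and \<open>\<gamma>\<close>, as an endomorphism of \<open>T\<close>; it induces
  \<open>\<chi> \<mapsto> \<chi> - \<langle>\<chi>, \<gamma>\<rangle> \<alpha>\<close> on characters and \<open>\<mu> \<mapsto> \<mu> - \<langle>\<alpha>, \<mu>\<rangle> \<gamma>\<close> on cocharacters.
\<close>

definition torus_reflection ::
  "('a::field, 'm) tchar \<Rightarrow> ('a, 'm) tcochar \<Rightarrow> 'a^'m^'m \<Rightarrow> 'a^'m^'m" where
  "torus_reflection \<alpha> \<gamma> t = t \<otimes>\<^bsub>GL\<^esub> inv\<^bsub>GL\<^esub> (\<gamma> (\<alpha> t))"

text \<open>
  The coroot of \<open>\<alpha>\<close> in the sense of root systems: \<open>\<langle>\<alpha>, \<gamma>\<rangle> = 2\<close> and the reflection stabilises the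
  set of roots.  This determines \<open>\<gamma>\<close> when the roots span, i.e. when \<open>G\<close> is semisimple.
\<close>

definition is_coroot ::
  "('a::field^'m^'m) set \<Rightarrow> ('a^'m^'m) set \<Rightarrow> ('a, 'm) tchar \<Rightarrow> ('a, 'm) tcochar \<Rightarrow> bool" where
  "is_coroot G T \<alpha> \<gamma> \<longleftrightarrow> \<gamma> \<in> cocharacters T \<and> (\<forall>x. x \<noteq> 0 \<longrightarrow> \<alpha> (\<gamma> x) = x ^ 2) \<and>
     (\<forall>\<beta> \<in> roots G T. (\<lambda>t\<in>T. \<beta> (torus_reflection \<alpha> \<gamma> t)) \<in> roots G T)"

definition root_parametrization ::
  "('a::field^'m^'m) set \<Rightarrow> ('a^'m^'m) set \<Rightarrow> ('a, 'm) tchar \<Rightarrow> ('a \<Rightarrow> 'a^'m^'m) \<Rightarrow>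
   ('a^'m^'m) set \<Rightarrow> bool" where
  "root_parametrization G T \<alpha> u U \<longleftrightarrow> algebraic_group U \<and> U \<subseteq> G \<and>
     u \<in> alg_iso Ga Ga_coords (sub_GL U) GL_coords \<and>
     (\<forall>t\<in>T. \<forall>x. t \<otimes>\<^bsub>GL\<^esub> u x \<otimes>\<^bsub>GL\<^esub> inv\<^bsub>GL\<^esub> t = u (\<alpha> t * x))"

text \<open>The root subgroup of \<open>\<alpha>\<close> is the \<^emph>\<open>unique\<close> closed subgroup admitting such a parametrization.\<close>

definition root_subgroup ::
  "('a::field^'m^'m) set \<Rightarrow> ('a^'m^'m) set \<Rightarrow> ('a, 'm) tchar \<Rightarrow> ('a^'m^'m) set \<Rightarrow> bool" where
  "root_subgroup G T \<alpha> U \<longleftrightarrow> (\<exists>u. root_parametrization G T \<alpha> u U) \<and>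
     (\<forall>V v. root_parametrization G T \<alpha> v V \<longrightarrow> V = U)"


section \<open>Realizations\<close>

text \<open>
  A group \<open>grp\<close> with a torus \<open>tor\<close>, simple roots \<open>sroot 1\<close>, ..., \<open>sroot rk\<close>, a coroot \<open>coroot \<alpha>\<close>
  and a parametrization \<open>rpar \<alpha>\<close> of the root subgroup for every root \<open>\<alpha>\<close>.
\<close>

record ('a, 'm) realization =
  rk :: nat
  grp :: "('a^'m^'m) set"
  tor :: "('a^'m^'m) set"
  sroot :: "nat \<Rightarrow> ('a, 'm) tchar"
  coroot :: "('a, 'm) tchar \<Rightarrow> ('a, 'm) tcochar"
  rpar :: "('a, 'm) tchar \<Rightarrow> 'a \<Rightarrow> 'a^'m^'m"

definition normalizer_torus :: "('a::field, 'm::finite) realization \<Rightarrow> ('a^'m^'m) set" where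
  "normalizer_torus R =
     {g \<in> grp R. (\<lambda>t. g \<otimes>\<^bsub>GL\<^esub> t \<otimes>\<^bsub>GL\<^esub> inv\<^bsub>GL\<^esub> g) ` tor R = tor R}"

definition weyl_group :: "('a::field, 'm::finite) realization \<Rightarrow> ('a^'m^'m) set monoid" where
  "weyl_group R = sub_GL (normalizer_torus R) Mod tor R"

definition weyl_proj :: "('a::field, 'm::finite) realization \<Rightarrow> 'a^'m^'m \<Rightarrow> ('a^'m^'m) set" where
  "weyl_proj R g = tor R #>\<^bsub>GL\<^esub> g"

definition sigma_root :: "('a::field, 'm::finite) realization \<Rightarrow> ('a, 'm) tchar \<Rightarrow> 'a^'m^'m" where
  "sigma_root R \<alpha> = rpar R \<alpha> 1 \<otimes>\<^bsub>GL\<^esub> rpar R (neg_char (tor R) \<alpha>) (- 1) \<otimes>\<^bsub>GL\<^esub> rpar R \<alpha> 1"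

abbreviation sigma :: "('a::field, 'm::finite) realization \<Rightarrow> nat \<Rightarrow> 'a^'m^'m" where
  "sigma R i \<equiv> sigma_root R (sroot R i)"

text \<open>
  By the axiom that \<open>sigma_root R \<alpha>\<close> acts on the torus as the reflection of \<open>\<alpha>\<close> (see
  \<open>is_realization\<close> below), this is the simple reflection \<open>s\<^sub>i\<close> in the Weyl group.
\<close>

definition simple_reflection ::
  "('a::field, 'm::finite) realization \<Rightarrow> nat \<Rightarrow> ('a^'m^'m) set" where
  "simple_reflection R i = weyl_proj R (sigma R i)"

definition is_base :: "('a::field, 'm::finite) realization \<Rightarrow> bool" where
  "is_base R \<longleftrightarrow>
     (\<forall>i\<in>{1..rk R}. sroot R i \<in> roots (grp R) (tor R)) \<and>
     (\<forall>m :: nat \<Rightarrow> int. (\<forall>t\<in>tor R. (\<Prod>i=1..rk R. sroot R i t powi m i) = 1) \<longrightarrow>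
        (\<forall>i\<in>{1..rk R}. m i = 0)) \<and>
     (\<forall>\<beta> \<in> roots (grp R) (tor R). \<exists>m :: nat \<Rightarrow> nat.
        (\<forall>t\<in>tor R. \<beta> t = (\<Prod>i=1..rk R. sroot R i t ^ m i)) \<or>
        (\<forall>t\<in>tor R. \<beta> t = inverse (\<Prod>i=1..rk R. sroot R i t ^ m i)))"

text \<open>
  The last conjunct (the Weyl group is generated by the simple reflections) is a theorem for
  connected reductive groups, as is the existence of a realization; the library does not provide
  the structure theory of reductive groups, so it is listed with the other properties.
\<close>

definition is_realization :: "('a::field, 'm::finite) realization \<Rightarrow> bool" where
  "is_realization R \<longleftrightarrow>
     connected_reductive (grp R) \<and> maximal_torus (grp R) (tor R) \<and> is_base R \<and>
     (\<forall>\<alpha> \<in> roots (grp R) (tor R).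
        is_coroot (grp R) (tor R) \<alpha> (coroot R \<alpha>) \<and>
        (\<exists>U. root_subgroup (grp R) (tor R) \<alpha> U \<and>
             root_parametrization (grp R) (tor R) \<alpha> (rpar R \<alpha>) U) \<and>
        sigma_root R \<alpha> \<in> normalizer_torus R \<and>
        (\<forall>t\<in>tor R. sigma_root R \<alpha> \<otimes>\<^bsub>GL\<^esub> t \<otimes>\<^bsub>GL\<^esub> inv\<^bsub>GL\<^esub> sigma_root R \<alpha>
           = torus_reflection \<alpha> (coroot R \<alpha>) t) \<and>
        (\<forall>x. x \<noteq> 0 \<longrightarrow>
           rpar R \<alpha> x \<otimes>\<^bsub>GL\<^esub> rpar R (neg_char (tor R) \<alpha>) (- inverse x) \<otimes>\<^bsub>GL\<^esub> rpar R \<alpha> x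
           = coroot R \<alpha> x \<otimes>\<^bsub>GL\<^esub> sigma_root R \<alpha>)) \<and>
     carrier (weyl_group R) = generate (weyl_group R) (simple_reflection R ` {1..rk R})"

text \<open>
  The simple roots of \<open>C\<^sub>n\<close> in coordinates \<open>e\<^sub>1, ..., e\<^sub>n\<close>, and the Cartan integers
  \<open>\<langle>\<alpha>\<^sub>i, \<alpha>\<^sub>j\<^sup>\<or>\<rangle> = 2 (\<alpha>\<^sub>i, \<alpha>\<^sub>j) / (\<alpha>\<^sub>j, \<alpha>\<^sub>j)\<close>; the division is exact.
\<close>

definition C_root :: "nat \<Rightarrow> nat \<Rightarrow> nat \<Rightarrow> int" where
  "C_root n i k = (if i = n then (if k = n then 2 else 0)
                   else if k = i then 1 else if k = i + 1 then - 1 else 0)"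

definition C_cartan :: "nat \<Rightarrow> nat \<Rightarrow> nat \<Rightarrow> int" where
  "C_cartan n i j = 2 * (\<Sum>k=1..n. C_root n i k * C_root n j k) div
                        (\<Sum>k=1..n. C_root n j k * C_root n j k)"

definition type_C :: "('a::field, 'm::finite) realization \<Rightarrow> bool" where
  "type_C R \<longleftrightarrow> (\<forall>i\<in>{1..rk R}. \<forall>j\<in>{1..rk R}. \<forall>x. x \<noteq> 0 \<longrightarrow>
     sroot R i (coroot R (sroot R j) x) = x powi C_cartan (rk R) i j)"

text \<open>The simple coroots generate the coroot lattice.\<close>

definition simply_connected_grp :: "('a::field, 'm::finite) realization \<Rightarrow> bool" where
  "simply_connected_grp R \<longleftrightarrow> carrier (cocharacter_group (tor R)) =
     generate (cocharacter_group (tor R)) ((\<lambda>i. coroot R (sroot R i)) ` {1..rk R})"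

text \<open>The element \<open>(x\<^sub>1, ..., x\<^sub>n)\<close> of the torus.\<close>

definition torus_elt ::
  "('a::field, 'm::finite) realization \<Rightarrow> (nat \<Rightarrow> 'a) \<Rightarrow> 'a^'m^'m" where
  "torus_elt R x = finprod (sub_GL (tor R)) (\<lambda>k. coroot R (sroot R k) (x k)) {1..rk R}"


section \<open>Sections of the Weyl group\<close>

definition word_prod :: "('b, 'c) monoid_scheme \<Rightarrow> (nat \<Rightarrow> 'b) \<Rightarrow> nat list \<Rightarrow> 'b" where
  "word_prod M f ws = foldr (\<lambda>i y. f i \<otimes>\<^bsub>M\<^esub> y) ws \<one>\<^bsub>M\<^esub>"

definition reduced_word :: "('a::field, 'm::finite) realization \<Rightarrow> nat list \<Rightarrow> bool" where
  "reduced_word R ws \<longleftrightarrow> set ws \<subseteq> {1..rk R} \<and>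
     (\<forall>vs. set vs \<subseteq> {1..rk R} \<and>
        word_prod (weyl_group R) (simple_reflection R) vs =
        word_prod (weyl_group R) (simple_reflection R) ws \<longrightarrow> length ws \<le> length vs)"

type_synonym ('a, 'm) wsection = "('a^'m^'m) set \<Rightarrow> 'a^'m^'m"

text \<open>Multiplicativity is required along reduced expressions only, which is what the braid
  relations amount to; sections are not homomorphisms in general.\<close>

definition is_section ::
  "('a::field, 'm::finite) realization \<Rightarrow> ('a, 'm) wsection \<Rightarrow> bool" where
  "is_section R S \<longleftrightarrow> S \<in> carrier (weyl_group R) \<rightarrow>\<^sub>E normalizer_torus R \<and>
     (\<forall>w \<in> carrier (weyl_group R). weyl_proj R (S w) = w) \<and>
     (\<forall>ws. reduced_word R ws \<longrightarrow>
        S (word_prod (weyl_group R) (simple_reflection R) ws) =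
        word_prod GL (\<lambda>i. S (simple_reflection R i)) ws)"

definition tits_section ::
  "('a::field, 'm::finite) realization \<Rightarrow> ('a, 'm) wsection \<Rightarrow> bool" where
  "tits_section R S \<longleftrightarrow> is_section R S \<and>
     (\<forall>i\<in>{1..rk R}. S (simple_reflection R i) = sigma R i)"

definition elt_order :: "('a::field^'m^'m) \<Rightarrow> enat" where
  "elt_order g = (if group.ord GL g = 0 then \<infinity> else enat (group.ord GL g))"

definition order_profile ::
  "('a::field, 'm::finite) realization \<Rightarrow> ('a, 'm) wsection \<Rightarrow> nat \<Rightarrow> enat" where
  "order_profile R S = (\<lambda>i\<in>{1..rk R}. elt_order (S (simple_reflection R i)))"

definition order_profiles ::
  "('a::field, 'm::finite) realization \<Rightarrow> (nat \<Rightarrow> enat) set" where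
  "order_profiles R = order_profile R ` {S. is_section R S}"

text \<open>The partial order is reversed: a larger profile has smaller orders at the nodes.\<close>

definition profile_le :: "nat \<Rightarrow> (nat \<Rightarrow> enat) \<Rightarrow> (nat \<Rightarrow> enat) \<Rightarrow> bool" where
  "profile_le n p q \<longleftrightarrow> (\<forall>i\<in>{1..n}. q i \<le> p i)"

definition optimal ::
  "('a::field, 'm::finite) realization \<Rightarrow> ('a, 'm) wsection \<Rightarrow> bool" where
  "optimal R S \<longleftrightarrow> is_section R S \<and>
     {p \<in> order_profiles R. \<forall>q \<in> order_profiles R. profile_le (rk R) p q \<longrightarrow> q = p}
       = {order_profile R S}"

definition T_conjugate ::
  "('a::field, 'm::finite) realization \<Rightarrow> ('a, 'm) wsection \<Rightarrow> ('a, 'm) wsection \<Rightarrow> bool" where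
  "T_conjugate R S S' \<longleftrightarrow>
     (\<exists>t\<in>tor R. \<forall>w \<in> carrier (weyl_group R). t \<otimes>\<^bsub>GL\<^esub> S w \<otimes>\<^bsub>GL\<^esub> inv\<^bsub>GL\<^esub> t = S' w)"

text \<open>The \<open>k\<close>-th coordinate of \<open>t\<^sub>i\<close>, where \<open>d i\<close> is the free diagonal entry \<open>a\<^sub>i\<^sub>,\<^sub>i\<close>.\<close>

definition t_coord ::
  "nat \<Rightarrow> 'a::field \<Rightarrow> 'a \<Rightarrow> 'a \<Rightarrow> (nat \<Rightarrow> 'a) \<Rightarrow> nat \<Rightarrow> nat \<Rightarrow> 'a" where
  "t_coord n a b c d i k =
     (if k = i then d i
      else if i = n then (if odd k then c else 1)
      else if k < i then (if odd k then a * b else 1)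
      else if even n then (if odd k then a else b)
      else (if odd k then b else a))"

definition section_params ::
  "('a::field, 'm::finite) realization \<Rightarrow> 'a \<Rightarrow> 'a \<Rightarrow> 'a \<Rightarrow> (nat \<Rightarrow> 'a) \<Rightarrow>
   ('a, 'm) wsection \<Rightarrow> bool" where
  "section_params R a b c d S \<longleftrightarrow> is_section R S \<and>
     a ^ 2 = 1 \<and> b ^ 2 = 1 \<and> c ^ 2 = 1 \<and> (\<forall>i\<in>{1..rk R}. d i \<noteq> 0) \<and>
     (\<forall>i\<in>{1..rk R}. S (simple_reflection R i) =
        torus_elt R (t_coord (rk R) a b c d i) \<otimes>\<^bsub>GL\<^esub> sigma R i)"

end

theory Submission imports Defs begin

text \<open>
  Three facts reduce the theorem to a computation with coordinates in \<open>T\<close>.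

  The first is that \<open>(x\<^sub>1, \<dots>, x\<^sub>n)\<close> identifies \<open>T\<close> with the \<open>n\<close>-th power of \<open>Gm\<close>.  Surjectivity
  (\<open>torus_coordinates_surj\<close>) comes from the fact that the simple coroots generate the cocharacters.  For
  injectivity (\<open>h_eq_one\<close>) the values of the simple roots leave a single nontrivial candidate for the
  kernel, and a divisibility argument in the cocharacter lattice excludes it.

  The second is the braid relation for the \<open>\<sigma>\<^sub>i\<close> (\<open>tits_braid\<close>).  If \<open>g \<in> N\<close> carries the root \<open>\<alpha>\<close> to
  \<open>\<beta>\<close>, then \<open>g \<sigma>\<^sub>\<alpha> g\<^sup>-\<^sup>1 = \<beta>\<^sup>\<or>(c) \<sigma>\<^sub>\<beta>\<close> for some \<open>c\<close> (\<open>sigma_transport\<close>), because root subgroups are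
  unique.  Along an alternating word in \<open>s\<^sub>i\<close> and \<open>s\<^sub>j\<close> this shows that the two sides of the braid
  relation differ by a value of \<open>\<alpha>\<^sub>i\<^sup>\<or>\<close> and, by symmetry, by a value of \<open>\<alpha>\<^sub>j\<^sup>\<or>\<close>.  The simple coroots
  being independent, they are equal.

  The third is that lifts of the simple reflections extend to a section exactly if they satisfy the
  braid relations (\<open>exists_section\<close>, \<open>section_has_params\<close>).  This is Matsumoto's theorem, which rests on
  the exchange condition in \<open>N/T\<close>.  That \<open>N/T\<close> acts faithfully on \<open>T\<close> is not
  among the axioms of a realization, so equalities in \<open>N/T\<close> cannot be read off from reflections.
  Instead, if \<open>s\<^sub>j\<close> makes a positive image of a simple root negative, this image is \<open>\<alpha>\<^sub>j\<close>
  (\<open>sign_change\<close>), and \<open>sigma_transport\<close> gives an equality in \<open>N\<close> up to \<open>T\<close>.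

  In coordinates the braid relations of the \<open>t\<^sub>i \<sigma>\<^sub>i\<close> become monomial equations, whose solutions are the
  family with parameters \<open>a\<close>, \<open>b\<close>, \<open>c\<close> and free diagonal entries (\<open>braid_equations_solution\<close>,
  \<open>t_coord_braid_equations\<close>).  Let \<open>u = b\<close> for even \<open>n\<close> and \<open>u = a\<close> for odd \<open>n\<close>.  Then
  \<open>S(s\<^sub>i)\<^sup>2 = \<alpha>\<^sub>i\<^sup>\<or>(-u)\<close> for \<open>i < n\<close> and \<open>S(s\<^sub>n)\<^sup>2 = \<alpha>\<^sub>n\<^sup>\<or>(-1)\<close> (\<open>section_square\<close>).  So the order profile is
  \<open>(2, \<dots>, 2, 4)\<close> for \<open>u = -1\<close> and \<open>(4, \<dots>, 4)\<close> for \<open>u = 1\<close>, and the Tits section, with all parameters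
  equal to \<open>1\<close>, has the latter.  Conjugation by \<open>t \<in> T\<close> only multiplies the diagonal entries by the values
  \<open>\<alpha>\<^sub>i(t)\<close>, which can be prescribed (\<open>T_conjugate_iff\<close>).
\<close>


section \<open>Matsumoto's theorem from the exchange condition\<close>

fun alternating :: "nat \<Rightarrow> nat \<Rightarrow> nat \<Rightarrow> nat list" where
  "alternating 0 i j = []"
| "alternating (Suc q) i j = i # alternating q j i"

lemma length_alternating [simp]: "length (alternating q i j) = q"
  by (induction q i j rule: alternating.induct) auto

lemma set_alternating: "set (alternating q i j) \<subseteq> {i, j}"
  by (induction q i j rule: alternating.induct) auto

lemma take_alternating: "k \<le> q \<Longrightarrow> take k (alternating q i j) = alternating k i j"
proof (induction q arbitrary: k i j)
  case (Suc q)
  then show ?case by (cases k) auto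
qed simp

lemma (in monoid) word_prod_closed:
  assumes "\<And>i. i \<in> set ws \<Longrightarrow> f i \<in> carrier G"
  shows "word_prod G f ws \<in> carrier G"
  using assms by (induction ws) (auto simp: word_prod_def)

lemma (in monoid) word_prod_append:
  assumes "\<And>i. i \<in> set us \<union> set ws \<Longrightarrow> f i \<in> carrier G"
  shows "word_prod G f (us @ ws) = word_prod G f us \<otimes> word_prod G f ws"
  using assms
proof (induction us)
  case Nil
  then show ?case using word_prod_closed[of ws f] by (simp add: word_prod_def)
next
  case (Cons a us)
  then show ?case using word_prod_closed[of ws f] word_prod_closed[of us f]
    by (simp add: word_prod_def m_assoc)
qed

lemma word_prod_Nil [simp]: "word_prod G f [] = \<one>\<^bsub>G\<^esub>"
  by (simp add: word_prod_def)

lemma word_prod_Cons [simp]: "word_prod G f (i # ws) = f i \<otimes>\<^bsub>G\<^esub> word_prod G f ws"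
  by (simp add: word_prod_def)

lemma word_prod_cong:
  "(\<And>i. i \<in> set ws \<Longrightarrow> f i = g i) \<Longrightarrow> word_prod G f ws = word_prod G g ws"
  by (induction ws) auto

locale involutive_generators = group W for W (structure) +
  fixes I :: "nat set" and s :: "nat \<Rightarrow> 'a"
  assumes s_closed: "i \<in> I \<Longrightarrow> s i \<in> carrier W"
    and s_square: "i \<in> I \<Longrightarrow> s i \<otimes> s i = \<one>"
    and exists_word: "w \<in> carrier W \<Longrightarrow> \<exists>ws. set ws \<subseteq> I \<and> word_prod W s ws = w"
begin

definition reduced :: "nat list \<Rightarrow> bool" where
  "reduced ws \<longleftrightarrow> set ws \<subseteq> I \<and>
     (\<forall>vs. set vs \<subseteq> I \<and> word_prod W s vs = word_prod W s ws \<longrightarrow> length ws \<le> length vs)"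

abbreviation wp :: "nat list \<Rightarrow> 'a" where "wp \<equiv> word_prod W s"

lemma wp_closed: "set ws \<subseteq> I \<Longrightarrow> wp ws \<in> carrier W"
  by (rule word_prod_closed) (use s_closed in auto)

lemma wp_append: "set us \<subseteq> I \<Longrightarrow> set ws \<subseteq> I \<Longrightarrow> wp (us @ ws) = wp us \<otimes> wp ws"
  by (rule word_prod_append) (use s_closed in auto)

lemma wp_double: "i \<in> I \<Longrightarrow> set ws \<subseteq> I \<Longrightarrow> s i \<otimes> wp (i # ws) = wp ws"
  using s_square s_closed wp_closed by (simp add: m_assoc[symmetric])

lemma reducedD: "reduced ws \<Longrightarrow> set ws \<subseteq> I"
  by (simp add: reduced_def)

lemma reduced_le: "reduced ws \<Longrightarrow> set vs \<subseteq> I \<Longrightarrow> wp vs = wp ws \<Longrightarrow> length ws \<le> length vs"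
  by (simp add: reduced_def)

lemma reduced_same_length:
  "reduced ws \<Longrightarrow> reduced vs \<Longrightarrow> wp vs = wp ws \<Longrightarrow> length vs = length ws"
  by (metis le_antisym reduced_def)

lemma reduced_of_length:
  "reduced ws \<Longrightarrow> set vs \<subseteq> I \<Longrightarrow> wp vs = wp ws \<Longrightarrow> length vs \<le> length ws \<Longrightarrow> reduced vs"
  by (metis le_trans reduced_def)

lemma reduced_Nil: "reduced []"
  by (simp add: reduced_def)

lemma exists_reduced:
  assumes "w \<in> carrier W"
  shows "\<exists>ws. reduced ws \<and> wp ws = w"
proof -
  define P where "P ws \<longleftrightarrow> set ws \<subseteq> I \<and> wp ws = w" for ws
  obtain ws0 where "P ws0" using exists_word[OF assms] by (auto simp: P_def)
  then have "P (arg_min length P) \<and> (\<forall>vs. P vs \<longrightarrow> length (arg_min length P) \<le> length vs)"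
    by (metis arg_min_nat_lemma)
  then show ?thesis by (auto simp: P_def reduced_def intro!: exI[of _ "arg_min length P"])
qed

lemma reduced_appendD:
  assumes "reduced (us @ ws)"
  shows "reduced us" "reduced ws"
proof -
  have I: "set us \<subseteq> I" "set ws \<subseteq> I" using reducedD[OF assms] by auto
  show "reduced us" unfolding reduced_def
  proof (intro conjI allI impI I(1), elim conjE)
    fix vs assume "set vs \<subseteq> I" "wp vs = wp us"
    then have "wp (vs @ ws) = wp (us @ ws)" using I by (simp add: wp_append)
    then show "length us \<le> length vs"
      using reduced_le[OF assms, of "vs @ ws"] \<open>set vs \<subseteq> I\<close> I by simp
  qed
  show "reduced ws" unfolding reduced_def
  proof (intro conjI allI impI I(2), elim conjE)
    fix vs assume "set vs \<subseteq> I" "wp vs = wp ws"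
    then have "wp (us @ vs) = wp (us @ ws)" using I by (simp add: wp_append)
    then show "length ws \<le> length vs"
      using reduced_le[OF assms, of "us @ vs"] \<open>set vs \<subseteq> I\<close> I by simp
  qed
qed

text \<open>
  Otherwise a reduced word \<open>vs\<close> of \<open>s\<^sub>i w\<close> is at most as long as \<open>ws\<close>.  It takes \<open>\<alpha>\<^sub>i\<close> to the negative of
  its image under \<open>w\<close>, so exchange yields a word of \<open>w = s\<^sub>i s\<^sub>i w\<close> that is shorter than \<open>vs\<close>.
\<close>

lemma reduced_ConsD: "reduced (i # ws) \<Longrightarrow> reduced ws"
  using reduced_appendD(2)[of "[i]" ws] by simp

end

text \<open>
  The exchange condition in the form in which root systems give it: \<open>s\<^sub>i\<close> moves through the prefix
  \<open>us\<close> and cancels the letter \<open>v\<close> that follows.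
\<close>

locale exchange_generators = involutive_generators +
  assumes exchange: "\<lbrakk>reduced ws; i \<in> I; \<not> reduced (i # ws)\<rbrakk> \<Longrightarrow>
    \<exists>us v vs. ws = us @ v # vs \<and> wp (i # us) = wp (us @ [v])"
begin

lemma reduced_exchange_head:
  assumes ws: "reduced ws" and vs: "reduced (i # vs)" and eq: "wp ws = wp (i # vs)"
  shows "\<exists>us v us'. ws = us @ v # us' \<and> reduced (i # us @ us') \<and> wp (i # us @ us') = wp ws"
proof -
  have I: "set ws \<subseteq> I" "set vs \<subseteq> I" "i \<in> I" using reducedD[OF ws] reducedD[OF vs] by auto
  have "wp (i # ws) = wp vs" using wp_double[of i vs] I eq by simp
  moreover have "length ws = length (i # vs)" using reduced_same_length[OF vs ws eq] .
  ultimately have "\<not> reduced (i # ws)"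
    using reduced_le[of "i # ws" vs] I by force
  then obtain us v us' where dec: "ws = us @ v # us'" and ex: "wp (i # us) = wp (us @ [v])"
    using exchange[OF ws I(3)] by blast
  have I': "set us \<subseteq> I" "v \<in> I" "set us' \<subseteq> I" using I dec by auto
  have "wp (i # us @ us') = wp (i # us) \<otimes> wp us'"
    using I I' wp_append[of "i # us" us'] by simp
  also have "\<dots> = wp (us @ [v]) \<otimes> wp us'" by (simp only: ex)
  also have "\<dots> = wp ws" using I' wp_append[of "us @ [v]" us'] by (simp add: dec)
  finally have "wp (i # us @ us') = wp ws" .
  moreover from this have "reduced (i # us @ us')"
    using reduced_of_length[OF ws] I I' dec by simp
  ultimately show ?thesis using dec by blast
qed

text \<open>
  In a counterexample of least length the two words have different first and different last letters,
  and exchange can only remove the last letter.  Repeating the exchange turns the pair into two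
  words that alternate between the same two letters, where the braid relation applies.
\<close>

theorem matsumoto:
  fixes M (structure)
  assumes M: "monoid M" and f: "\<And>i. i \<in> I \<Longrightarrow> f i \<in> carrier M"
    and braid: "\<And>q i j. \<lbrakk>i \<in> I; j \<in> I; i \<noteq> j; reduced (alternating q i j); reduced (alternating q j i);
        wp (alternating q i j) = wp (alternating q j i)\<rbrakk>
      \<Longrightarrow> word_prod M f (alternating q i j) = word_prod M f (alternating q j i)"
    and red: "reduced ws" "reduced vs" and eq: "wp ws = wp vs"
  shows "word_prod M f ws = word_prod M f vs"
  using red eq
proof (induction "length ws" arbitrary: ws vs rule: less_induct)
  case less
  let ?F = "word_prod M f"
  interpret M: monoid M by fact
  define n where "n = length ws"
  have IH: "?F us = ?F us'" if "length us < n" "reduced us" "reduced us'" "wp us = wp us'" for us us'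
    using less.hyps[of us us'] that unfolding n_def by blast
  have F_append: "?F (us @ us') = ?F us \<otimes>\<^bsub>M\<^esub> ?F us'" if "set us \<subseteq> I" "set us' \<subseteq> I" for us us'
    by (rule M.word_prod_append) (use that f in auto)
  \<comment> \<open>Two words with a common first letter or a common last letter are handled by induction.\<close>
  have head: "?F (i # us) = ?F (i # us')"
    if "reduced (i # us)" "reduced (i # us')" "wp (i # us) = wp (i # us')" "length us < n"
    for i us us'
  proof -
    have I: "i \<in> I" "set us \<subseteq> I" "set us' \<subseteq> I"
      using reducedD[OF that(1)] reducedD[OF that(2)] by auto
    have "wp us = wp us'"
      using wp_double[OF I(1,2)] wp_double[OF I(1,3)] that(3) by metis
    then have "?F us = ?F us'"
      using IH reduced_ConsD[OF that(1)] reduced_ConsD[OF that(2)] that(4) by blast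
    then show ?thesis by simp
  qed
  have last: "?F (us @ [v]) = ?F (us' @ [v])"
    if "reduced (us @ [v])" "reduced (us' @ [v])" "wp (us @ [v]) = wp (us' @ [v])" "length us < n"
    for v us us'
  proof -
    have I: "set us \<subseteq> I" "set us' \<subseteq> I" "v \<in> I"
      using reducedD[OF that(1)] reducedD[OF that(2)] by auto
    then have "wp us \<otimes> s v = wp us' \<otimes> s v"
      using that(3) s_closed by (simp add: wp_append)
    then have "wp us = wp us'" using I wp_closed s_closed by (simp add: right_cancel)
    then have "?F us = ?F us'"
      using IH reduced_appendD(1)[OF that(1)] reduced_appendD(1)[OF that(2)] that(4) by blast
    then show ?thesis using I by (simp add: F_append)
  qed
  define ok where "ok us us' \<longleftrightarrow> reduced us \<and> reduced us' \<and> wp us = wp us' \<and>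
    length us = n \<and> length us' = n \<and> ?F us \<noteq> ?F us'" for us us'
  \<comment> \<open>From a counterexample, moving the first letter of one word to the front of the other
      and dropping the last letter there gives another one.\<close>
  have step: "ok (hd us' # butlast us) us" if ok: "ok us us'" "0 < n" for us us'
  proof -
    obtain i vs where us': "us' = i # vs" using ok by (cases us') (auto simp: ok_def)
    obtain xs v ys where dec: "us = xs @ v # ys" and r: "reduced (i # xs @ ys)"
      and e: "wp (i # xs @ ys) = wp us"
      using reduced_exchange_head[of us i vs] ok us' by (auto simp: ok_def)
    have len: "length (i # xs @ ys) = n" using dec ok by (simp add: ok_def)
    have 1: "?F (i # xs @ ys) = ?F us'"
      using head[where i=i and us="xs @ ys" and us'=vs] r e ok us' len by (simp add: ok_def)
    have "ys = []"
    proof (rule ccontr)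
      assume "ys \<noteq> []"
      then obtain zs z where ys: "ys = zs @ [z]" by (metis rev_exhaust)
      have "?F (i # xs @ ys) = ?F us"
        using last[where us="i # xs @ zs" and v=z and us'="xs @ v # zs"] r e ok dec ys len by (simp add: ok_def)
      with 1 ok show False by (simp add: ok_def)
    qed
    then show ?thesis using 1 r e ok dec us' len by (auto simp: ok_def)
  qed
  show ?case
  proof (rule ccontr)
    assume neq: "?F ws \<noteq> ?F vs"
    have ok0: "ok ws vs"
      using less.prems neq reduced_same_length[of ws vs] by (auto simp: ok_def n_def)
    have pos: "0 < n"
      using ok0 by (cases n) (auto simp: ok_def)
    \<comment> \<open>Each step makes the alternating prefixes of both words longer by one letter.\<close>
    have "\<exists>a b us us'. ok us us' \<and> take (Suc k) us = alternating (Suc k) a b \<and>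
        take (Suc k) us' = alternating (Suc k) b a" if "Suc k \<le> n" for k
      using that
    proof (induction k)
      case 0
      then show ?case using ok0
        by (intro exI[of _ "hd ws"] exI[of _ "hd vs"] exI[of _ ws] exI[of _ vs])
          (cases ws; cases vs; auto simp: ok_def)
    next
      case (Suc k)
      then obtain a b us us' where ok: "ok us us'"
        and t: "take (Suc k) us = alternating (Suc k) a b"
          "take (Suc k) us' = alternating (Suc k) b a" by fastforce
      define xs where "xs = hd us' # butlast us"
      define ys where "ys = hd us # butlast xs"
      have hds: "hd us = a" "hd us' = b"
        using t ok pos by (cases us; cases us'; auto simp: ok_def)+
      have okx: "ok xs us" unfolding xs_def using step[OF ok pos] .
      have oky: "ok ys xs" unfolding ys_def using step[OF okx pos] .
      have len: "length us = n" "length xs = n" using ok okx by (auto simp: ok_def)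
      have tx: "take (Suc (Suc k)) xs = alternating (Suc (Suc k)) b a"
        using t(1) Suc.prems len unfolding xs_def hds by (simp add: take_butlast)
      have "take (Suc k) xs = alternating (Suc k) b a"
        using tx take_alternating[of "Suc k" "Suc (Suc k)" b a]
        by (metis le_add2 min.absorb1 plus_1_eq_Suc take_take)
      then have "take (Suc (Suc k)) ys = alternating (Suc (Suc k)) a b"
        using Suc.prems len unfolding ys_def hds by (simp add: take_butlast)
      with tx oky show ?case by blast
    qed
    from this[of "n - 1"] obtain a b us us' where ok: "ok us us'"
      and t: "take n us = alternating n a b" "take n us' = alternating n b a"
      using pos by auto
    have us: "us = alternating n a b" "us' = alternating n b a" using t ok by (auto simp: ok_def)
    have "a \<in> I" "b \<in> I"
      using us ok pos reducedD[of us] reducedD[of us'] by (cases n; auto simp: ok_def)+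
    then show False using braid[of a b n] ok us by (cases "a = b") (auto simp: ok_def)
  qed
qed

end

section \<open>Regular functions, morphisms and the field\<close>

text \<open>
  The polynomial that is \<open>1\<close> plus the product of all \<open>X - a\<close> with \<open>a \<in> A\<close> has no root in \<open>A\<close>.
\<close>

lemma exists_not_in_finite:
  fixes A :: "'a::alg_closed_field set"
  assumes "finite A"
  shows "\<exists>q. q \<notin> A"
proof (cases "A = {}")
  case False
  define p where "p = (\<Prod>a\<in>A. [:- a, 1:]) + 1"
  have "Polynomial.degree (\<Prod>a\<in>A. [:- a, 1:]) = card A"
    by (subst degree_prod_eq_sum_degree) auto
  moreover have "0 < card A" using False assms by (simp add: card_gt_0_iff)
  ultimately have "Polynomial.degree p = card A" unfolding p_def by (subst degree_add_eq_left) auto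
  then obtain x where x: "poly p x = 0"
    using alg_closed_imp_poly_has_root[of p] \<open>0 < card A\<close> by auto
  have "x \<notin> A"
  proof
    assume "x \<in> A"
    then have "poly (\<Prod>a\<in>A. [:- a, 1:]) x = 0" using assms by (auto simp: poly_prod)
    then show False using x by (simp add: p_def)
  qed
  then show ?thesis ..
qed auto

lemma exists_non_root:
  fixes p :: "'a::alg_closed_field poly"
  assumes "p \<noteq> 0"
  shows "\<exists>x. x \<noteq> 0 \<and> poly p x \<noteq> 0"
proof -
  have "finite (insert 0 {x. poly p x = 0})" using assms poly_roots_finite by blast
  from exists_not_in_finite[OF this] show ?thesis by auto
qed

lemma square_root_exists: "\<exists>y :: 'a::alg_closed_field. y ^ 2 = x"
  by (rule nth_root_exists) simp

lemma regular_sum: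
  assumes "finite A" "\<And>a. a \<in> A \<Longrightarrow> f a \<in> regular C"
  shows "(\<lambda>v. \<Sum>a\<in>A. f a v) \<in> regular C"
  using assms by (induction A rule: finite_induct) (auto intro: regular.intros)

lemma regular_comp:
  assumes "f \<in> regular D" and "\<And>d. d \<in> D \<Longrightarrow> (\<lambda>x. d (\<phi> x)) \<in> regular C"
  shows "(\<lambda>x. f (\<phi> x)) \<in> regular C"
  using assms by (induction rule: regular.induct) (auto intro: regular.intros)

lemma regular_pullback:
  assumes "f \<in> regular D" and "\<And>d. d \<in> D \<Longrightarrow> \<exists>g\<in>regular C. \<forall>x\<in>V. d (\<phi> x) = g x"
  shows "\<exists>g\<in>regular C. \<forall>x\<in>V. f (\<phi> x) = g x"
  using assms
proof (induction rule: regular.induct)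
  case (const c)
  show ?case by (rule bexI[of _ "\<lambda>_. c"]) (auto intro: regular.const)
next
  case (add f g)
  from add.IH(1) add.prems obtain f' where f': "f' \<in> regular C" "\<forall>x\<in>V. f (\<phi> x) = f' x" by blast
  from add.IH(2) add.prems obtain g' where g': "g' \<in> regular C" "\<forall>x\<in>V. g (\<phi> x) = g' x" by blast
  from f' g' show ?case by (intro bexI[of _ "\<lambda>v. f' v + g' v"]) (auto intro: regular.add)
next
  case (mult f g)
  from mult.IH(1) mult.prems obtain f' where f': "f' \<in> regular C" "\<forall>x\<in>V. f (\<phi> x) = f' x" by blast
  from mult.IH(2) mult.prems obtain g' where g': "g' \<in> regular C" "\<forall>x\<in>V. g (\<phi> x) = g' x" by blast
  from f' g' show ?case by (intro bexI[of _ "\<lambda>v. f' v * g' v"]) (auto intro: regular.mult)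
qed auto

lemma alg_homD:
  assumes "\<phi> \<in> alg_hom H C K D"
  shows "\<phi> \<in> hom H K" "x \<in> carrier H \<Longrightarrow> \<phi> x \<in> carrier K"
    "d \<in> D \<Longrightarrow> \<exists>f\<in>regular C. \<forall>x\<in>carrier H. d (\<phi> x) = f x"
    "\<lbrakk>x \<in> carrier H; y \<in> carrier H\<rbrakk> \<Longrightarrow> \<phi> (x \<otimes>\<^bsub>H\<^esub> y) = \<phi> x \<otimes>\<^bsub>K\<^esub> \<phi> y"
  using assms unfolding alg_hom_def alg_morphism_def hom_def by auto

lemma alg_homI:
  assumes "\<And>x. x \<in> carrier H \<Longrightarrow> \<phi> x \<in> carrier K"
    and "\<And>x y. \<lbrakk>x \<in> carrier H; y \<in> carrier H\<rbrakk> \<Longrightarrow> \<phi> (x \<otimes>\<^bsub>H\<^esub> y) = \<phi> x \<otimes>\<^bsub>K\<^esub> \<phi> y"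
    and "\<And>d. d \<in> D \<Longrightarrow> \<exists>f\<in>regular C. \<forall>x\<in>carrier H. d (\<phi> x) = f x"
  shows "\<phi> \<in> alg_hom H C K D"
  unfolding alg_hom_def alg_morphism_def hom_def using assms by blast

lemma alg_hom_comp:
  assumes "\<phi> \<in> alg_hom H C K D" "\<psi> \<in> alg_hom K D L E"
  shows "(\<lambda>x. \<psi> (\<phi> x)) \<in> alg_hom H C L E"
proof (rule alg_homI)
  fix d assume "d \<in> E"
  from alg_homD(3)[OF assms(2) this] obtain f
    where f: "f \<in> regular D" "\<forall>y\<in>carrier K. d (\<psi> y) = f y" by (elim bexE)
  have "\<exists>g\<in>regular C. \<forall>x\<in>carrier H. f (\<phi> x) = g x"
    using regular_pullback[where \<phi>=\<phi> and V="carrier H", OF f(1)] alg_homD(3)[OF assms(1)] by blast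
  then obtain g where "g \<in> regular C" "\<forall>x\<in>carrier H. f (\<phi> x) = g x" by (elim bexE)
  then show "\<exists>f\<in>regular C. \<forall>x\<in>carrier H. d (\<psi> (\<phi> x)) = f x"
    using f(2) alg_homD(2)[OF assms(1)] by (intro bexI[of _ g]) auto
qed (use alg_homD(2,4)[OF assms(1)] alg_homD(2,4)[OF assms(2)] in auto)

lemma alg_hom_cong:
  assumes "\<phi> \<in> alg_hom H C K D" "\<And>x. x \<in> carrier H \<Longrightarrow> \<phi> x = \<psi> x"
    and "\<And>x y. x \<in> carrier H \<Longrightarrow> y \<in> carrier H \<Longrightarrow> x \<otimes>\<^bsub>H\<^esub> y \<in> carrier H"
  shows "\<psi> \<in> alg_hom H C K D"
proof (rule alg_homI)
  fix d assume "d \<in> D"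
  from alg_homD(3)[OF assms(1) this] obtain f
    where "f \<in> regular C" "\<forall>y\<in>carrier H. d (\<phi> y) = f y" by (elim bexE)
  then show "\<exists>f\<in>regular C. \<forall>x\<in>carrier H. d (\<psi> x) = f x"
    using assms(2) by (intro bexI[of _ f]) auto
qed (use alg_homD(2,4)[OF assms(1)] assms(2,3) in auto)

lemma Ga_simps [simp]:
  "carrier Ga = UNIV" "x \<otimes>\<^bsub>Ga\<^esub> y = x + y" "\<one>\<^bsub>Ga\<^esub> = (0::'a::field)"
  by (simp_all add: Ga_def)

lemma Gm_simps [simp]:
  "carrier Gm = - {0}" "x \<otimes>\<^bsub>Gm\<^esub> y = x * y" "\<one>\<^bsub>Gm\<^esub> = (1::'a::field)"
  by (simp_all add: Gm_def)

lemma Gm_power_simps [simp]: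
  "carrier (Gm_power r) = {x. (\<forall>i<r. x i \<noteq> 0) \<and> (\<forall>i\<ge>r. x i = 1)}"
  "x \<otimes>\<^bsub>Gm_power r\<^esub> y = (\<lambda>i. x i * y i)" "\<one>\<^bsub>Gm_power r\<^esub> = (\<lambda>_. 1::'a::field)"
  by (simp_all add: Gm_power_def)

lemma regular_Gm_inverse:
  assumes "f \<in> regular Gm_coords"
  shows "(\<lambda>x. f (inverse x)) \<in> regular (Gm_coords :: ('a::field \<Rightarrow> 'a) set)"
  by (rule regular_comp[OF assms]) (auto simp: Gm_coords_def intro: regular.coord)

lemma regular_Gm_laurent:
  assumes "f \<in> regular (Gm_coords :: ('a::field \<Rightarrow> 'a) set)"
  shows "\<exists>N p. \<forall>x. x \<noteq> 0 \<longrightarrow> x ^ N * f x = poly p x"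
  using assms
proof (induction rule: regular.induct)
  case (const c)
  show ?case by (rule exI[of _ 0], rule exI[of _ "[:c:]"]) simp
next
  case (coord f)
  then consider "f = (\<lambda>x. x)" | "f = inverse" by (auto simp: Gm_coords_def)
  then show ?case
  proof cases
    case 1
    show ?thesis unfolding 1 by (rule exI[of _ 0], rule exI[of _ "[:0, 1:]"]) simp
  next
    case 2
    show ?thesis unfolding 2 by (rule exI[of _ 1], rule exI[of _ "1"]) simp
  qed
next
  case (add f g)
  from add.IH(1) obtain N p where 1: "\<forall>x. x \<noteq> 0 \<longrightarrow> x ^ N * f x = poly p x" by (elim exE)
  from add.IH(2) obtain M q where 2: "\<forall>x. x \<noteq> 0 \<longrightarrow> x ^ M * g x = poly q x" by (elim exE)
  have "\<forall>x. x \<noteq> 0 \<longrightarrow> x ^ (N + M) * (f x + g x) = poly (Polynomial.monom 1 M * p + Polynomial.monom 1 N * q) x"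
  proof (intro allI impI)
    fix x :: 'a assume "x \<noteq> 0"
    have "x ^ (N + M) * (f x + g x) = x ^ M * (x ^ N * f x) + x ^ N * (x ^ M * g x)"
      by (simp add: power_add algebra_simps)
    then show "x ^ (N + M) * (f x + g x) = poly (Polynomial.monom 1 M * p + Polynomial.monom 1 N * q) x"
      using 1 2 \<open>x \<noteq> 0\<close> by (simp add: poly_monom)
  qed
  then show ?case by (intro exI)
next
  case (mult f g)
  from mult.IH(1) obtain N p where 1: "\<forall>x. x \<noteq> 0 \<longrightarrow> x ^ N * f x = poly p x" by (elim exE)
  from mult.IH(2) obtain M q where 2: "\<forall>x. x \<noteq> 0 \<longrightarrow> x ^ M * g x = poly q x" by (elim exE)
  have "\<forall>x. x \<noteq> 0 \<longrightarrow> x ^ (N + M) * (f x * g x) = poly (p * q) x"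
  proof (intro allI impI)
    fix x :: 'a assume "x \<noteq> 0"
    have "x ^ (N + M) * (f x * g x) = (x ^ N * f x) * (x ^ M * g x)"
      by (simp add: power_add algebra_simps)
    then show "x ^ (N + M) * (f x * g x) = poly (p * q) x"
      using 1 2 \<open>x \<noteq> 0\<close> by simp
  qed
  then show ?case by (intro exI)
qed

text \<open>
  Over an algebraically closed field the numerator of a nowhere vanishing Laurent polynomial has no
  root other than \<open>0\<close>.
\<close>

lemma Gm_endomorphism_power:
  fixes f :: "'a::alg_closed_field \<Rightarrow> 'a"
  assumes reg: "\<exists>g\<in>regular Gm_coords. \<forall>x. x \<noteq> 0 \<longrightarrow> f x = g x"
    and nz: "\<And>x. x \<noteq> 0 \<Longrightarrow> f x \<noteq> 0" and one: "f 1 = 1"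
  shows "\<exists>k :: int. \<forall>x. x \<noteq> 0 \<longrightarrow> f x = x powi k"
proof -
  obtain g where g: "g \<in> regular Gm_coords" "\<forall>x. x \<noteq> 0 \<longrightarrow> f x = g x" using reg by blast
  then obtain N p where p: "\<And>x. x \<noteq> 0 \<Longrightarrow> x ^ N * f x = poly p x"
    using regular_Gm_laurent[OF g(1)] by force
  have "p \<noteq> 0" using p[of 1] one by auto
  define k where "k = Polynomial.order 0 p"
  obtain q where q: "p = [:- 0, 1:] ^ k * q" "\<not> [:- 0, 1:] dvd q"
    using order_decomp[OF \<open>p \<noteq> 0\<close>, of 0] unfolding k_def by blast
  have "poly q x \<noteq> 0" for x
  proof (cases "x = 0")
    case True
    then show ?thesis using q(2) by (simp add: dvd_iff_poly_eq_0)
  next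
    case False
    then show ?thesis using p[OF False] nz[OF False] q(1) by auto
  qed
  then have "Polynomial.degree q = 0" using alg_closed_imp_poly_has_root[of q] by blast
  then obtain c where c: "q = [:c:]" by (metis degree_eq_zeroE)
  have "c = 1" using p[of 1] one q(1) c by simp
  have "f x = x powi (int k - int N)" if "x \<noteq> 0" for x
  proof -
    have "x ^ N * f x = x ^ k" using p[OF that] q(1) c \<open>c = 1\<close> by simp
    then show ?thesis using that by (simp add: power_int_diff field_simps)
  qed
  then show ?thesis by blast
qed

lemma power_int_all_one:
  fixes k :: int
  assumes "\<And>x :: 'a::alg_closed_field. x \<noteq> 0 \<Longrightarrow> x powi k = 1"
  shows "k = 0"
proof (rule ccontr)
  assume "k \<noteq> 0"
  then have "nat \<bar>k\<bar> > 0" by simp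
  have "x ^ nat \<bar>k\<bar> = 1" if "x \<noteq> 0" for x :: 'a
    using assms[OF that] assms[of "inverse x"] that
    by (cases "k \<ge> 0") (auto simp: power_int_def)
  then have "poly (Polynomial.monom 1 (nat \<bar>k\<bar>) - 1) x = 0" if "x \<noteq> 0" for x :: 'a
    using that by (simp add: poly_monom)
  then have *: "Polynomial.monom 1 (nat \<bar>k\<bar>) - 1 = (0 :: 'a poly)" using exists_non_root by blast
  have "poly.coeff (Polynomial.monom 1 (nat \<bar>k\<bar>) - 1 :: 'a poly) 0 = - 1"
    using \<open>nat \<bar>k\<bar> > 0\<close> by (simp add: coeff_1)
  then show False using * by simp
qed

section \<open>The general linear group\<close>

lemma GL_simps [simp]:
  "carrier GL = {A. invertible A}" "A \<otimes>\<^bsub>GL\<^esub> B = A ** B" "\<one>\<^bsub>GL\<^esub> = (mat 1 :: 'a::field^'m^'m)"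
  by (simp_all add: GL_def)

lemma invertible_mat_1 [simp]: "invertible (mat 1 :: 'a::field^'m^'m)"
  by (auto simp: invertible_def intro!: exI[of _ "mat 1"])

lemma group_GL: "group (GL :: ('a::field^'m^'m) monoid)"
proof (rule groupI)
  fix x :: "'a^'m^'m" assume "x \<in> carrier GL"
  then obtain y where "x ** y = mat 1" "y ** x = mat 1" by (auto simp: invertible_def)
  then show "\<exists>y\<in>carrier GL. y \<otimes>\<^bsub>GL\<^esub> x = \<one>\<^bsub>GL\<^esub>" by (auto simp: invertible_def)
qed (auto simp: invertible_mult matrix_mul_assoc)

interpretation GL: group "GL :: ('a::field^'m^'m) monoid"
  by (rule group_GL)

abbreviation ginv :: "'a::field^'m^'m \<Rightarrow> 'a^'m^'m" where "ginv A \<equiv> inv\<^bsub>GL\<^esub> A"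

lemmas mul_assoc = matrix_mul_assoc[symmetric]

lemma ginv_simps [simp]:
  fixes A B :: "'a::field^'m^'m"
  assumes "invertible A"
  shows "A ** ginv A = mat 1" "ginv A ** A = mat 1" "A ** (ginv A ** B) = B"
    "ginv A ** (A ** B) = B" "invertible (ginv A)" "ginv (ginv A) = A"
proof -
  show 1: "A ** ginv A = mat 1" and 2: "ginv A ** A = mat 1"
    using GL.r_inv[of A] GL.l_inv[of A] assms by simp_all
  then show "A ** (ginv A ** B) = B" "ginv A ** (A ** B) = B"
    by (simp_all add: matrix_mul_assoc)
  show "invertible (ginv A)" "ginv (ginv A) = A"
    using GL.inv_closed[of A] GL.inv_inv[of A] assms by simp_all
qed

lemma ginv_mult [simp]:
  "invertible A \<Longrightarrow> invertible B \<Longrightarrow> ginv (A ** B) = ginv B ** ginv A"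
  using GL.inv_mult_group[of A B] by simp

lemma ginv_mat_1 [simp]: "ginv (mat 1) = mat 1"
  using GL.inv_one by simp

lemma ginv_unique:
  fixes A B :: "'a::field^'m^'m"
  assumes "A ** B = mat 1" "invertible A"
  shows "ginv A = B"
proof -
  have "ginv A = ginv A ** (A ** B)" by (simp only: assms(1) matrix_mul_rid)
  also have "\<dots> = B" by (rule ginv_simps(4)[OF assms(2)])
  finally show ?thesis .
qed

lemma mult_left_cancel_GL:
  fixes A B C :: "'a::field^'m^'m"
  assumes A: "invertible A"
  shows "A ** B = A ** C \<longleftrightarrow> B = C"
proof
  assume "A ** B = A ** C"
  then have "ginv A ** (A ** B) = ginv A ** (A ** C)" by (simp only:)
  then show "B = C" by (simp only: ginv_simps(4)[OF A])
qed simp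

lemma mult_right_cancel_GL:
  fixes A B C :: "'a::field^'m^'m"
  assumes A: "invertible A"
  shows "B ** A = C ** A \<longleftrightarrow> B = C"
proof
  assume "B ** A = C ** A"
  then have "B ** A ** ginv A = C ** A ** ginv A" by (simp only:)
  then show "B = C" by (simp only: mul_assoc ginv_simps(1)[OF A] matrix_mul_rid)
qed simp

lemma subgroup_GL_iff:
  "subgroup H GL \<longleftrightarrow> H \<subseteq> {A. invertible A} \<and> mat 1 \<in> H \<and> (\<forall>A\<in>H. \<forall>B\<in>H. A ** B \<in> H) \<and>
     (\<forall>A\<in>H. ginv A \<in> H)"
  by (auto simp: subgroup_def)

lemma regular_GL_coords_conj:
  fixes n :: "'a::field^'m^'m"
  assumes "f \<in> regular GL_coords" "invertible n"
  shows "(\<lambda>g. f (n ** g ** ginv n)) \<in> regular GL_coords"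
proof (rule regular_comp[OF assms(1)])
  fix d :: "'a^'m^'m \<Rightarrow> 'a" assume "d \<in> GL_coords"
  then consider i j where "d = (\<lambda>A. A $ i $ j)" | "d = (\<lambda>A. inverse (det A))"
    by (auto simp: GL_coords_def entries_def)
  then show "(\<lambda>g. d (n ** g ** ginv n)) \<in> regular GL_coords"
  proof cases
    case 1
    have *: "(n ** g ** ginv n) $ i $ j = (\<Sum>k\<in>UNIV. (\<Sum>l\<in>UNIV. n $ i $ l * g $ l $ k) * ginv n $ k $ j)"
      for g
      by (simp add: matrix_matrix_mult_def)
    show ?thesis unfolding 1 *
      by (intro regular_sum regular.mult regular.const regular.coord)
        (auto simp: GL_coords_def entries_def)
  next
    case 2
    have "det n * det (ginv n) = 1"
      using det_mul[of n "ginv n"] assms(2) by simp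
    then have "det (n ** g ** ginv n) = det g" for g
      by (simp add: det_mul mult.commute mult.left_commute)
    then show ?thesis unfolding 2 by (auto intro!: regular.coord simp: GL_coords_def)
  qed
qed

lemma algebraic_group_subgroup: "algebraic_group H \<Longrightarrow> subgroup H GL"
  by (simp add: algebraic_group_def)

lemma algebraic_group_conj:
  fixes n :: "'a::field^'m^'m"
  assumes U: "algebraic_group U" and n: "invertible n"
  shows "algebraic_group ((\<lambda>g. n ** g ** ginv n) ` U)"
proof -
  let ?c = "\<lambda>g. n ** g ** ginv n" and ?d = "\<lambda>g. ginv n ** g ** ginv (ginv n)"
  have sub: "subgroup U GL" using U by (rule algebraic_group_subgroup)
  then have inv: "invertible g" if "g \<in> U" for g using that by (auto simp: subgroup_GL_iff)
  have "subgroup (?c ` U) GL"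
    unfolding subgroup_GL_iff
  proof (intro conjI ballI)
    show "?c ` U \<subseteq> {A. invertible A}" using inv n by (auto intro!: invertible_mult)
    show "mat 1 \<in> ?c ` U" using sub n by (auto simp: subgroup_GL_iff intro!: image_eqI[of _ _ "mat 1"])
  next
    fix A B assume "A \<in> ?c ` U" "B \<in> ?c ` U"
    then obtain a b where ab: "a \<in> U" "b \<in> U" "A = ?c a" "B = ?c b" by blast
    show "A ** B \<in> ?c ` U"
      using ab sub n by (intro image_eqI[of _ _ "a ** b"]) (auto simp: mul_assoc subgroup_GL_iff)
  next
    fix A assume "A \<in> ?c ` U"
    then obtain a where ab: "a \<in> U" "A = ?c a" by blast
    show "ginv A \<in> ?c ` U"
      using ab sub n inv
      by (intro image_eqI[of _ _ "ginv a"]) (auto simp: mul_assoc subgroup_GL_iff invertible_mult)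
  qed
  moreover have "zariski_closed (carrier GL) GL_coords (?c ` U)"
  proof -
    obtain P where P: "P \<subseteq> regular GL_coords" "U = {x \<in> carrier GL. \<forall>f\<in>P. f x = 0}"
      using U by (auto simp: algebraic_group_def zariski_closed_def)
    let ?P = "(\<lambda>f g. f (?d g)) ` P"
    have "?P \<subseteq> regular GL_coords"
      using P(1) regular_GL_coords_conj[of _ "ginv n"] n by auto
    moreover have "?c ` U = {x \<in> carrier GL. \<forall>f\<in>?P. f x = 0}"
    proof (rule Set.set_eqI)
      fix x
      have "x \<in> ?c ` U \<longleftrightarrow> invertible x \<and> ?d x \<in> U"
      proof
        assume "x \<in> ?c ` U"
        then obtain g where g: "g \<in> U" "x = ?c g" by blast
        then have "?d x = g" "invertible x" using n inv[OF g(1)]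
          by (simp_all add: mul_assoc invertible_mult)
        with g show "invertible x \<and> ?d x \<in> U" by simp
      next
        assume x: "invertible x \<and> ?d x \<in> U"
        have "x = ?c (?d x)" using n by (simp add: mul_assoc)
        then show "x \<in> ?c ` U" using x by blast
      qed
      also have "\<dots> \<longleftrightarrow> x \<in> {x \<in> carrier GL. \<forall>f\<in>?P. f x = 0}"
        unfolding P(2) using n by (auto intro!: invertible_mult)
      finally show "x \<in> ?c ` U \<longleftrightarrow> x \<in> {x \<in> carrier GL. \<forall>f\<in>?P. f x = 0}" .
    qed
    ultimately show ?thesis unfolding zariski_closed_def by blast
  qed
  ultimately show ?thesis by (simp add: algebraic_group_def)
qed

lemma conj_alg_hom:
  fixes n :: "'a::field^'m^'m"
  assumes n: "invertible n" and U: "\<And>g. g \<in> U \<Longrightarrow> invertible g" and V: "\<And>g. g \<in> U \<Longrightarrow> n ** g ** ginv n \<in> V"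
  shows "(\<lambda>g. n ** g ** ginv n) \<in> alg_hom (sub_GL U) GL_coords (sub_GL V) GL_coords"
proof -
  have "(\<lambda>g. d (n ** g ** ginv n)) \<in> regular GL_coords" if "d \<in> GL_coords" for d
    using regular_GL_coords_conj[OF regular.coord[OF that] n] .
  then show ?thesis
    by (intro alg_homI) (use n V in \<open>auto simp: mul_assoc\<close>)
qed

lemma root_parametrization_conj:
  fixes n :: "'a::field^'m^'m"
  assumes par: "root_parametrization G T \<alpha> u U"
    and n: "invertible n" and G: "\<And>g. g \<in> G \<Longrightarrow> n ** g ** ginv n \<in> G"
    and T: "\<And>t. t \<in> T \<Longrightarrow> invertible t \<and> ginv n ** t ** n \<in> T \<and> \<alpha> (ginv n ** t ** n) = \<beta> t"
  shows "root_parametrization G T \<beta> (\<lambda>x. n ** u x ** ginv n) ((\<lambda>g. n ** g ** ginv n) ` U)"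
proof -
  let ?c = "\<lambda>g. n ** g ** ginv n" and ?d = "\<lambda>g. ginv n ** g ** ginv (ginv n)"
  let ?v = "\<lambda>x. n ** u x ** ginv n" and ?V = "?c ` U"
  have U: "algebraic_group U" "U \<subseteq> G" and iso: "u \<in> alg_iso Ga Ga_coords (sub_GL U) GL_coords"
    and act: "\<And>t x. t \<in> T \<Longrightarrow> t ** u x ** ginv t = u (\<alpha> t * x)"
    using par by (auto simp: root_parametrization_def)
  have inv: "invertible g" if "g \<in> U" for g
    using algebraic_group_subgroup[OF U(1)] that by (auto simp: subgroup_GL_iff)
  have hom: "u \<in> alg_hom Ga Ga_coords (sub_GL U) GL_coords"
    and bij: "bij_betw u UNIV U" and inv_hom: "inv_into UNIV u \<in> alg_hom (sub_GL U) GL_coords Ga Ga_coords"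
    using iso by (auto simp: alg_iso_def)
  have vhom: "?v \<in> alg_hom Ga Ga_coords (sub_GL ?V) GL_coords"
    by (rule alg_hom_comp[OF hom conj_alg_hom]) (use n inv in auto)
  have inj_c: "inj_on ?c U"
    by (rule inj_on_inverseI[of _ ?d]) (use n in \<open>simp add: mul_assoc\<close>)
  have "bij_betw (?c \<circ> u) UNIV ?V"
    by (rule bij_betw_trans[OF bij]) (use inj_c in \<open>simp add: bij_betw_def\<close>)
  then have vbij: "bij_betw ?v UNIV ?V" by (simp add: comp_def)
  have "(\<lambda>g. inv_into UNIV u (?d g)) \<in> alg_hom (sub_GL ?V) GL_coords Ga Ga_coords"
    by (rule alg_hom_comp[OF conj_alg_hom inv_hom])
      (use n inv in \<open>auto simp: mul_assoc intro!: invertible_mult\<close>)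
  moreover have "inv_into UNIV u (?d g) = inv_into UNIV ?v g" if "g \<in> ?V" for g
  proof -
    from that obtain h where h: "h \<in> U" "g = ?c h" by blast
    then obtain x where "h = u x" using bij unfolding bij_betw_def by blast
    then have x: "g = ?v x" using h by simp
    have "inv_into UNIV ?v g = x" unfolding x
      using vbij by (intro inv_into_f_f) (auto simp: bij_betw_def)
    moreover have "inv_into UNIV u (?d g) = x"
      unfolding x using bij n by (simp add: bij_betw_def mul_assoc)
    ultimately show ?thesis by simp
  qed
  moreover have "subgroup ?V GL" using algebraic_group_conj[OF U(1) n] algebraic_group_subgroup by blast
  ultimately have "inv_into UNIV ?v \<in> alg_hom (sub_GL ?V) GL_coords Ga Ga_coords"
    by (elim alg_hom_cong) (auto simp: subgroup_GL_iff)
  then have "?v \<in> alg_iso Ga Ga_coords (sub_GL ?V) GL_coords"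
    using vhom vbij by (simp add: alg_iso_def)
  moreover have "t ** ?v x ** ginv t = ?v (\<beta> t * x)" if "t \<in> T" for t x
  proof -
    let ?t = "ginv n ** t ** n"
    have t: "invertible t" "?t \<in> T" "\<alpha> ?t = \<beta> t" using T[OF that] by auto
    have "?v (\<beta> t * x) = n ** (?t ** u x ** ginv ?t) ** ginv n" using act[OF t(2)] t(3) by simp
    also have "\<dots> = t ** ?v x ** ginv t" using t(1) n by (simp add: mul_assoc invertible_mult)
    finally show ?thesis by simp
  qed
  moreover have "?V \<subseteq> G" using U(2) G by auto
  ultimately show ?thesis
    using algebraic_group_conj[OF U(1) n] by (simp add: root_parametrization_def)
qed

section \<open>Root subgroups and the elements \<open>\<sigma>\<^sub>\<alpha>\<close>\<close>

locale realized_group =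
  fixes R :: "('a::alg_closed_field, 'm::finite) realization"
  assumes realization: "is_realization R"
begin

abbreviation "G \<equiv> grp R"
abbreviation "T \<equiv> tor R"
abbreviation "N \<equiv> normalizer_torus R"
abbreviation "\<Phi> \<equiv> roots G T"
abbreviation "cor \<equiv> coroot R"
abbreviation "u \<equiv> rpar R"
abbreviation "\<sigma> \<equiv> sigma_root R"
abbreviation "neg \<equiv> neg_char T"

lemma subgroup_G: "subgroup G GL"
  using realization by (simp add: is_realization_def connected_reductive_def algebraic_group_def)

lemma torus_T: "torus T" and T_subset_G: "T \<subseteq> G"
  using realization by (simp_all add: is_realization_def maximal_torus_def)

lemma subgroup_T: "subgroup T GL"
  using torus_T by (simp add: torus_def algebraic_group_def)

lemma G_simps:
  "g \<in> G \<Longrightarrow> invertible g" "mat 1 \<in> G" "g \<in> G \<Longrightarrow> h \<in> G \<Longrightarrow> g ** h \<in> G" "g \<in> G \<Longrightarrow> ginv g \<in> G"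
  using subgroup_G unfolding subgroup_GL_iff by auto

lemma T_simps [simp]:
  "t \<in> T \<Longrightarrow> invertible t" "mat 1 \<in> T" "s \<in> T \<Longrightarrow> t \<in> T \<Longrightarrow> s ** t \<in> T" "t \<in> T \<Longrightarrow> ginv t \<in> T"
  using subgroup_T unfolding subgroup_GL_iff by auto

lemma T_comm:
  assumes "s \<in> T" "t \<in> T"
  shows "s ** t = t ** s"
proof -
  obtain r \<phi> where "\<phi> \<in> alg_iso (Gm_power r) (Gm_power_coords r) (sub_GL T) GL_coords"
    using torus_T unfolding torus_def by blast
  then have hom: "\<phi> \<in> alg_hom (Gm_power r) (Gm_power_coords r) (sub_GL T) GL_coords"
    and im: "\<phi> ` carrier (Gm_power r) = T"
    by (auto simp: alg_iso_def bij_betw_def)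
  obtain x y where "x \<in> carrier (Gm_power r)" "s = \<phi> x" "y \<in> carrier (Gm_power r)" "t = \<phi> y"
    using im assms by blast
  then show ?thesis
    using alg_homD(4)[OF hom, of x y] alg_homD(4)[OF hom, of y x] by (simp add: mult.commute)
qed

lemma T_lcomm: "s \<in> T \<Longrightarrow> t \<in> T \<Longrightarrow> s ** (t ** A) = t ** (s ** A)"
  using T_comm[of s t] by (simp only: matrix_mul_assoc)

lemma N_def': "g \<in> N \<longleftrightarrow> g \<in> G \<and> (\<lambda>t. g ** t ** ginv g) ` T = T"
  by (simp add: normalizer_torus_def)

lemma N_in_G: "g \<in> N \<Longrightarrow> g \<in> G"
  by (simp add: N_def')

lemma N_invertible [simp]: "g \<in> N \<Longrightarrow> invertible g"
  using N_in_G G_simps(1) by blast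

lemma N_conj: "g \<in> N \<Longrightarrow> t \<in> T \<Longrightarrow> g ** t ** ginv g \<in> T"
  unfolding N_def' by blast

lemma N_conj_inv:
  assumes "g \<in> N" "t \<in> T"
  shows "ginv g ** t ** g \<in> T"
proof -
  obtain s where s: "s \<in> T" "t = g ** s ** ginv g" using assms unfolding N_def' by blast
  have "ginv g ** t ** g = s" using assms(1) by (simp add: s(2) mul_assoc)
  then show ?thesis using s(1) by simp
qed

lemma N_I:
  assumes "g \<in> G" "\<And>t. t \<in> T \<Longrightarrow> g ** t ** ginv g \<in> T" "\<And>t. t \<in> T \<Longrightarrow> ginv g ** t ** g \<in> T"
  shows "g \<in> N"
proof -
  have inv: "invertible g" using assms(1) G_simps(1) by blast
  have "t \<in> (\<lambda>t. g ** t ** ginv g) ` T" if "t \<in> T" for t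
    by (rule image_eqI[of _ _ "ginv g ** t ** g"]) (use assms(3)[OF that] inv in \<open>simp_all add: mul_assoc\<close>)
  then show ?thesis using assms(1,2) unfolding N_def' by blast
qed

lemma N_mult: assumes "g \<in> N" "h \<in> N" shows "g ** h \<in> N"
proof (rule N_I)
  show "g ** h \<in> G" using assms N_in_G G_simps(3) by blast
  fix t assume t: "t \<in> T"
  show "(g ** h) ** t ** ginv (g ** h) \<in> T"
    using N_conj[OF assms(1) N_conj[OF assms(2) t]] assms by (simp add: mul_assoc)
  show "ginv (g ** h) ** t ** (g ** h) \<in> T"
    using N_conj_inv[OF assms(2) N_conj_inv[OF assms(1) t]] assms by (simp add: mul_assoc)
qed

lemma N_inv: assumes "g \<in> N" shows "ginv g \<in> N"
proof (rule N_I)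
  show "ginv g \<in> G" using assms N_in_G G_simps(4) by blast
  fix t assume t: "t \<in> T"
  show "ginv g ** t ** ginv (ginv g) \<in> T" using N_conj_inv[OF assms t] assms by simp
  show "ginv (ginv g) ** t ** ginv g \<in> T" using N_conj[OF assms t] assms by simp
qed

lemma T_in_N: assumes "t \<in> T" shows "t \<in> N"
proof (rule N_I)
  show "t \<in> G" using assms T_subset_G by blast
qed (use assms in simp_all)

lemma subgroup_N: "subgroup N GL"
  unfolding subgroup_GL_iff using N_mult N_inv T_in_N by auto

lemma rootE:
  assumes "\<alpha> \<in> \<Phi>"
  shows "\<alpha> \<in> hom (sub_GL T) Gm" "\<alpha> \<in> extensional T" "\<exists>t\<in>T. \<alpha> t \<noteq> 1"
  using assms by (auto simp: roots_def characters_def dest: alg_homD(1))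

lemma root_mult: "\<alpha> \<in> \<Phi> \<Longrightarrow> s \<in> T \<Longrightarrow> t \<in> T \<Longrightarrow> \<alpha> (s ** t) = \<alpha> s * \<alpha> t"
  using rootE(1)[of \<alpha>] by (auto simp: hom_def)

lemma root_nz [simp]: "\<alpha> \<in> \<Phi> \<Longrightarrow> t \<in> T \<Longrightarrow> \<alpha> t \<noteq> 0"
  using rootE(1)[of \<alpha>] by (auto simp: hom_def)

lemma root_one: "\<alpha> \<in> \<Phi> \<Longrightarrow> \<alpha> (mat 1) = 1"
  using root_mult[of \<alpha> "mat 1" "mat 1"] root_nz[of \<alpha> "mat 1"] by simp

lemma root_inv: "\<alpha> \<in> \<Phi> \<Longrightarrow> t \<in> T \<Longrightarrow> \<alpha> (ginv t) = inverse (\<alpha> t)"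
  using root_mult[of \<alpha> t "ginv t"] root_one[of \<alpha>] by (simp add: inverse_unique)

lemma root_eqI: "\<alpha> \<in> \<Phi> \<Longrightarrow> \<beta> \<in> \<Phi> \<Longrightarrow> (\<And>t. t \<in> T \<Longrightarrow> \<alpha> t = \<beta> t) \<Longrightarrow> \<alpha> = \<beta>"
  using rootE(2) by (metis extensionalityI)

context
  fixes \<alpha> assumes \<alpha>: "\<alpha> \<in> \<Phi>"
begin

lemma coroot_axioms:
  "is_coroot G T \<alpha> (cor \<alpha>)" "\<sigma> \<alpha> \<in> N"
  "\<exists>U. root_subgroup G T \<alpha> U \<and> root_parametrization G T \<alpha> (u \<alpha>) U"
  "t \<in> T \<Longrightarrow> \<sigma> \<alpha> ** t ** ginv (\<sigma> \<alpha>) = t ** ginv (cor \<alpha> (\<alpha> t))"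
  "x \<noteq> 0 \<Longrightarrow> u \<alpha> x ** u (neg \<alpha>) (- inverse x) ** u \<alpha> x = cor \<alpha> x ** \<sigma> \<alpha>"
  using realization \<alpha> by (auto simp: is_realization_def torus_reflection_def)

lemma coroot_in_T [simp]: "x \<noteq> 0 \<Longrightarrow> cor \<alpha> x \<in> T"
  and coroot_mult: "x \<noteq> 0 \<Longrightarrow> y \<noteq> 0 \<Longrightarrow> cor \<alpha> (x * y) = cor \<alpha> x ** cor \<alpha> y"
  and root_coroot: "x \<noteq> 0 \<Longrightarrow> \<alpha> (cor \<alpha> x) = x ^ 2"
proof -
  have hom: "cor \<alpha> \<in> alg_hom Gm Gm_coords (sub_GL T) GL_coords"
    using coroot_axioms(1) by (simp add: is_coroot_def cocharacters_def)
  show "x \<noteq> 0 \<Longrightarrow> cor \<alpha> x \<in> T" using alg_homD(2)[OF hom, of x] by simp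
  show "x \<noteq> 0 \<Longrightarrow> y \<noteq> 0 \<Longrightarrow> cor \<alpha> (x * y) = cor \<alpha> x ** cor \<alpha> y"
    using alg_homD(4)[OF hom, of x y] by simp
  show "x \<noteq> 0 \<Longrightarrow> \<alpha> (cor \<alpha> x) = x ^ 2" using coroot_axioms(1) by (simp add: is_coroot_def)
qed

lemma coroot_one [simp]: "cor \<alpha> 1 = mat 1"
proof -
  have "cor \<alpha> 1 ** cor \<alpha> 1 = cor \<alpha> 1 ** mat 1"
    using coroot_mult[of 1 1] by simp
  then show ?thesis by (rule iffD1[OF mult_left_cancel_GL, rotated]) simp
qed

lemma coroot_inverse: "x \<noteq> 0 \<Longrightarrow> ginv (cor \<alpha> x) = cor \<alpha> (inverse x)"
  using coroot_mult[of x "inverse x"] by (intro ginv_unique) simp_all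

lemma root_surj: "q \<noteq> 0 \<Longrightarrow> \<exists>t\<in>T. \<alpha> t = q"
proof -
  assume "q \<noteq> 0"
  obtain y where y: "y ^ 2 = q" using square_root_exists by blast
  then have "y \<noteq> 0" using \<open>q \<noteq> 0\<close> by auto
  then show ?thesis using root_coroot[of y] y by (intro bexI[of _ "cor \<alpha> y"]) auto
qed

lemma reflected_root:
  assumes "\<beta> \<in> \<Phi>"
  shows "(\<lambda>t\<in>T. \<beta> (\<sigma> \<alpha> ** t ** ginv (\<sigma> \<alpha>))) \<in> \<Phi>"
proof -
  have "(\<lambda>t\<in>T. \<beta> (torus_reflection \<alpha> (cor \<alpha>) t)) \<in> \<Phi>"
    using coroot_axioms(1) assms by (simp add: is_coroot_def)
  moreover have "(\<lambda>t\<in>T. \<beta> (torus_reflection \<alpha> (cor \<alpha>) t)) = (\<lambda>t\<in>T. \<beta> (\<sigma> \<alpha> ** t ** ginv (\<sigma> \<alpha>)))"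
    using coroot_axioms(4) by (intro restrict_ext) (simp add: torus_reflection_def)
  ultimately show ?thesis by simp
qed

lemma neg_apply: "t \<in> T \<Longrightarrow> neg \<alpha> t = inverse (\<alpha> t)"
  by (simp add: neg_char_def)

lemma neg_root: "neg \<alpha> \<in> \<Phi>"
proof -
  have "neg \<alpha> = (\<lambda>t\<in>T. \<alpha> (\<sigma> \<alpha> ** t ** ginv (\<sigma> \<alpha>)))"
    unfolding neg_char_def
  proof (rule restrict_ext)
    fix t assume t: "t \<in> T"
    have "\<alpha> (t ** ginv (cor \<alpha> (\<alpha> t))) = \<alpha> t * inverse (\<alpha> t ^ 2)"
      using t \<alpha> by (simp add: root_mult root_inv root_coroot)
    then show "inverse (\<alpha> t) = \<alpha> (\<sigma> \<alpha> ** t ** ginv (\<sigma> \<alpha>))"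
      using coroot_axioms(4)[OF t] t \<alpha> by (simp add: field_simps power2_eq_square)
  qed
  then show ?thesis using reflected_root[OF \<alpha>] by simp
qed

lemma root_group_hom:
  shows "u \<alpha> (x + y) = u \<alpha> x ** u \<alpha> y" "u \<alpha> 0 = mat 1" "inj (u \<alpha>)" "u \<alpha> x \<in> G"
    and "t \<in> T \<Longrightarrow> t ** u \<alpha> x ** ginv t = u \<alpha> (\<alpha> t * x)"
    and "invertible (u \<alpha> x)" "ginv (u \<alpha> x) = u \<alpha> (- x)"
proof -
  obtain U where "root_parametrization G T \<alpha> (u \<alpha>) U" using coroot_axioms(3) by blast
  then have iso: "u \<alpha> \<in> alg_iso Ga Ga_coords (sub_GL U) GL_coords" and UG: "U \<subseteq> G"
    and act: "\<And>t x. t \<in> T \<Longrightarrow> t ** u \<alpha> x ** ginv t = u \<alpha> (\<alpha> t * x)"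
    by (auto simp: root_parametrization_def)
  have hom: "u \<alpha> \<in> alg_hom Ga Ga_coords (sub_GL U) GL_coords" and bij: "bij_betw (u \<alpha>) UNIV U"
    using iso by (auto simp: alg_iso_def)
  show G: "u \<alpha> x \<in> G" for x using alg_homD(2)[OF hom, of x] UG by auto
  then show inv: "invertible (u \<alpha> x)" for x using G_simps(1) by blast
  show add: "u \<alpha> (x + y) = u \<alpha> x ** u \<alpha> y" for x y using alg_homD(4)[OF hom, of x y] by simp
  show "inj (u \<alpha>)" using bij by (simp add: bij_betw_def)
  have "u \<alpha> 0 ** u \<alpha> 0 = u \<alpha> 0 ** mat 1" using add[of 0 0] by simp
  then show zero: "u \<alpha> 0 = mat 1" using mult_left_cancel_GL[OF inv] by blast
  show "t \<in> T \<Longrightarrow> t ** u \<alpha> x ** ginv t = u \<alpha> (\<alpha> t * x)" by (rule act)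
  show "ginv (u \<alpha> x) = u \<alpha> (- x)"
    using add[of x "- x"] zero inv by (intro ginv_unique) simp_all
qed

lemma root_group_conj: "t \<in> T \<Longrightarrow> t ** u \<alpha> x = u \<alpha> (\<alpha> t * x) ** t"
proof -
  assume t: "t \<in> T"
  have "t ** u \<alpha> x = (t ** u \<alpha> x ** ginv t) ** t" using t by (simp add: mul_assoc)
  then show ?thesis using root_group_hom(5)[OF t] by simp
qed

end

text \<open>
  Uniqueness of root subgroups turns conjugation by \<open>n\<close> into a map \<open>U\<^sub>\<alpha> \<rightarrow> U\<^sub>\<beta>\<close>.  It commutes
  with the action of \<open>T\<close>, and \<open>\<beta>\<close> takes every nonzero value, so it is multiplication by a
  scalar in the coordinates \<open>u\<^sub>\<alpha>\<close>, \<open>u\<^sub>\<beta>\<close>.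
\<close>

lemma root_group_transport:
  assumes \<alpha>: "\<alpha> \<in> \<Phi>" and \<beta>: "\<beta> \<in> \<Phi>" and n: "n \<in> N"
    and \<beta>_eq: "\<And>t. t \<in> T \<Longrightarrow> \<beta> t = \<alpha> (ginv n ** t ** n)"
  shows "\<exists>c. c \<noteq> 0 \<and> (\<forall>x. n ** u \<alpha> x ** ginv n = u \<beta> (c * x))"
proof -
  obtain U where U: "root_parametrization G T \<alpha> (u \<alpha>) U" using coroot_axioms(3)[OF \<alpha>] by blast
  obtain V where V: "root_subgroup G T \<beta> V" "root_parametrization G T \<beta> (u \<beta>) V"
    using coroot_axioms(3)[OF \<beta>] by blast
  let ?v = "\<lambda>x. n ** u \<alpha> x ** ginv n"
  have "n ** g ** ginv n \<in> G" if "g \<in> G" for g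
    using N_in_G[OF n] that G_simps(3,4) by blast
  then have par: "root_parametrization G T \<beta> ?v ((\<lambda>g. n ** g ** ginv n) ` U)"
    using N_conj_inv[OF n] \<beta>_eq n by (intro root_parametrization_conj[OF U]) simp_all
  then have UV: "(\<lambda>g. n ** g ** ginv n) ` U = V" using V(1) unfolding root_subgroup_def by blast
  have "range (u \<beta>) = V"
    using V(2) by (simp add: root_parametrization_def alg_iso_def bij_betw_def)
  moreover have "range ?v = V"
    using par UV by (simp add: root_parametrization_def alg_iso_def bij_betw_def)
  ultimately obtain c where c: "?v 1 = u \<beta> c" by (metis (no_types, lifting) rangeE rangeI)
  have v0: "?v 0 = u \<beta> 0" using root_group_hom(2)[OF \<alpha>] root_group_hom(2)[OF \<beta>] n by simp
  have "?v x = u \<beta> (c * x)" for x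
  proof (cases "x = 0")
    case True
    then show ?thesis using v0 by simp
  next
    case False
    then obtain t where t: "t \<in> T" "\<beta> t = x" using root_surj[OF \<beta>] by blast
    have "?v x = t ** ?v 1 ** ginv t"
      using par t by (auto simp: root_parametrization_def)
    then show ?thesis using root_group_hom(5)[OF \<beta> t(1)] c t(2) by (simp add: mult.commute)
  qed
  moreover have "c \<noteq> 0"
  proof
    assume "c = 0"
    then have "n ** u \<alpha> 1 ** ginv n = n ** u \<alpha> 0 ** ginv n" using c v0 by simp
    then have "u \<alpha> 1 = u \<alpha> 0"
      using n by (simp add: mul_assoc mult_left_cancel_GL mult_right_cancel_GL)
    then show False using root_group_hom(3)[OF \<alpha>] by (simp add: inj_eq)
  qed
  ultimately show ?thesis by blast
qed

text \<open>
  Commutators with \<open>T\<close> remove the factor \<open>h\<close>.  Unless \<open>y = 0\<close>, comparing the additive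
  parametrizations of the two root groups under \<open>T\<close> then forces \<open>q\<^sup>2 + q + 1 = 0\<close> for all \<open>q\<close> other
  than \<open>0\<close> and \<open>-1\<close>.
\<close>

lemma opposite_root_groups:
  assumes \<beta>: "\<beta> \<in> \<Phi>" and h: "h \<in> T" and eq: "u (neg \<beta>) y = u \<beta> x ** h"
  shows "y = 0"
proof (rule ccontr)
  assume y: "y \<noteq> 0"
  note neg = neg_root[OF \<beta>]
  note act = root_group_hom(5)[OF \<beta>] root_group_hom(5)[OF neg]
  have comm: "u (neg \<beta>) ((inverse q - 1) * y) = u \<beta> ((q - 1) * x)" if "q \<noteq> 0" for q
  proof -
    obtain t where t: "t \<in> T" "\<beta> t = q" using root_surj[OF \<beta> \<open>q \<noteq> 0\<close>] by blast
    have "u (neg \<beta>) ((inverse q - 1) * y) = u (neg \<beta>) (neg \<beta> t * y) ** u (neg \<beta>) (- y)"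
      using t by (simp add: neg_apply[OF \<beta>] root_group_hom(1)[OF neg, symmetric] algebra_simps)
    also have "\<dots> = (t ** u (neg \<beta>) y ** ginv t) ** ginv (u (neg \<beta>) y)"
      using act(2)[OF t(1)] root_group_hom(7)[OF neg] by simp
    also have "\<dots> = t ** (u \<beta> x ** (h ** (ginv t ** (ginv h ** u \<beta> (- x)))))"
      unfolding eq using h root_group_hom(6,7)[OF \<beta>] by (simp add: mul_assoc)
    also have "h ** (ginv t ** (ginv h ** u \<beta> (- x))) = ginv t ** u \<beta> (- x)"
      by (subst T_lcomm[OF h T_simps(4)[OF t(1)]]) (use h in simp)
    also have "t ** (u \<beta> x ** (ginv t ** u \<beta> (- x))) = (t ** u \<beta> x ** ginv t) ** u \<beta> (- x)"
      by (simp add: mul_assoc)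
    also have "\<dots> = u \<beta> ((q - 1) * x)"
      using act(1)[OF t(1)] t(2) by (simp add: root_group_hom(1)[OF \<beta>, symmetric] algebra_simps)
    finally show ?thesis .
  qed
  obtain q1 :: 'a where q1: "q1 \<noteq> 0" "q1 \<noteq> 1"
    using exists_not_in_finite[of "{0, 1 :: 'a}"] by auto
  define z where "z = (inverse q1 - 1) * y"
  define w where "w = (q1 - 1) * x"
  have z: "z \<noteq> 0" using q1 y by (simp add: z_def)
  have zw: "u (neg \<beta>) (inverse q * z) = u \<beta> (q * w)" if "q \<noteq> 0" for q
  proof -
    obtain t where t: "t \<in> T" "\<beta> t = q" using root_surj[OF \<beta> \<open>q \<noteq> 0\<close>] by blast
    have "u (neg \<beta>) z = u \<beta> w" using comm[OF q1(1)] by (simp add: z_def w_def)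
    then show ?thesis using act(1)[OF t(1), of w] act(2)[OF t(1), of z] t by (simp add: neg_apply[OF \<beta>])
  qed
  have poly_eq: "(q + 1) ^ 2 = q" if "q \<noteq> 0" "q \<noteq> - 1" for q :: 'a
  proof -
    have "q + 1 \<noteq> 0" using that(2) by (simp add: add_eq_0_iff2)
    have "u (neg \<beta>) (inverse q * z + z) = u (neg \<beta>) (inverse q * z) ** u (neg \<beta>) (inverse 1 * z)"
      using root_group_hom(1)[OF neg] by simp
    also have "\<dots> = u \<beta> ((q + 1) * w)"
      using zw[OF that(1)] zw[of 1] by (simp add: root_group_hom(1)[OF \<beta>, symmetric] algebra_simps)
    also have "\<dots> = u (neg \<beta>) (inverse (q + 1) * z)" using zw \<open>q + 1 \<noteq> 0\<close> by simp
    finally have "inverse q * z + z = inverse (q + 1) * z"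
      using root_group_hom(3)[OF neg] by (simp add: inj_eq)
    then have "inverse q + 1 = inverse (q + 1)"
      using z by (metis distrib_right mult_1 mult_right_cancel)
    then have "(1 + q) * (q + 1) = q"
      using that \<open>q + 1 \<noteq> 0\<close> by (simp add: field_simps)
    then show ?thesis by (simp add: power2_eq_square add.commute)
  qed
  have "poly [:0, 1, 2, 2, 1:] q = 0" for q :: 'a
  proof (cases "q = 0 \<or> q = - 1")
    case True
    then show ?thesis by auto
  next
    case False
    have "poly [:0, 1, 2, 2, 1:] q = q * (q + 1) * ((q + 1) ^ 2 - q)"
      by (simp add: algebra_simps power2_eq_square)
    then show ?thesis using poly_eq False by simp
  qed
  then show False using exists_non_root[of "[:0, 1, 2, 2, 1:] :: 'a poly"] by auto
qed

text \<open>
  At \<open>x = -1\<close> the left side of the relation defining \<open>\<alpha>\<^sup>\<or>(x) \<sigma>\<^sub>\<alpha>\<close> is \<open>\<sigma>\<^sub>\<alpha>\<^sup>-\<^sup>1\<close>.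
\<close>

lemma sigma_square:
  assumes \<alpha>: "\<alpha> \<in> \<Phi>"
  shows "\<sigma> \<alpha> ** \<sigma> \<alpha> = cor \<alpha> (- 1)"
proof -
  note inv = root_group_hom(6)[OF \<alpha>] root_group_hom(6)[OF neg_root[OF \<alpha>]]
  have "cor \<alpha> (- 1) ** \<sigma> \<alpha> = ginv (\<sigma> \<alpha>)"
    using coroot_axioms(5)[OF \<alpha>, of "- 1"] inv
    by (simp add: sigma_root_def root_group_hom(7)[OF \<alpha>] root_group_hom(7)[OF neg_root[OF \<alpha>]]
        invertible_mult mul_assoc)
  then have "cor \<alpha> (- 1) ** (\<sigma> \<alpha> ** \<sigma> \<alpha>) = mat 1"
    using coroot_axioms(2)[OF \<alpha>] by (simp add: matrix_mul_assoc)
  then have "ginv (cor \<alpha> (- 1)) = \<sigma> \<alpha> ** \<sigma> \<alpha>"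
    using coroot_in_T[OF \<alpha>, of "- 1"] by (intro ginv_unique) simp_all
  then show ?thesis using coroot_inverse[OF \<alpha>, of "- 1"] by (simp add: inverse_minus_eq)
qed

text \<open>
  The triple product differs from the element of \<open>N\<close> obtained for \<open>y = 1/c\<close> by the factor
  \<open>m = u\<^sub>\<beta>(c) u\<^sub>-\<^sub>\<beta>(z) u\<^sub>\<beta>(-c)\<close> of \<open>N\<close>, where \<open>z = 1/c - y\<close>.  If \<open>z \<noteq> 0\<close>, the element \<open>u\<^sub>-\<^sub>\<beta>(z)\<close>
  lies in \<open>U\<^sub>\<beta> T \<sigma>\<^sub>\<beta> U\<^sub>\<beta>\<close>.  Since \<open>m\<close> normalizes \<open>T\<close>, comparing \<open>m\<close> with its conjugate by a
  \<open>t \<in> T\<close> such that \<open>\<beta>(t) \<noteq> 1\<close> gives an element of \<open>U\<^sub>-\<^sub>\<beta> \<inter> U\<^sub>\<beta> T\<close>, and its triviality means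
  \<open>z = 1/c\<close>, that is, \<open>y = 0\<close>.
\<close>

lemma root_triple_in_normalizer:
  assumes \<beta>: "\<beta> \<in> \<Phi>" and c: "c \<noteq> 0" and y: "y \<noteq> 0"
    and N: "u \<beta> c ** u (neg \<beta>) (- y) ** u \<beta> c \<in> N"
  shows "y = inverse c"
proof (rule ccontr)
  assume ne: "y \<noteq> inverse c"
  note neg = neg_root[OF \<beta>]
  note add = root_group_hom(1)[OF \<beta>, symmetric] and inv = root_group_hom(6)[OF \<beta>] root_group_hom(6)[OF neg]
  note invs = root_group_hom(7)[OF \<beta>] root_group_hom(7)[OF neg]
  note nadd = root_group_hom(1)[OF neg, symmetric]
  have add': "u \<beta> a ** (u \<beta> b ** B) = u \<beta> (a + b) ** B" for a b B
    using root_group_hom(1)[OF \<beta>] by (simp add: mul_assoc)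
  have nadd': "u (neg \<beta>) a ** (u (neg \<beta>) b ** B) = u (neg \<beta>) (a + b) ** B" for a b B
    using root_group_hom(1)[OF neg] by (simp add: mul_assoc)
  define z where "z = inverse c - y"
  have z: "z \<noteq> 0" using ne by (simp add: z_def)
  \<comment> \<open>The Bruhat form of an element of the opposite root group.\<close>
  define \<nu> where "\<nu> v = cor \<beta> (- inverse v) ** \<sigma> \<beta>" for v
  have \<nu>_N: "\<nu> v \<in> N" if "v \<noteq> 0" for v
    unfolding \<nu>_def using that by (intro N_mult T_in_N coroot_axioms(2)[OF \<beta>] coroot_in_T[OF \<beta>]) simp
  have bruhat: "u (neg \<beta>) v = u \<beta> (inverse v) ** (\<nu> v ** u \<beta> (inverse v))" if "v \<noteq> 0" for v
  proof -
    have "\<nu> v = u \<beta> (- inverse v) ** u (neg \<beta>) v ** u \<beta> (- inverse v)"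
      using coroot_axioms(5)[OF \<beta>, of "- inverse v"] that by (simp add: \<nu>_def)
    then show ?thesis
      using root_group_hom(2)[OF \<beta>] by (simp add: mul_assoc add add')
  qed
  define m where "m = u \<beta> c ** (u (neg \<beta>) z ** u \<beta> (- c))"
  have m: "m \<in> N"
  proof -
    let ?A = "u \<beta> c ** u (neg \<beta>) (- y) ** u \<beta> c" and ?B = "u \<beta> c ** u (neg \<beta>) (- inverse c) ** u \<beta> c"
    have B: "?B \<in> N" unfolding coroot_axioms(5)[OF \<beta> c]
      using c by (intro N_mult T_in_N coroot_axioms(2)[OF \<beta>] coroot_in_T[OF \<beta>])
    have "m = ?A ** ginv ?B"
      using inv root_group_hom(2)[OF \<beta>]
      by (simp add: m_def z_def mul_assoc invertible_mult invs add add' nadd nadd')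
    then show ?thesis using N_mult[OF N N_inv[OF B]] by simp
  qed
  obtain q where q: "q \<noteq> 0" "q \<noteq> (1::'a)"
    using exists_not_in_finite[of "{0, 1 :: 'a}"] by auto
  then obtain t where t: "t \<in> T" "\<beta> t = q" using root_surj[OF \<beta>] by blast
  define t' where "t' = m ** t ** ginv m"
  have t': "t' \<in> T" unfolding t'_def using N_conj[OF m t(1)] .
  have mt: "m ** t = t' ** m" using m by (simp add: t'_def mul_assoc)
  define h where "h = t' ** ginv t"
  have h: "h \<in> T" using t t' by (simp add: h_def)
  \<comment> \<open>The relation \<open>m t = t' m\<close>, multiplied by \<open>u\<^sub>\<beta>(-c)\<close> from the left and by \<open>u\<^sub>\<beta>(c)\<close> from the right.\<close>
  have "u (neg \<beta>) z ** (u \<beta> ((q - 1) * c) ** t) = u \<beta> (- c) ** (m ** t ** u \<beta> c)"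
    using root_group_conj[OF \<beta> t(1), of c] root_group_hom(2)[OF \<beta>] t(2)
    by (simp add: m_def mul_assoc add add' algebra_simps)
  also have "\<dots> = u \<beta> (- c) ** (t' ** (u \<beta> c ** u (neg \<beta>) z))"
    unfolding mt using root_group_hom(2)[OF \<beta>] by (simp add: m_def mul_assoc add add')
  also have "\<dots> = u \<beta> ((\<beta> t' - 1) * c) ** (t' ** u (neg \<beta>) z)"
    using root_group_conj[OF \<beta> t', of c]
    by (simp add: matrix_mul_assoc) (simp add: mul_assoc add add' algebra_simps)
  finally have key: "u (neg \<beta>) z ** (u \<beta> ((q - 1) * c) ** t) = u \<beta> ((\<beta> t' - 1) * c) ** (t' ** u (neg \<beta>) z)" .
  define d where "d = (q - 1) * c"
  define e where "e = (\<beta> t' - 1) * c"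
  have "u (neg \<beta>) z ** (u \<beta> d ** u (neg \<beta>) (- inverse q * z)) = u \<beta> e ** h"
  proof -
    have "t ** u (neg \<beta>) (- z) ** ginv t = u (neg \<beta>) (- inverse q * z)"
      using root_group_hom(5)[OF neg t(1), of "- z"] t by (simp add: neg_apply[OF \<beta>])
    then have "u (neg \<beta>) z ** (u \<beta> d ** u (neg \<beta>) (- inverse q * z))
        = (u (neg \<beta>) z ** (u \<beta> d ** t)) ** (u (neg \<beta>) (- z) ** ginv t)"
      by (simp add: mul_assoc)
    also have "\<dots> = u \<beta> e ** h"
      using key root_group_hom(2)[OF neg] unfolding d_def[symmetric] e_def[symmetric]
      by (simp add: mul_assoc nadd' h_def)
    finally show ?thesis .
  qed
  \<comment> \<open>With the Bruhat forms of both elements of \<open>U\<^sub>-\<^sub>\<beta>\<close>, only one root element between \<open>n1\<close> and \<open>n2\<close> remains.\<close>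
  moreover have "- inverse q * z \<noteq> 0" using q z by simp
  define f where "f = inverse z + (d - q * inverse z)"
  define n1 n2 where "n1 = \<nu> z" and "n2 = \<nu> (- inverse q * z)"
  have n12: "n1 \<in> N" "n2 \<in> N" using \<nu>_N z q by (simp_all add: n1_def n2_def)
  have "u (neg \<beta>) z ** (u \<beta> d ** u (neg \<beta>) (- inverse q * z))
      = u \<beta> (inverse z) ** (n1 ** (u \<beta> f ** (n2 ** u \<beta> (- q * inverse z))))"
    unfolding bruhat[OF z] bruhat[OF \<open>- inverse q * z \<noteq> 0\<close>] n1_def[symmetric] n2_def[symmetric]
    by (simp add: mul_assoc add' f_def)
  ultimately have "u \<beta> (inverse z) ** (n1 ** (u \<beta> f ** (n2 ** u \<beta> (- q * inverse z)))) = u \<beta> e ** h"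
    by simp
  then have "u \<beta> (- inverse z) ** (u \<beta> (inverse z) ** (n1 ** (u \<beta> f ** (n2 ** u \<beta> (- q * inverse z)))))
      = u \<beta> (- inverse z) ** (u \<beta> e ** h)" by (simp only:)
  then have 1: "n1 ** (u \<beta> f ** (n2 ** u \<beta> (- q * inverse z))) = u \<beta> (e - inverse z) ** h"
    using root_group_hom(2)[OF \<beta>] by (simp add: add')
  have act_n1: "neg \<beta> s = \<beta> (ginv n1 ** s ** n1)" if s: "s \<in> T" for s
  proof -
    define r where "r = ginv n1 ** s ** n1"
    have r: "r \<in> T" unfolding r_def using N_conj_inv[OF n12(1) s] .
    let ?h = "cor \<beta> (- inverse z)"
    have hT: "?h \<in> T" using z \<beta> by simp
    have sig: "\<sigma> \<beta> ** r ** ginv (\<sigma> \<beta>) = r ** ginv (cor \<beta> (\<beta> r))"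
      by (rule coroot_axioms(4)[OF \<beta> r])
    have "s = n1 ** r ** ginv n1" unfolding r_def using n12 by (simp add: mul_assoc)
    also have "\<dots> = ?h ** (\<sigma> \<beta> ** r ** ginv (\<sigma> \<beta>)) ** ginv ?h"
      unfolding n1_def \<nu>_def using hT coroot_axioms(2)[OF \<beta>] by (simp add: mul_assoc)
    also have "\<dots> = \<sigma> \<beta> ** r ** ginv (\<sigma> \<beta>)"
    proof -
      have "\<sigma> \<beta> ** r ** ginv (\<sigma> \<beta>) \<in> T" using N_conj[OF coroot_axioms(2)[OF \<beta>] r] .
      from T_comm[OF hT this] show ?thesis using hT by (simp add: mul_assoc)
    qed
    finally have "\<beta> s = \<beta> r * inverse (\<beta> r ^ 2)"
      unfolding sig using r \<beta> by (simp add: root_mult root_inv root_coroot)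
    then show ?thesis using r s \<beta> by (simp add: r_def[symmetric] neg_apply field_simps power2_eq_square)
  qed
  obtain k where k: "k \<noteq> 0" "\<And>x. n1 ** u \<beta> x ** ginv n1 = u (neg \<beta>) (k * x)"
    using root_group_transport[OF \<beta> neg n12(1) act_n1] by blast
  \<comment> \<open>It lies in \<open>T\<close>, as both factors lie in \<open>T \<sigma>\<^sub>\<beta>\<close> and the square of \<open>\<sigma>\<^sub>\<beta>\<close> lies in \<open>T\<close>.\<close>
  define l where "l = n1 ** n2"
  have "u (neg \<beta>) (k * f) = u \<beta> (e - inverse z) ** h ** u \<beta> (q * inverse z) ** ginv l"
  proof -
    have "u (neg \<beta>) (k * f) ** l ** u \<beta> (- q * inverse z) = u \<beta> (e - inverse z) ** h"
      using 1 n12 unfolding k(2)[symmetric] l_def by (simp add: mul_assoc)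
    then have "u (neg \<beta>) (k * f) ** l ** u \<beta> (- q * inverse z) ** u \<beta> (q * inverse z) ** ginv l
      = u \<beta> (e - inverse z) ** h ** u \<beta> (q * inverse z) ** ginv l" by (simp only:)
    moreover have "l \<in> N" using N_mult[OF n12] by (simp add: l_def)
    ultimately show ?thesis using root_group_hom(2)[OF \<beta>] by (simp add: mul_assoc add')
  qed
  also have "\<dots> = u \<beta> (e - inverse z + \<beta> h * (q * inverse z)) ** (h ** ginv l)"
    using root_group_conj[OF \<beta> h, of "q * inverse z"]
    by (simp add: mul_assoc[of _ h]) (simp add: mul_assoc add')
  finally have 2: "u (neg \<beta>) (k * f) = u \<beta> (e - inverse z + \<beta> h * (q * inverse z)) ** (h ** ginv l)" .
  have "l \<in> T"
  proof -
    have \<sigma>2: "\<sigma> \<beta> ** \<sigma> \<beta> \<in> T"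
      using sigma_square[OF \<beta>] coroot_in_T[OF \<beta>, of "- 1"] by simp
    have "\<sigma> \<beta> ** cor \<beta> (inverse (inverse q * z)) ** ginv (\<sigma> \<beta>) \<in> T"
      using N_conj[OF coroot_axioms(2)[OF \<beta>]] coroot_in_T[OF \<beta>] q z by simp
    moreover have "l = cor \<beta> (- inverse z) ** (\<sigma> \<beta> ** cor \<beta> (inverse (inverse q * z)) ** ginv (\<sigma> \<beta>)) ** (\<sigma> \<beta> ** \<sigma> \<beta>)"
      unfolding l_def n1_def n2_def \<nu>_def using coroot_axioms(2)[OF \<beta>] by (simp add: mul_assoc)
    ultimately show ?thesis using \<sigma>2 coroot_in_T[OF \<beta>, of "- inverse z"] z by simp
  qed
  then have "k * f = 0" using opposite_root_groups[OF \<beta> _ 2] h by simp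
  then have "f = 0" using k(1) by simp
  then have "(1 - q) * inverse z = (1 - q) * c"
    by (simp add: f_def d_def algebra_simps)
  then have "inverse z = c" using q by simp
  then have "z = inverse c" by (simp flip: \<open>inverse z = c\<close>)
  then have "y = 0" by (simp add: z_def)
  then show False using y by simp
qed

text \<open>
  Conjugation by \<open>n\<close> scales \<open>U\<^sub>\<alpha>\<close> by some \<open>c\<close> and \<open>U\<^sub>-\<^sub>\<alpha>\<close> by some \<open>y\<close>.  As the conjugate of \<open>\<sigma>\<^sub>\<alpha>\<close>
  lies in \<open>N\<close>, the two scalars are inverse to each other.
\<close>

theorem sigma_transport:
  assumes \<alpha>: "\<alpha> \<in> \<Phi>" and \<beta>: "\<beta> \<in> \<Phi>" and n: "n \<in> N"
    and \<beta>_eq: "\<And>t. t \<in> T \<Longrightarrow> \<beta> t = \<alpha> (ginv n ** t ** n)"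
  shows "\<exists>c. c \<noteq> 0 \<and> n ** \<sigma> \<alpha> ** ginv n = cor \<beta> c ** \<sigma> \<beta>"
proof -
  obtain c where c: "c \<noteq> 0" "\<And>x. n ** u \<alpha> x ** ginv n = u \<beta> (c * x)"
    using root_group_transport[OF assms] by blast
  have "neg \<beta> t = neg \<alpha> (ginv n ** t ** n)" if "t \<in> T" for t
    using \<beta>_eq[OF that] N_conj_inv[OF n that] that \<alpha> \<beta> by (simp add: neg_apply)
  then obtain y where y: "y \<noteq> 0" "\<And>x. n ** u (neg \<alpha>) x ** ginv n = u (neg \<beta>) (y * x)"
    using root_group_transport[OF neg_root[OF \<alpha>] neg_root[OF \<beta>] n] by blast
  have "n ** \<sigma> \<alpha> ** ginv n
      = (n ** u \<alpha> 1 ** ginv n) ** (n ** u (neg \<alpha>) (- 1) ** ginv n) ** (n ** u \<alpha> 1 ** ginv n)"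
    using n by (simp add: sigma_root_def mul_assoc)
  then have eq: "n ** \<sigma> \<alpha> ** ginv n = u \<beta> c ** u (neg \<beta>) (- y) ** u \<beta> c"
    unfolding c(2) y(2) by simp
  have "n ** \<sigma> \<alpha> ** ginv n \<in> N" using N_mult N_inv n coroot_axioms(2)[OF \<alpha>] by blast
  then have "y = inverse c" using root_triple_in_normalizer[OF \<beta> c(1) y(1)] eq by simp
  then show ?thesis using eq coroot_axioms(5)[OF \<beta> c(1)] c(1) by (intro exI[of _ c]) simp
qed

end

section \<open>Coordinates on the torus\<close>

lemma C_root_sum:
  assumes "i \<in> {1..n}"
  shows "(\<Sum>k=1..n. C_root n i k * f k) = (if i = n then 2 * f n else f i - f (Suc i))"
proof -
  have "C_root n i k * f k = (if k = i then (if i = n then 2 else 1) * f i else 0) +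
      (if k = Suc i then (if i = n then 0 else - 1) * f (Suc i) else 0)" for k
    by (auto simp: C_root_def)
  then show ?thesis using assms by (simp add: sum.distrib sum.delta)
qed

lemma C_cartan_eq:
  assumes "i \<in> {1..n}" "j \<in> {1..n}"
  shows "C_cartan n i j = (if i = j then 2 else if i = n \<and> Suc j = n then - 2
     else if i = Suc j \<or> j = Suc i then - 1 else 0)"
  unfolding C_cartan_def C_root_sum[OF assms(1)] C_root_sum[OF assms(2)]
  using assms by (auto simp: C_root_def)

text \<open>The value of \<open>\<alpha>\<^sub>i\<close> at \<open>(x\<^sub>1, \<dots>, x\<^sub>n)\<close>, and the action of \<open>s\<^sub>i\<close> on such a point.\<close>

definition root_value :: "nat \<Rightarrow> nat \<Rightarrow> (nat \<Rightarrow> 'a::field) \<Rightarrow> 'a" where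
  "root_value n i x = (if i = n then x n ^ 2 / x (n - 1) ^ 2
     else x i ^ 2 / ((if i = 1 then 1 else x (i - 1)) * x (i + 1)))"

definition reflect :: "nat \<Rightarrow> nat \<Rightarrow> (nat \<Rightarrow> 'a::field) \<Rightarrow> nat \<Rightarrow> 'a" where
  "reflect n i x = x(i := x i / root_value n i x)"

definition nonvanishing :: "nat \<Rightarrow> (nat \<Rightarrow> 'a::field) \<Rightarrow> bool" where
  "nonvanishing n x \<longleftrightarrow> (\<forall>k\<in>{1..n}. x k \<noteq> 0)"

lemma root_value_prod:
  fixes x :: "nat \<Rightarrow> 'a::field"
  assumes i: "i \<in> {1..n}" and n: "2 \<le> n"
  shows "(\<Prod>k=1..n. x k powi C_cartan n i k) = root_value n i x"
proof -
  let ?f = "\<lambda>k. x k powi C_cartan n i k"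
  have restrict: "(\<Prod>k=1..n. ?f k) = prod ?f A" if "A \<subseteq> {1..n}" "\<And>k. k \<in> {1..n} - A \<Longrightarrow> C_cartan n i k = 0" for A
    by (rule prod.mono_neutral_right) (use that in auto)
  consider "i = n" | "i = 1" "i \<noteq> n" | "i \<noteq> 1" "i \<noteq> n" by blast
  then show ?thesis
  proof cases
    case 1
    have "(\<Prod>k=1..n. ?f k) = prod ?f {n - 1, n}"
      by (rule restrict) (use i n 1 in \<open>auto simp: C_cartan_eq\<close>)
    also have "\<dots> = x (n - 1) powi - 2 * x n powi 2"
      using i n 1 by (subst prod.insert) (auto simp: C_cartan_eq)
    finally show ?thesis using 1 by (simp add: root_value_def power_int_minus field_simps)
  next
    case 2
    have "(\<Prod>k=1..n. ?f k) = prod ?f {1, 2}"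
      by (rule restrict) (use i n 2 in \<open>auto simp: C_cartan_eq\<close>)
    also have "\<dots> = x 1 powi 2 * x 2 powi - 1"
      using i n 2 by (subst prod.insert) (auto simp: C_cartan_eq)
    finally show ?thesis using 2 by (simp add: root_value_def power_int_minus field_simps numeral_2_eq_2)
  next
    case 3
    have "(\<Prod>k=1..n. ?f k) = prod ?f {i - 1, i, i + 1}"
      by (rule restrict) (use i n 3 in \<open>auto simp: C_cartan_eq\<close>)
    also have "\<dots> = x (i - 1) powi - 1 * (x i powi 2 * x (i + 1) powi - 1)"
    proof -
      obtain j where j: "i = Suc j" "1 \<le> j" using i 3(1) by (cases i) auto
      have "C_cartan n i (i - 1) = - 1" "C_cartan n i i = 2" "C_cartan n i (i + 1) = - 1"
        using i n 3 j by (auto simp: C_cartan_eq)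
      moreover have "i - 1 \<noteq> i" "i - 1 \<noteq> i + 1" using i by auto
      ultimately show ?thesis by simp
    qed
    finally show ?thesis using 3 by (simp add: root_value_def power_int_minus field_simps)
  qed
qed

lemma root_value_nz: "i \<in> {1..n} \<Longrightarrow> 2 \<le> n \<Longrightarrow> nonvanishing n x \<Longrightarrow> root_value n i x \<noteq> 0"
  unfolding root_value_def nonvanishing_def by (cases i; cases "i = n") auto

lemma nonvanishing_simps [simp]:
  "nonvanishing n (\<lambda>_. 1)"
  "nonvanishing n x \<Longrightarrow> nonvanishing n y \<Longrightarrow> nonvanishing n (\<lambda>k. x k * y k)"
  "nonvanishing n x \<Longrightarrow> nonvanishing n (\<lambda>k. inverse (x k))"
  "z \<noteq> 0 \<Longrightarrow> nonvanishing n (\<lambda>k. if k = i then z else 1)"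
  "z \<noteq> 0 \<Longrightarrow> nonvanishing n (\<lambda>k. z powi m k)"
  by (auto simp: nonvanishing_def)

lemma nonvanishing_reflect:
  "i \<in> {1..n} \<Longrightarrow> 2 \<le> n \<Longrightarrow> nonvanishing n x \<Longrightarrow> nonvanishing n (reflect n i x)"
  using root_value_nz[of i n x] by (auto simp: nonvanishing_def reflect_def)

text \<open>With the convention \<open>x\<^sub>0 = 1\<close> the formula for \<open>\<alpha>\<^sub>1\<close> is the one for the other short simple roots.\<close>

definition coord0 :: "(nat \<Rightarrow> 'a::field) \<Rightarrow> nat \<Rightarrow> 'a" where
  "coord0 x k = (if k = 0 then 1 else x k)"

lemma root_value_inner: "1 \<le> i \<Longrightarrow> i < n \<Longrightarrow> root_value n i x = x i ^ 2 / (coord0 x (i - 1) * x (i + 1))"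
  by (auto simp: root_value_def coord0_def)

lemma root_value_last: "root_value n n x = x n ^ 2 / x (n - 1) ^ 2"
  by (simp add: root_value_def)

lemma coord0_nz: "nonvanishing n x \<Longrightarrow> k \<le> n \<Longrightarrow> coord0 x k \<noteq> 0"
  by (auto simp: coord0_def nonvanishing_def)

lemma geometric_progression:
  fixes x :: "nat \<Rightarrow> 'a::field"
  assumes nz: "\<And>k. 1 \<le> k \<Longrightarrow> k \<le> m \<Longrightarrow> x k \<noteq> 0"
    and eq: "\<And>i. 1 \<le> i \<Longrightarrow> i < m \<Longrightarrow> x i ^ 2 = coord0 x (i - 1) * x (i + 1)"
    and k: "1 \<le> k" "k \<le> m"
  shows "x k = x 1 ^ k"
proof -
  have "coord0 x (k - 1) = x 1 ^ (k - 1) \<and> x k = x 1 ^ k"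
    using k
  proof (induction k rule: dec_induct)
    case base
    show ?case by (simp add: coord0_def)
  next
    case (step k)
    then have IH: "coord0 x (k - 1) = x 1 ^ (k - 1)" "x k = x 1 ^ k" by auto
    obtain j where j: "k = Suc j" using step.hyps(1) by (cases k) auto
    have "x 1 ^ j * x 1 ^ Suc k = x k ^ 2" unfolding IH(2) by (simp add: j power2_eq_square algebra_simps)
    also have "\<dots> = coord0 x (k - 1) * x (k + 1)" using eq[of k] step by simp
    also have "\<dots> = x 1 ^ j * x (Suc k)" unfolding IH(1) by (simp add: j)
    finally have "x (Suc k) = x 1 ^ Suc k" using nz[of 1] step by (subst (asm) mult_cancel_left) auto
    then show ?case using IH step.hyps by (simp add: coord0_def)
  qed
  then show ?thesis ..
qed

text \<open>
  The equations \<open>\<alpha>\<^sub>i(x) = 1\<close> for \<open>i < n\<close> make the coordinates a geometric progression, and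
  \<open>\<alpha>\<^sub>n(x) = 1\<close> says that its ratio \<open>x\<^sub>1\<close> has square \<open>1\<close>.
\<close>

lemma root_values_trivial:
  fixes x :: "nat \<Rightarrow> 'a::field"
  assumes n: "2 \<le> n" and x: "nonvanishing n x" and r: "\<And>i. i \<in> {1..n} \<Longrightarrow> root_value n i x = 1"
  shows "k \<in> {1..n} \<Longrightarrow> x k = x 1 ^ k" "x 1 ^ 2 = 1"
proof -
  have nz: "x k \<noteq> 0" if "k \<in> {1..n}" for k using x that by (simp add: nonvanishing_def)
  have geo: "x k = x 1 ^ k" if "1 \<le> k" "k \<le> n" for k
  proof (rule geometric_progression[OF _ _ that])
    fix i assume i: "1 \<le> i" "i < n"
    have "coord0 x (i - 1) \<noteq> 0" "x (i + 1) \<noteq> 0" using coord0_nz[OF x, of "i - 1"] nz[of "i + 1"] i by auto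
    then show "x i ^ 2 = coord0 x (i - 1) * x (i + 1)"
      using r[of i] root_value_inner[OF i, of x] i by simp
  qed (use nz in auto)
  show "x k = x 1 ^ k" if "k \<in> {1..n}" for k by (rule geo) (use that in simp_all)
  obtain m where m: "n = Suc m" "1 \<le> m" using n by (cases n) auto
  have "x n = x m * x 1" using geo[of n] geo[of m] m by (simp add: mult.commute)
  moreover have "x n ^ 2 = x m ^ 2" using r[of n] nz[of m] n m by (simp add: root_value_last)
  ultimately show "x 1 ^ 2 = 1" using nz[of m] m by (simp add: power_mult_distrib)
qed

lemma power_int_sum_prod:
  fixes z :: "'a::field"
  assumes "finite A" "z \<noteq> 0"
  shows "z powi (\<Sum>j\<in>A. f j) = (\<Prod>j\<in>A. z powi f j)"
  using assms by (induction A rule: finite_induct) (auto simp: power_int_add)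

lemma regular_power_int: "(\<lambda>x. x powi k) \<in> regular (Gm_coords :: ('a::field \<Rightarrow> 'a) set)"
proof -
  have pow: "(\<lambda>x. f x ^ m) \<in> regular Gm_coords" if "f \<in> regular Gm_coords" for f :: "'a \<Rightarrow> 'a" and m
    by (induction m) (auto intro: regular.intros that)
  show ?thesis
  proof (cases "k \<ge> 0")
    case True
    then have "(\<lambda>x::'a. x powi k) = (\<lambda>x. x ^ nat k)" by (simp add: power_int_def)
    then show ?thesis using pow[of "\<lambda>x. x"] by (auto intro: regular.coord simp: Gm_coords_def)
  next
    case False
    then have "(\<lambda>x::'a. x powi k) = (\<lambda>x. inverse x ^ nat (- k))" by (simp add: power_int_def)
    then show ?thesis using pow[of inverse] by (auto intro: regular.coord simp: Gm_coords_def)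
  qed
qed

locale realized_C_group = realized_group +
  fixes n :: nat
  assumes simply_connected: "simply_connected_grp R" and type_C: "type_C R"
    and rank: "rk R = n" and n_ge_3: "3 \<le> n"
begin

abbreviation "I \<equiv> {1..n}"
abbreviation "\<alpha> \<equiv> sroot R"
abbreviation "h \<equiv> torus_elt R"
abbreviation "TM \<equiv> sub_GL T"
abbreviation "s \<equiv> \<lambda>i. \<sigma> (\<alpha> i)"
abbreviation "nv \<equiv> nonvanishing n"

lemma n_ge_2: "2 \<le> n"
  using n_ge_3 by simp

lemma simple_root: "i \<in> I \<Longrightarrow> \<alpha> i \<in> \<Phi>"
  using realization rank by (simp add: is_realization_def is_base_def)

lemma simple_root_coroot:
  "i \<in> I \<Longrightarrow> j \<in> I \<Longrightarrow> x \<noteq> 0 \<Longrightarrow> \<alpha> i (cor (\<alpha> j) x) = x powi C_cartan n i j"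
  using type_C rank by (simp add: type_C_def)

lemma comm_group_TM: "comm_group TM"
proof -
  have "group TM" using GL.subgroup_imp_group[OF subgroup_T] .
  then show ?thesis using T_comm by (intro group.group_comm_groupI) auto
qed

sublocale TM: comm_group TM
  by (rule comm_group_TM)

lemma coroot_factors: "nv x \<Longrightarrow> (\<lambda>k. cor (\<alpha> k) (x k)) \<in> I \<rightarrow> carrier TM"
  using simple_root by (auto simp: nonvanishing_def)

lemma torus_elt_eq: "h x = finprod TM (\<lambda>k. cor (\<alpha> k) (x k)) I"
  by (simp add: torus_elt_def rank)

lemma h_in_T [simp]: "nv x \<Longrightarrow> h x \<in> T"
  unfolding torus_elt_eq using TM.finprod_closed[OF coroot_factors] by simp

lemma h_mult:
  assumes "nv x" "nv y"
  shows "h (\<lambda>k. x k * y k) = h x ** h y"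
proof -
  have "h x ** h y = finprod TM (\<lambda>k. cor (\<alpha> k) (x k) \<otimes>\<^bsub>TM\<^esub> cor (\<alpha> k) (y k)) I"
    unfolding torus_elt_eq using TM.finprod_multf[OF coroot_factors[OF assms(1)] coroot_factors[OF assms(2)]]
    by simp
  also have "\<dots> = h (\<lambda>k. x k * y k)" unfolding torus_elt_eq
    by (rule TM.finprod_cong')
      (use coroot_factors[of "\<lambda>k. x k * y k"] assms coroot_mult simple_root in
        \<open>auto simp: nonvanishing_def\<close>)
  finally show ?thesis by simp
qed

lemma h_cong:
  assumes "nv y" "\<And>k. k \<in> I \<Longrightarrow> x k = y k"
  shows "h x = h y"
  unfolding torus_elt_eq
  by (rule TM.finprod_cong') (use coroot_factors[OF assms(1)] assms in auto)

lemma h_single: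
  assumes "i \<in> I" "z \<noteq> 0"
  shows "h (\<lambda>k. if k = i then z else 1) = cor (\<alpha> i) z"
proof -
  have "h (\<lambda>k. if k = i then z else 1) = finprod TM (\<lambda>k. if i = k then cor (\<alpha> k) z else \<one>\<^bsub>TM\<^esub>) I"
    unfolding torus_elt_eq by (rule TM.finprod_cong') (use assms simple_root in auto)
  also have "\<dots> = cor (\<alpha> i) z"
    by (rule TM.finprod_singleton) (use assms simple_root in auto)
  finally show ?thesis .
qed

lemma h_one: "h (\<lambda>_. 1) = mat 1"
  using h_single[of 1 1] n_ge_3 simple_root[of 1] by (simp cong: if_cong)

lemma h_inverse: "nv x \<Longrightarrow> ginv (h x) = h (\<lambda>k. inverse (x k))"
proof (rule ginv_unique)
  assume x: "nv x"
  have "h x ** h (\<lambda>k. inverse (x k)) = h (\<lambda>k. x k * inverse (x k))"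
    using x by (simp add: h_mult)
  also have "\<dots> = h (\<lambda>_. 1)" by (rule h_cong) (use x in \<open>auto simp: nonvanishing_def\<close>)
  finally show "h x ** h (\<lambda>k. inverse (x k)) = mat 1" by (simp add: h_one)
qed simp

lemma root_h:
  assumes i: "i \<in> I" and x: "nv x"
  shows "\<alpha> i (h x) = root_value n i x"
proof -
  have "\<alpha> i (finprod TM (\<lambda>k. cor (\<alpha> k) (x k)) A) = (\<Prod>k\<in>A. x k powi C_cartan n i k)" if "A \<subseteq> I" for A
  proof -
    have "finite A" using that finite_subset by blast
    then show ?thesis using that
    proof (induction A rule: finite_induct)
      case empty
      then show ?case using root_one[OF simple_root[OF i]] by simp
    next
      case (insert k A)
      have c: "(\<lambda>k. cor (\<alpha> k) (x k)) \<in> A \<rightarrow> carrier TM" "cor (\<alpha> k) (x k) \<in> carrier TM"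
        using coroot_factors[OF x] insert.prems by auto
      then have "finprod TM (\<lambda>k. cor (\<alpha> k) (x k)) (insert k A)
          = cor (\<alpha> k) (x k) ** finprod TM (\<lambda>k. cor (\<alpha> k) (x k)) A"
        using TM.finprod_insert[OF insert.hyps c] by simp
      moreover have "finprod TM (\<lambda>k. cor (\<alpha> k) (x k)) A \<in> T"
        using TM.finprod_closed[OF c(1)] by simp
      ultimately show ?case
        using insert c x i simple_root simple_root_coroot[OF i, of k "x k"]
        by (simp add: root_mult nonvanishing_def)
    qed
  qed
  from this[of I] show ?thesis using root_value_prod[OF i n_ge_2] by (simp add: torus_elt_eq)
qed

lemma s_conj_h:
  assumes i: "i \<in> I" and x: "nv x"
  shows "s i ** h x ** ginv (s i) = h (reflect n i x)"
proof -
  note \<alpha>i = simple_root[OF i]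
  let ?r = "root_value n i x"
  have r: "?r \<noteq> 0" using root_value_nz[OF i n_ge_2 x] .
  have "s i ** h x ** ginv (s i) = h x ** ginv (cor (\<alpha> i) ?r)"
    using coroot_axioms(4)[OF \<alpha>i, of "h x"] x root_h[OF i x] by simp
  also have "\<dots> = h x ** h (\<lambda>k. if k = i then inverse ?r else 1)"
    using coroot_inverse[OF \<alpha>i r] h_single[OF i, of "inverse ?r"] r by simp
  also have "\<dots> = h (\<lambda>k. x k * (if k = i then inverse ?r else 1))"
    using x r by (simp add: h_mult)
  also have "(\<lambda>k. x k * (if k = i then inverse ?r else 1)) = reflect n i x"
    by (auto simp: reflect_def fun_eq_iff divide_inverse)
  finally show ?thesis .
qed

lemma s_h_commute:
  assumes i: "i \<in> I" and x: "nv x"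
  shows "s i ** h x = h (reflect n i x) ** s i"
proof -
  have "invertible (s i)" using coroot_axioms(2)[OF simple_root[OF i]] by simp
  then have "s i ** h x = s i ** h x ** ginv (s i) ** s i" by (simp add: mul_assoc)
  then show ?thesis by (simp only: s_conj_h[OF assms])
qed

lemma simple_coroot_cocharacter: "i \<in> I \<Longrightarrow> cor (\<alpha> i) \<in> cocharacters T"
  using coroot_axioms(1)[OF simple_root] by (simp add: is_coroot_def)

text \<open>
  This is the form in which simple connectedness is used.
\<close>

lemma cocharacterE:
  assumes "\<mu> \<in> cocharacters T"
  shows "\<exists>m :: nat \<Rightarrow> int. \<forall>x. x \<noteq> 0 \<longrightarrow> \<mu> x = h (\<lambda>k. x powi m k)"
proof -
  let ?X = "cocharacter_group T"
  have "\<mu> \<in> generate ?X ((\<lambda>i. cor (\<alpha> i)) ` I)"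
    using simply_connected assms rank by (simp add: simply_connected_grp_def cocharacter_group_def)
  then show ?thesis
  proof (induction rule: generate.induct)
    case one
    show ?case
      by (rule exI[of _ "\<lambda>_. 0"]) (simp add: h_one cocharacter_group_def)
  next
    case (incl \<nu>)
    then obtain i where i: "i \<in> I" "\<nu> = cor (\<alpha> i)" by blast
    have "(\<lambda>k. x powi (if k = i then 1 else 0)) = (\<lambda>k. if k = i then x else 1)" for x :: 'a
      by auto
    then show ?case using h_single[OF i(1)] i(2)
      by (intro exI[of _ "\<lambda>k. if k = i then 1 else 0"]) simp
  next
    case (inv \<nu>)
    then obtain i where i: "i \<in> I" "\<nu> = cor (\<alpha> i)" by blast
    note \<alpha>i = simple_root[OF i(1)]
    define \<rho> where "\<rho> = restrict (\<lambda>x. cor (\<alpha> i) (inverse x)) (- {0})"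
    have hom: "cor (\<alpha> i) \<in> alg_hom Gm Gm_coords TM GL_coords"
      using simple_coroot_cocharacter[OF i(1)] by (simp add: cocharacters_def)
    have "inverse \<in> alg_hom Gm Gm_coords Gm (Gm_coords :: ('a \<Rightarrow> 'a) set)"
    proof (rule alg_homI)
      fix d :: "'a \<Rightarrow> 'a" assume "d \<in> Gm_coords"
      then show "\<exists>f\<in>regular Gm_coords. \<forall>x\<in>carrier Gm. d (inverse x) = f x"
        by (intro bexI[OF _ regular_Gm_inverse[OF regular.coord]]) auto
    qed auto
    from alg_hom_comp[OF this hom]
    have "\<rho> \<in> alg_hom Gm Gm_coords TM GL_coords"
      by (rule alg_hom_cong) (auto simp: \<rho>_def)
    then have \<rho>: "\<rho> \<in> carrier ?X" by (simp add: cocharacter_group_def cocharacters_def \<rho>_def)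
    have "inv\<^bsub>?X\<^esub> \<nu> = \<rho>"
      unfolding m_inv_def
    proof (rule the_equality)
      have "cor (\<alpha> i) x ** cor (\<alpha> i) (inverse x) = mat 1 \<and> cor (\<alpha> i) (inverse x) ** cor (\<alpha> i) x = mat 1"
        if "x \<noteq> 0" for x
        using that coroot_inverse[OF \<alpha>i that] coroot_in_T[OF \<alpha>i that] by (simp flip: coroot_inverse[OF \<alpha>i that])
      then have "restrict (\<lambda>x. cor (\<alpha> i) x ** \<rho> x) (- {0}) = restrict (\<lambda>_. mat 1) (- {0})"
        "restrict (\<lambda>x. \<rho> x ** cor (\<alpha> i) x) (- {0}) = restrict (\<lambda>_. mat 1) (- {0})"
        by (intro restrict_ext; simp add: \<rho>_def)+
      then show "\<rho> \<in> carrier ?X \<and> \<nu> \<otimes>\<^bsub>?X\<^esub> \<rho> = \<one>\<^bsub>?X\<^esub> \<and> \<rho> \<otimes>\<^bsub>?X\<^esub> \<nu> = \<one>\<^bsub>?X\<^esub>"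
        using \<rho> by (simp add: cocharacter_group_def i(2))
    next
      fix \<kappa> assume \<kappa>: "\<kappa> \<in> carrier ?X \<and> \<nu> \<otimes>\<^bsub>?X\<^esub> \<kappa> = \<one>\<^bsub>?X\<^esub> \<and> \<kappa> \<otimes>\<^bsub>?X\<^esub> \<nu> = \<one>\<^bsub>?X\<^esub>"
      show "\<kappa> = \<rho>"
      proof (rule extensionalityI[of _ "- {0}"])
        show "\<kappa> \<in> extensional (- {0})" using \<kappa> by (simp add: cocharacter_group_def cocharacters_def)
        show "\<rho> \<in> extensional (- {0})" by (simp add: \<rho>_def)
        fix x :: 'a assume x: "x \<in> - {0}"
        have "(\<nu> \<otimes>\<^bsub>?X\<^esub> \<kappa>) x = \<one>\<^bsub>?X\<^esub> x" using \<kappa> by simp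
        then have "cor (\<alpha> i) x ** \<kappa> x = mat 1" using x by (simp add: cocharacter_group_def i(2))
        then have "ginv (cor (\<alpha> i) x) = \<kappa> x" using x \<alpha>i by (intro ginv_unique) auto
        then show "\<kappa> x = \<rho> x" using x coroot_inverse[OF \<alpha>i, of x] by (simp add: \<rho>_def)
      qed
    qed
    moreover have "\<rho> x = h (\<lambda>k. x powi (if k = i then - 1 else 0))" if "x \<noteq> 0" for x
    proof -
      have "(\<lambda>k. x powi (if k = i then - 1 else 0)) = (\<lambda>k. if k = i then inverse x else 1)"
        by (auto simp: power_int_minus)
      then show ?thesis using h_single[OF i(1), of "inverse x"] that by (simp add: \<rho>_def)
    qed
    ultimately show ?case by (intro exI[of _ "\<lambda>k. if k = i then - 1 else 0"]) simp
  next
    case (eng \<mu> \<nu>)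
    then obtain m m' :: "nat \<Rightarrow> int" where
      m: "\<And>x. x \<noteq> 0 \<Longrightarrow> \<mu> x = h (\<lambda>k. x powi m k)" "\<And>x. x \<noteq> 0 \<Longrightarrow> \<nu> x = h (\<lambda>k. x powi m' k)"
      by auto
    show ?case
    proof (intro exI[of _ "\<lambda>k. m k + m' k"] allI impI)
      fix x :: 'a assume x: "x \<noteq> 0"
      then show "(\<mu> \<otimes>\<^bsub>?X\<^esub> \<nu>) x = h (\<lambda>k. x powi (m k + m' k))"
        using m by (simp add: cocharacter_group_def power_int_add h_mult)
    qed
  qed
qed

lemma torus_chart:
  obtains r \<phi> \<psi> where
    "\<phi> \<in> alg_hom (Gm_power r) (Gm_power_coords r) TM GL_coords"
    "\<psi> \<in> alg_hom TM GL_coords (Gm_power r) (Gm_power_coords r)"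
    "\<And>t. t \<in> T \<Longrightarrow> \<phi> (\<psi> t) = t"
proof -
  obtain r \<phi> where iso: "\<phi> \<in> alg_iso (Gm_power r) (Gm_power_coords r) TM GL_coords"
    using torus_T unfolding torus_def by blast
  show ?thesis
  proof (rule that)
    show "\<phi> \<in> alg_hom (Gm_power r) (Gm_power_coords r) TM GL_coords"
      "inv_into (carrier (Gm_power r)) \<phi> \<in> alg_hom TM GL_coords (Gm_power r) (Gm_power_coords r)"
      using iso by (auto simp: alg_iso_def)
    fix t assume "t \<in> T"
    moreover have "bij_betw \<phi> (carrier (Gm_power r)) T" using iso by (simp add: alg_iso_def)
    ultimately show "\<phi> (inv_into (carrier (Gm_power r)) \<phi> t) = t"
      using bij_betw_inv_into_right[of \<phi> "carrier (Gm_power r)" T t] by blast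
  qed
qed

lemma chart_cocharacter:
  fixes m :: "nat \<Rightarrow> int"
  assumes \<phi>: "\<phi> \<in> alg_hom (Gm_power r) (Gm_power_coords r) TM GL_coords"
  shows "\<exists>p :: nat \<Rightarrow> int. \<forall>x. x \<noteq> 0 \<longrightarrow> \<phi> (\<lambda>i. if i < r then x powi m i else 1) = h (\<lambda>k. x powi p k)"
proof -
  define \<xi> where "\<xi> x = (\<lambda>i. if i < r then x powi m i else 1)" for x :: 'a
  have "\<xi> \<in> alg_hom Gm Gm_coords (Gm_power r) (Gm_power_coords r)"
  proof (rule alg_homI)
    fix d :: "(nat \<Rightarrow> 'a) \<Rightarrow> 'a" assume "d \<in> Gm_power_coords r"
    then consider i where "i < r" "d = (\<lambda>x. x i)" | i where "i < r" "d = (\<lambda>x. inverse (x i))"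
      by (auto simp: Gm_power_coords_def)
    then show "\<exists>f\<in>regular Gm_coords. \<forall>x\<in>carrier Gm. d (\<xi> x) = f x"
    proof cases
      case 1
      then show ?thesis by (intro bexI[OF _ regular_power_int[of "m i"]]) (simp add: \<xi>_def)
    next
      case 2
      then show ?thesis
        by (intro bexI[OF _ regular_power_int[of "- m i"]]) (simp add: \<xi>_def power_int_minus)
    qed
  qed (auto simp: \<xi>_def power_int_mult_distrib fun_eq_iff)
  from alg_hom_comp[OF this \<phi>]
  have "restrict (\<lambda>x. \<phi> (\<xi> x)) (- {0}) \<in> alg_hom Gm Gm_coords TM GL_coords"
    by (rule alg_hom_cong) auto
  then have "restrict (\<lambda>x. \<phi> (\<xi> x)) (- {0}) \<in> cocharacters T" by (simp add: cocharacters_def)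
  from cocharacterE[OF this] show ?thesis by (auto simp: \<xi>_def)
qed

text \<open>
  A chart \<open>Gm\<^sup>r \<rightarrow> T\<close> turns the coordinate vectors into cocharacters, which are products of simple
  coroots; hence the coordinates of the chart can be filled in one at a time.
\<close>

lemma torus_coordinates_surj:
  assumes "t \<in> T"
  shows "\<exists>x. nv x \<and> h x = t"
proof -
  obtain r \<phi> \<psi> where \<phi>: "\<phi> \<in> alg_hom (Gm_power r) (Gm_power_coords r) TM GL_coords"
    and \<psi>: "\<psi> \<in> alg_hom TM GL_coords (Gm_power r) (Gm_power_coords r)"
    and inv: "\<And>t. t \<in> T \<Longrightarrow> \<phi> (\<psi> t) = t" by (rule torus_chart) blast
  define y where "y = \<psi> t"
  have y: "\<And>i. i < r \<Longrightarrow> y i \<noteq> 0" "\<And>i. i \<ge> r \<Longrightarrow> y i = 1"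
    using alg_homD(2)[OF \<psi>, of t] assms by (auto simp: y_def)
  have "\<exists>x. nv x \<and> h x = \<phi> (\<lambda>j. if j < q then y j else 1)" if "q \<le> r" for q
    using that
  proof (induction q)
    case 0
    have "\<phi> (\<lambda>_. 1) ** \<phi> (\<lambda>_. 1) = \<phi> (\<lambda>_. 1) ** mat 1"
      using alg_homD(4)[OF \<phi>, of "\<lambda>_. 1" "\<lambda>_. 1"] by simp
    moreover have "invertible (\<phi> (\<lambda>_. 1))" using alg_homD(2)[OF \<phi>, of "\<lambda>_. 1"] by simp
    ultimately have "\<phi> (\<lambda>_. 1) = mat 1" by (rule iffD1[OF mult_left_cancel_GL, rotated])
    then show ?case using h_one by (intro exI[of _ "\<lambda>_. 1"]) simp
  next
    case (Suc q)
    then obtain x where x: "nv x" "h x = \<phi> (\<lambda>j. if j < q then y j else 1)" by auto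
    obtain p :: "nat \<Rightarrow> int" where
      p: "\<And>z. z \<noteq> 0 \<Longrightarrow> \<phi> (\<lambda>i. if i < r then z powi (if i = q then 1 else 0) else 1) = h (\<lambda>k. z powi p k)"
      using chart_cocharacter[OF \<phi>, of "\<lambda>i. if i = q then 1 else 0"] by blast
    have yq: "y q \<noteq> 0" using y(1)[of q] Suc.prems by simp
    have "\<phi> (\<lambda>j. if j < Suc q then y j else 1)
        = \<phi> ((\<lambda>j. if j < q then y j else 1) \<otimes>\<^bsub>Gm_power r\<^esub> (\<lambda>i. if i < r then y q powi (if i = q then 1 else 0) else 1))"
      using Suc.prems by (intro arg_cong[of _ _ \<phi>]) (auto simp: fun_eq_iff less_Suc_eq)
    also have "\<dots> = h x ** h (\<lambda>k. y q powi p k)"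
      using alg_homD(4)[OF \<phi>, of "\<lambda>j. if j < q then y j else 1"
          "\<lambda>i. if i < r then y q powi (if i = q then 1 else 0) else 1"]
        y yq Suc.prems x(2) p[OF yq] by auto
    also have "\<dots> = h (\<lambda>k. x k * y q powi p k)" using x yq by (simp add: h_mult)
    finally show ?case using x yq by (intro exI[of _ "\<lambda>k. x k * y q powi p k"]) simp
  qed
  from this[of r] obtain x where "nv x" "h x = \<phi> (\<lambda>j. if j < r then y j else 1)" by auto
  moreover have "(\<lambda>j. if j < r then y j else 1) = y" using y(2) by (auto simp: fun_eq_iff)
  ultimately show ?thesis using inv[OF assms] by (auto simp: y_def)
qed

text \<open>
  The values of the simple roots leave only \<open>x = (\<epsilon>, \<epsilon>\<^sup>2, \<epsilon>\<^sup>3, \<dots>)\<close> with \<open>\<epsilon>\<^sup>2 = 1\<close>.  For the cocharacter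
  \<open>\<mu>(z) = (z, z\<^sup>2, z\<^sup>3, \<dots>)\<close> this means \<open>\<mu>(\<epsilon>) = 1\<close>.  If \<open>\<epsilon> \<noteq> 1\<close>, all exponents of \<open>\<mu>\<close> in a chart
  \<open>Gm\<^sup>r \<rightarrow> T\<close> are even, so \<open>\<mu>\<close> is the square of a cocharacter.  That cocharacter is again a product
  of powers of simple coroots, and the exponent of \<open>\<alpha>\<^sub>1\<^sup>\<or>\<close> in its square would be both even and \<open>1\<close>.
\<close>

lemma h_eq_one:
  assumes x: "nv x" and hx: "h x = mat 1" and k: "k \<in> I"
  shows "x k = 1"
proof -
  have r: "root_value n i y = 1" if "i \<in> I" "nv y" "h y = mat 1" for i y
    using root_h[OF that(1,2)] root_one[OF simple_root[OF that(1)]] that(3) by simp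
  have rx: "root_value n i x = 1" if "i \<in> I" for i using r[OF that x hx] .
  have triv1: "x k = x 1 ^ k" if "k \<in> I" for k
    by (rule root_values_trivial(1)[OF n_ge_2 x rx that])
  have triv2: "x 1 ^ 2 = 1" by (rule root_values_trivial(2)[OF n_ge_2 x rx])
  have "x 1 = 1"
  proof (rule ccontr)
    assume ne: "x 1 \<noteq> 1"
    obtain r \<phi> \<psi> where \<phi>: "\<phi> \<in> alg_hom (Gm_power r) (Gm_power_coords r) TM GL_coords"
      and \<psi>: "\<psi> \<in> alg_hom TM GL_coords (Gm_power r) (Gm_power_coords r)"
      and inv: "\<And>t. t \<in> T \<Longrightarrow> \<phi> (\<psi> t) = t" by (rule torus_chart) blast
    have \<psi>_nz: "\<psi> t i \<noteq> 0" if "t \<in> T" for t i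
      using alg_homD(2)[OF \<psi>, of t] that by (cases "i < r") auto
    have \<psi>_mult: "\<psi> (s ** t) i = \<psi> s i * \<psi> t i" if "s \<in> T" "t \<in> T" for s t i
      using alg_homD(4)[OF \<psi>, of s t] that by simp
    have \<psi>_one: "\<psi> (mat 1) i = 1" for i
      using \<psi>_mult[of "mat 1" "mat 1" i] \<psi>_nz[of "mat 1" i] by simp
    have ex_L: "\<exists>l :: int. \<forall>z. z \<noteq> 0 \<longrightarrow> \<psi> (cor (\<alpha> j) z) i = z powi l" if "j \<in> I" "i < r" for j i
    proof (rule Gm_endomorphism_power)
      have "cor (\<alpha> j) \<in> alg_hom Gm Gm_coords TM GL_coords"
        using simple_coroot_cocharacter[OF that(1)] by (simp add: cocharacters_def)
      from alg_hom_comp[OF this \<psi>]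
      have "(\<lambda>z. \<psi> (cor (\<alpha> j) z)) \<in> alg_hom Gm Gm_coords (Gm_power r) (Gm_power_coords r)" .
      moreover have "(\<lambda>x. x i) \<in> (Gm_power_coords r :: ((nat \<Rightarrow> 'a) \<Rightarrow> 'a) set)"
        using that(2) by (auto simp: Gm_power_coords_def)
      ultimately show "\<exists>g\<in>regular Gm_coords. \<forall>z. z \<noteq> 0 \<longrightarrow> \<psi> (cor (\<alpha> j) z) i = g z"
        using alg_homD(3) by fastforce
    qed (use that simple_root \<psi>_nz \<psi>_one in auto)
    define L where "L j i = (SOME l :: int. \<forall>z. z \<noteq> 0 \<longrightarrow> \<psi> (cor (\<alpha> j) z) i = z powi l)" for j i
    have L: "\<psi> (cor (\<alpha> j) z) i = z powi L j i" if "j \<in> I" "i < r" "z \<noteq> 0" for j i z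
      using someI_ex[OF ex_L[OF that(1,2)]] that(3) unfolding L_def by blast
    have \<psi>_h: "\<psi> (h y) i = (\<Prod>j\<in>I. y j powi L j i)" if y: "nv y" and i: "i < r" for y i
    proof -
      have "\<psi> (finprod TM (\<lambda>j. cor (\<alpha> j) (y j)) A) i = (\<Prod>j\<in>A. y j powi L j i)" if "A \<subseteq> I" for A
      proof -
        have "finite A" using that finite_subset by blast
        then show ?thesis using that
        proof (induction A rule: finite_induct)
          case empty
          then show ?case using \<psi>_one by simp
        next
          case (insert j A)
          have c: "(\<lambda>j. cor (\<alpha> j) (y j)) \<in> A \<rightarrow> carrier TM" "cor (\<alpha> j) (y j) \<in> carrier TM"
            using coroot_factors[OF y] insert.prems by auto
          have "finprod TM (\<lambda>j. cor (\<alpha> j) (y j)) (insert j A)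
              = cor (\<alpha> j) (y j) ** finprod TM (\<lambda>j. cor (\<alpha> j) (y j)) A"
            using TM.finprod_insert[OF insert.hyps c] by simp
          moreover have "finprod TM (\<lambda>j. cor (\<alpha> j) (y j)) A \<in> T"
            using TM.finprod_closed[OF c(1)] by simp
          ultimately show ?case
            using insert c y i L[of j i "y j"] by (simp add: \<psi>_mult nonvanishing_def)
        qed
      qed
      from this[of I] show ?thesis by (simp add: torus_elt_eq)
    qed
    define l where "l i = (\<Sum>j\<in>I. int j * L j i)" for i
    have prod_l: "(\<Prod>j\<in>I. (z ^ j) powi L j i) = z powi l i" if "z \<noteq> 0" for z :: 'a and i
      using that unfolding l_def
      by (subst power_int_sum_prod) (simp_all add: power_int_mult)
    have x1: "x 1 \<noteq> 0" using x n_ge_3 by (simp add: nonvanishing_def)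
    have even: "even (l i)" if "i < r" for i
    proof (rule ccontr)
      assume "odd (l i)"
      then obtain q where q: "l i = 2 * q + 1" by (elim oddE)
      have "1 = (\<Prod>j\<in>I. x j powi L j i)" using \<psi>_h[OF x that] hx \<psi>_one by simp
      also have "\<dots> = (\<Prod>j\<in>I. (x 1 ^ j) powi L j i)" 
        using triv1 by (intro prod.cong refl arg_cong2[where f="(powi)"])
      also have "\<dots> = (x 1 ^ 2) powi q * x 1"
        unfolding prod_l[OF x1] q using x1 by (simp add: power_int_add power_int_mult)
      finally show False using triv2 ne by simp
    qed
    obtain p :: "nat \<Rightarrow> int" where
      p: "\<And>z. z \<noteq> 0 \<Longrightarrow> \<phi> (\<lambda>i. if i < r then z powi (l i div 2) else 1) = h (\<lambda>k. z powi p k)"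
      using chart_cocharacter[OF \<phi>, of "\<lambda>i. l i div 2"] by blast
    have "z powi (2 * (2 * p 1 - 1)) = 1" if z: "z \<noteq> 0" for z :: 'a
    proof -
      let ?\<xi> = "\<lambda>i. if i < r then z powi (l i div 2) else 1"
      define \<mu> where "\<mu> k = z ^ k" for k :: nat
      have nv\<mu>: "nv \<mu>" using z by (simp add: nonvanishing_def \<mu>_def)
      then have \<mu>T: "h \<mu> \<in> T" by simp
      have "?\<xi> i * ?\<xi> i = \<psi> (h \<mu>) i" for i
      proof (cases "i < r")
        case True
        have "l i = l i div 2 + l i div 2" using even[OF True] by presburger
        then have "z powi l i = z powi (l i div 2) * z powi (l i div 2)"
          using power_int_add[of z "l i div 2" "l i div 2"] z by simp
        moreover have "\<psi> (h \<mu>) i = z powi l i"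
          using \<psi>_h[OF nv\<mu> True] prod_l[OF z, of i] by (simp add: \<mu>_def)
        ultimately show ?thesis using True by simp
      next
        case False
        then show ?thesis using alg_homD(2)[OF \<psi>, of "h \<mu>"] \<mu>T by simp
      qed
      then have "?\<xi> \<otimes>\<^bsub>Gm_power r\<^esub> ?\<xi> = \<psi> (h \<mu>)" by (simp only: Gm_power_simps)
      moreover have "\<phi> (?\<xi> \<otimes>\<^bsub>Gm_power r\<^esub> ?\<xi>) = \<phi> ?\<xi> \<otimes>\<^bsub>TM\<^esub> \<phi> ?\<xi>"
        by (rule alg_homD(4)[OF \<phi>]) (use z in auto)
      ultimately have sq: "h (\<lambda>k. z powi p k) ** h (\<lambda>k. z powi p k) = h \<mu>"
        using inv[OF \<mu>T] p[OF z] by simp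
      define e where "e k = z powi p k * z powi p k * inverse (\<mu> k)" for k
      have nve: "nv e" using z nv\<mu> by (auto simp: nonvanishing_def e_def)
      have "h e = h (\<lambda>k. z powi p k) ** h (\<lambda>k. z powi p k) ** ginv (h \<mu>)"
        using z nv\<mu> by (simp add: e_def[abs_def] h_mult h_inverse)
      then have "h e = mat 1" using sq \<mu>T by simp
      then have "e 1 ^ 2 = 1" using root_values_trivial(2)[OF n_ge_2 nve r[OF _ nve]] by simp
      moreover have "e 1 = z powi (2 * p 1 - 1)"
      proof -
        have "z powi (2 * p 1 - 1) = z powi (p 1 + p 1) * inverse z"
          using z by (simp add: power_int_diff divide_inverse)
        then show ?thesis using power_int_add[of z "p 1" "p 1"] z by (simp add: e_def \<mu>_def)
      qed
      ultimately have "(z powi (2 * p 1 - 1)) ^ 2 = 1" by simp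
      then show ?thesis by (metis mult.commute power_int_mult power_int_numeral)
    qed
    then have "2 * (2 * p 1 - 1) = 0" by (rule power_int_all_one)
    then show False by presburger
  qed
  then show ?thesis using triv1[OF k] by simp
qed

lemma h_inj:
  assumes "nv x" "nv y" "h x = h y" "k \<in> I"
  shows "x k = y k"
proof -
  have "h (\<lambda>k. x k * inverse (y k)) = h x ** h (\<lambda>k. inverse (y k))"
    by (rule h_mult) (use assms(1,2) in simp_all)
  also have "\<dots> = h y ** ginv (h y)" by (simp only: assms(3) h_inverse[OF assms(2)])
  also have "\<dots> = mat 1" using h_in_T[OF assms(2)] by (intro ginv_simps(1) T_simps(1))
  finally have eq: "h (\<lambda>k. x k * inverse (y k)) = mat 1" .
  have "nv (\<lambda>k. x k * inverse (y k))" using assms(1,2) by simp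
  from h_eq_one[OF this eq assms(4)] have "x k * inverse (y k) = 1" .
  moreover have "y k \<noteq> 0" using assms(2,4) by (simp only: nonvanishing_def) blast
  ultimately show ?thesis by (simp add: divide_inverse[symmetric])
qed

lemma coroots_independent:
  assumes "i \<in> I" "j \<in> I" "i \<noteq> j" "c \<noteq> 0" "d \<noteq> 0" and eq: "cor (\<alpha> i) c ** cor (\<alpha> j) d = mat 1"
  shows "c = 1" "d = 1"
proof -
  let ?x = "\<lambda>k. (if k = i then c else 1) * (if k = j then d else 1)"
  have nv: "nv ?x" using assms(4,5) by (intro nonvanishing_simps)
  have "h ?x = h (\<lambda>k. if k = i then c else 1) ** h (\<lambda>k. if k = j then d else 1)"
    using assms(4,5) by (intro h_mult nonvanishing_simps)
  also have "\<dots> = mat 1" by (simp only: h_single[OF assms(1,4)] h_single[OF assms(2,5)] eq)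
  finally have "h ?x = mat 1" .
  from h_eq_one[OF nv this assms(1)] h_eq_one[OF nv this assms(2)] assms(3)
  show "c = 1" "d = 1" by simp_all
qed

end

section \<open>The Weyl group as a Coxeter group\<close>

lemma word_prod_GL_append: "word_prod GL f (us @ ws) = word_prod GL f us ** word_prod GL f ws"
  by (induction us) (simp_all add: mul_assoc)

lemma prod_power_int:
  fixes f :: "'i \<Rightarrow> 'a::field"
  shows "(\<Prod>i\<in>A. f i) powi k = (\<Prod>i\<in>A. f i powi k)"
  by (induction A rule: infinite_finite_induct) (simp_all add: power_int_mult_distrib)

text \<open>For \<open>i \<noteq> j\<close>, the order of \<open>s\<^sub>i s\<^sub>j\<close> in type \<open>C\<^sub>n\<close>.\<close>

definition bond :: "nat \<Rightarrow> nat \<Rightarrow> nat \<Rightarrow> nat" where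
  "bond n i j = (if Suc i = j \<or> Suc j = i then (if i = n \<or> j = n then 4 else 3) else 2)"

lemma bond_commute: "bond n i j = bond n j i"
  by (auto simp: bond_def)

context realized_C_group
begin

abbreviation "W \<equiv> weyl_group R"
abbreviation "\<pi> \<equiv> weyl_proj R"
abbreviation "r \<equiv> simple_reflection R"
abbreviation "sw \<equiv> word_prod GL s"

lemma T_normal: "T \<lhd> sub_GL N"
proof -
  interpret N: group "sub_GL N" using GL.subgroup_imp_group[OF subgroup_N] .
  have "subgroup T (sub_GL N)"
    using GL.subgroup_incl[OF subgroup_T subgroup_N] T_in_N by blast
  moreover have "x \<otimes>\<^bsub>sub_GL N\<^esub> t \<otimes>\<^bsub>sub_GL N\<^esub> inv\<^bsub>sub_GL N\<^esub> x \<in> T" if "x \<in> N" "t \<in> T" for x t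
    using N_conj[OF that] GL.m_inv_consistent[OF subgroup_N that(1)] by simp
  ultimately show ?thesis by (simp add: N.normal_inv_iff)
qed

lemma group_W: "group W"
  unfolding weyl_group_def by (rule normal.factorgroup_is_group[OF T_normal])

lemma weyl_proj_eq: "\<pi> g = (\<lambda>t. t ** g) ` T"
  by (auto simp: weyl_proj_def r_coset_def)

lemma carrier_W: "carrier W = \<pi> ` N"
  by (simp add: weyl_group_def carrier_FactGroup weyl_proj_def[abs_def])

lemma weyl_proj_mult: "g \<in> N \<Longrightarrow> g' \<in> N \<Longrightarrow> \<pi> g \<otimes>\<^bsub>W\<^esub> \<pi> g' = \<pi> (g ** g')"
  using normal.rcos_sum[OF T_normal, of g g'] by (simp add: weyl_group_def weyl_proj_def)

lemma weyl_proj_one: "\<one>\<^bsub>W\<^esub> = \<pi> (mat 1)"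
  by (simp add: weyl_group_def weyl_proj_eq)

lemma weyl_proj_eq_iff:
  assumes "g' \<in> N"
  shows "\<pi> g = \<pi> g' \<longleftrightarrow> (\<exists>t\<in>T. g = t ** g')"
proof
  assume eq: "\<pi> g = \<pi> g'"
  have "g \<in> \<pi> g" unfolding weyl_proj_eq by (rule image_eqI[of _ _ "mat 1"]) simp_all
  then have "g \<in> \<pi> g'" by (simp only: eq)
  then show "\<exists>t\<in>T. g = t ** g'" unfolding weyl_proj_eq by blast
next
  assume "\<exists>t\<in>T. g = t ** g'"
  then obtain t where t: "t \<in> T" "g = t ** g'" by blast
  show "\<pi> g = \<pi> g'"
  proof
    show "\<pi> g \<subseteq> \<pi> g'"
    proof
      fix x assume "x \<in> \<pi> g"
      then obtain q where "q \<in> T" "x = q ** g" unfolding weyl_proj_eq by blast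
      then show "x \<in> \<pi> g'" unfolding weyl_proj_eq
        using t by (intro image_eqI[of _ _ "q ** t"]) (simp_all add: mul_assoc)
    qed
    show "\<pi> g' \<subseteq> \<pi> g"
    proof
      fix x assume "x \<in> \<pi> g'"
      then obtain q where "q \<in> T" "x = q ** g'" unfolding weyl_proj_eq by blast
      then show "x \<in> \<pi> g" unfolding weyl_proj_eq
        using t by (intro image_eqI[of _ _ "q ** ginv t"]) (simp_all add: mul_assoc)
    qed
  qed
qed

lemma s_in_N: "i \<in> I \<Longrightarrow> s i \<in> N"
  by (rule coroot_axioms(2)[OF simple_root])

lemma s_invertible: "i \<in> I \<Longrightarrow> invertible (s i)"
  using s_in_N N_invertible by blast

lemma r_eq: "r i = \<pi> (s i)"
  by (simp add: simple_reflection_def)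

lemma word_in_N: "set ws \<subseteq> I \<Longrightarrow> (\<And>i. i \<in> I \<Longrightarrow> f i \<in> N) \<Longrightarrow> word_prod GL f ws \<in> N"
proof (induction ws)
  case Nil
  then show ?case using T_in_N[of "mat 1"] by simp
next
  case (Cons i ws)
  then show ?case using N_mult[of "f i"] by simp
qed

lemma sw_in_N: "set ws \<subseteq> I \<Longrightarrow> sw ws \<in> N"
  by (rule word_in_N[OF _ s_in_N])

lemma word_prod_W:
  assumes "\<And>i. i \<in> I \<Longrightarrow> f i \<in> N \<and> \<pi> (f i) = r i" "set ws \<subseteq> I"
  shows "word_prod W r ws = \<pi> (word_prod GL f ws)"
  using assms(2)
proof (induction ws)
  case Nil
  then show ?case by (simp add: weyl_proj_one)
next
  case (Cons i ws)
  then have f: "f i \<in> N" "\<pi> (f i) = r i" and ws: "set ws \<subseteq> I" using assms(1)[of i] by auto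
  have "word_prod GL f ws \<in> N" by (rule word_in_N[OF ws]) (use assms(1) in blast)
  then have "r i \<otimes>\<^bsub>W\<^esub> \<pi> (word_prod GL f ws) = \<pi> (f i ** word_prod GL f ws)"
    using weyl_proj_mult[OF f(1)] f(2) by simp
  then show ?case using Cons.IH[OF ws] by simp
qed

lemma wp_eq_sw: "set ws \<subseteq> I \<Longrightarrow> word_prod W r ws = \<pi> (sw ws)"
  by (rule word_prod_W) (simp_all add: s_in_N r_eq)

lemma s_square: "i \<in> I \<Longrightarrow> s i ** s i = cor (\<alpha> i) (- 1)"
  by (rule sigma_square[OF simple_root])

lemma r_square: "i \<in> I \<Longrightarrow> r i \<otimes>\<^bsub>W\<^esub> r i = \<one>\<^bsub>W\<^esub>"
proof -
  assume i: "i \<in> I"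
  have "s i ** s i = cor (\<alpha> i) (- 1) ** mat 1" using s_square[OF i] by simp
  moreover have "cor (\<alpha> i) (- 1) \<in> T" using coroot_in_T[OF simple_root[OF i]] by simp
  ultimately have "\<pi> (s i ** s i) = \<pi> (mat 1)"
    using weyl_proj_eq_iff[OF T_in_N[of "mat 1"]] by auto
  then show ?thesis using weyl_proj_mult[OF s_in_N[OF i] s_in_N[OF i]] by (simp add: r_eq weyl_proj_one)
qed

sublocale W: involutive_generators W I r
proof (intro involutive_generators.intro involutive_generators_axioms.intro)
  interpret WG: group W by (rule group_W)
  show "group W" by (rule group_W)
  show closed: "r i \<in> carrier W" if "i \<in> I" for i using s_in_N[OF that] by (simp add: carrier_W r_eq)
  show "r i \<otimes>\<^bsub>W\<^esub> r i = \<one>\<^bsub>W\<^esub>" if "i \<in> I" for i using r_square[OF that] .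
  fix w assume "w \<in> carrier W"
  then have "w \<in> generate W (r ` I)"
    using realization rank by (simp add: is_realization_def)
  then show "\<exists>ws. set ws \<subseteq> I \<and> word_prod W r ws = w"
  proof (induction rule: generate.induct)
    case one
    then show ?case by (intro exI[of _ "[]"]) simp
  next
    case (incl w)
    then obtain i where "i \<in> I" "w = r i" by blast
    then show ?case using closed by (intro exI[of _ "[i]"]) simp
  next
    case (inv w)
    then obtain i where i: "i \<in> I" "w = r i" by blast
    then have "inv\<^bsub>W\<^esub> w = r i" using WG.inv_equality[OF r_square[OF i(1)]] closed by blast
    then show ?case using closed i by (intro exI[of _ "[i]"]) simp
  next
    case (eng v w)
    then obtain us ws where "set us \<subseteq> I" "word_prod W r us = v" "set ws \<subseteq> I" "word_prod W r ws = w" by blast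
    moreover from this have "word_prod W r (us @ ws) = word_prod W r us \<otimes>\<^bsub>W\<^esub> word_prod W r ws"
      by (intro WG.word_prod_append) (use closed in auto)
    ultimately show ?case by (intro exI[of _ "us @ ws"]) simp
  qed
qed

lemma N_word:
  assumes "g \<in> N"
  shows "\<exists>t\<in>T. \<exists>ws. set ws \<subseteq> I \<and> g = t ** sw ws"
proof -
  have "\<pi> g \<in> carrier W" using assms by (simp add: carrier_W)
  then obtain ws where ws: "set ws \<subseteq> I" "word_prod W r ws = \<pi> g" using W.exists_word by blast
  then have "\<pi> g = \<pi> (sw ws)" using wp_eq_sw by simp
  then show ?thesis using weyl_proj_eq_iff[OF sw_in_N[OF ws(1)]] ws(1) by blast
qed

text \<open>The Weyl group acts on roots from the right, which suits exchange at the left end of a word.\<close>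

definition act :: "('a^'b^'b \<Rightarrow> 'a) \<Rightarrow> 'a^'b^'b \<Rightarrow> 'a^'b^'b \<Rightarrow> 'a" where
  "act \<beta> g = (\<lambda>t\<in>T. \<beta> (g ** t ** ginv g))"

lemma act_apply: "t \<in> T \<Longrightarrow> act \<beta> g t = \<beta> (g ** t ** ginv g)"
  by (simp add: act_def)

lemma act_act: "g \<in> N \<Longrightarrow> g' \<in> N \<Longrightarrow> act \<beta> (g ** g') = act (act \<beta> g) g'"
  unfolding act_def by (rule restrict_ext) (simp add: N_conj, simp add: mul_assoc)

lemma act_torus: assumes "\<beta> \<in> \<Phi>" "t \<in> T" "g \<in> N" shows "act \<beta> (t ** g) = act \<beta> g"
proof -
  have "act \<beta> t = \<beta>"
  proof (rule extensionalityI[of _ T])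
    show "\<beta> \<in> extensional T" using rootE(2)[OF assms(1)] .
    fix x assume x: "x \<in> T"
    have "t ** x ** ginv t = x" using T_comm[OF assms(2) x] assms(2) by (simp add: mul_assoc)
    then show "act \<beta> t x = \<beta> x" using act_apply[OF x] by simp
  qed (simp add: act_def)
  then show ?thesis using act_act[OF T_in_N[OF assms(2)] assms(3)] by simp
qed

lemma act_one: "\<beta> \<in> \<Phi> \<Longrightarrow> act \<beta> (mat 1) = \<beta>"
  by (rule extensionalityI[of _ T]) (simp_all add: act_def rootE(2))

lemma act_s_root: "\<beta> \<in> \<Phi> \<Longrightarrow> i \<in> I \<Longrightarrow> act \<beta> (s i) \<in> \<Phi>"
  unfolding act_def by (rule reflected_root[OF simple_root])

lemma act_sw_root: "set ws \<subseteq> I \<Longrightarrow> \<beta> \<in> \<Phi> \<Longrightarrow> act \<beta> (sw ws) \<in> \<Phi>"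
proof (induction ws arbitrary: \<beta>)
  case Nil
  then show ?case by (simp add: act_one)
next
  case (Cons i ws)
  then have i: "i \<in> I" "set ws \<subseteq> I" by auto
  have "act \<beta> (sw (i # ws)) = act (act \<beta> (s i)) (sw ws)"
    using act_act[OF s_in_N[OF i(1)] sw_in_N[OF i(2)]] by simp
  then show ?case using Cons.IH[OF i(2) act_s_root[OF Cons.prems(2) i(1)]] by simp
qed

lemma act_root:
  assumes "g \<in> N" "\<beta> \<in> \<Phi>"
  shows "act \<beta> g \<in> \<Phi>"
proof -
  obtain t ws where "t \<in> T" "set ws \<subseteq> I" "g = t ** sw ws" using N_word[OF assms(1)] by blast
  then show ?thesis using act_torus[OF assms(2)] act_sw_root assms(2) sw_in_N by simp
qed

definition monomial :: "(nat \<Rightarrow> int) \<Rightarrow> 'a^'b^'b \<Rightarrow> 'a" where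
  "monomial m t = (\<Prod>i\<in>I. \<alpha> i t powi m i)"

lemma simple_nz: "i \<in> I \<Longrightarrow> t \<in> T \<Longrightarrow> \<alpha> i t \<noteq> 0"
  using simple_root root_nz by blast

lemma monomial_nz: "t \<in> T \<Longrightarrow> monomial m t \<noteq> 0"
  unfolding monomial_def using simple_nz by simp

lemma monomial_unique:
  assumes "\<And>t. t \<in> T \<Longrightarrow> monomial m t = monomial m' t" "i \<in> I"
  shows "m i = m' i"
proof -
  have "(\<Prod>i=1..rk R. \<alpha> i t powi (m i - m' i)) = 1" if t: "t \<in> T" for t
  proof -
    have "(\<Prod>i\<in>I. \<alpha> i t powi (m i - m' i)) = (\<Prod>i\<in>I. \<alpha> i t powi m i / \<alpha> i t powi m' i)"
      by (rule prod.cong) (use simple_nz[OF _ t] in \<open>simp_all add: power_int_diff\<close>)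
    also have "\<dots> = monomial m t / monomial m' t" by (simp only: prod_dividef monomial_def)
    also have "\<dots> = 1" using assms(1)[OF t] monomial_nz[OF t] by simp
    finally show ?thesis using rank by simp
  qed
  moreover have "\<forall>m :: nat \<Rightarrow> int. (\<forall>t\<in>T. (\<Prod>i=1..rk R. \<alpha> i t powi m i) = 1) \<longrightarrow> (\<forall>i\<in>{1..rk R}. m i = 0)"
    using realization unfolding is_realization_def is_base_def by (elim conjE)
  from spec[OF this, of "\<lambda>i. m i - m' i"] calculation
  have "\<forall>i\<in>{1..rk R}. m i - m' i = 0" by blast
  then show ?thesis using assms(2) rank by simp
qed

lemma monomial_scale: "monomial (\<lambda>i. m i * k) t = monomial m t powi k"
  by (simp add: monomial_def prod_power_int power_int_mult)

lemma monomial_minus: "monomial (\<lambda>i. - m i) t = inverse (monomial m t)"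
  using monomial_scale[of m "- 1" t] by (simp add: power_int_minus)

lemma monomial_pair:
  assumes "i \<in> I" "j \<in> I" "i \<noteq> j" "t \<in> T"
  shows "monomial (\<lambda>k. if k = i then a else if k = j then b else 0) t = \<alpha> i t powi a * \<alpha> j t powi b"
proof -
  have "monomial (\<lambda>k. if k = i then a else if k = j then b else 0) t
      = (\<Prod>k\<in>{i, j}. \<alpha> k t powi (if k = i then a else if k = j then b else 0))"
    unfolding monomial_def by (rule prod.mono_neutral_right) (use assms in auto)
  then show ?thesis using assms(3) by simp
qed

lemma monomial_single:
  assumes "i \<in> I" "t \<in> T"
  shows "monomial (\<lambda>k. if k = i then a else 0) t = \<alpha> i t powi a"
proof -
  have "monomial (\<lambda>k. if k = i then a else 0) t = (\<Prod>k\<in>{i}. \<alpha> k t powi (if k = i then a else 0))"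
    unfolding monomial_def by (rule prod.mono_neutral_right) (use assms in auto)
  then show ?thesis by simp
qed

lemma simple_conj:
  assumes "i \<in> I" "j \<in> I" "t \<in> T"
  shows "\<alpha> i (s j ** t ** ginv (s j)) = \<alpha> i t * \<alpha> j t powi (- C_cartan n i j)"
proof -
  have nz: "\<alpha> j t \<noteq> 0" using simple_nz[OF assms(2,3)] .
  have c: "cor (\<alpha> j) (\<alpha> j t) \<in> T" using coroot_in_T[OF simple_root[OF assms(2)] nz] .
  have "\<alpha> i (s j ** t ** ginv (s j)) = \<alpha> i (t ** ginv (cor (\<alpha> j) (\<alpha> j t)))"
    using coroot_axioms(4)[OF simple_root[OF assms(2)] assms(3)] by simp
  also have "\<dots> = \<alpha> i t * inverse (\<alpha> i (cor (\<alpha> j) (\<alpha> j t)))"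
    using root_mult[OF simple_root[OF assms(1)] assms(3) T_simps(4)[OF c]]
      root_inv[OF simple_root[OF assms(1)] c] by simp
  also have "\<dots> = \<alpha> i t * \<alpha> j t powi (- C_cartan n i j)"
    using simple_root_coroot[OF assms(1,2) nz] by (simp add: power_int_minus)
  finally show ?thesis .
qed

lemma monomial_conj:
  assumes j: "j \<in> I" and t: "t \<in> T"
  shows "monomial m (s j ** t ** ginv (s j))
    = monomial (\<lambda>k. if k = j then m j - (\<Sum>i\<in>I. m i * C_cartan n i j) else m k) t"
proof -
  have nz: "\<alpha> j t \<noteq> 0" using simple_nz[OF j t] .
  have "\<alpha> i (s j ** t ** ginv (s j)) powi m i = \<alpha> i t powi m i * \<alpha> j t powi (- (m i * C_cartan n i j))"
    if "i \<in> I" for i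
  proof -
    have "(\<alpha> j t powi (- C_cartan n i j)) powi m i = \<alpha> j t powi (- (m i * C_cartan n i j))"
      using power_int_mult[of "\<alpha> j t" "- C_cartan n i j" "m i"] by (simp add: mult.commute)
    then show ?thesis by (simp only: simple_conj[OF that j t] power_int_mult_distrib)
  qed
  then have "monomial m (s j ** t ** ginv (s j)) = (\<Prod>i\<in>I. \<alpha> i t powi m i * \<alpha> j t powi (- (m i * C_cartan n i j)))"
    unfolding monomial_def by (intro prod.cong refl)
  also have "\<dots> = monomial m t * \<alpha> j t powi (\<Sum>i\<in>I. - (m i * C_cartan n i j))"
    by (simp only: prod.distrib monomial_def power_int_sum_prod[OF finite_atLeastAtMost nz])
  also have "\<dots> = monomial (\<lambda>k. if k = j then m j + (\<Sum>i\<in>I. - (m i * C_cartan n i j)) else m k) t"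
  proof -
    define e where "e = (\<Sum>i\<in>I. - (m i * C_cartan n i j))"
    have split: "prod f I = f j * prod f (I - {j})" for f :: "nat \<Rightarrow> 'a"
      using prod.remove[OF finite_atLeastAtMost j] .
    have "(\<Prod>k\<in>I - {j}. \<alpha> k t powi (if k = j then m j + e else m k)) = (\<Prod>k\<in>I - {j}. \<alpha> k t powi m k)"
      by (rule prod.cong) auto
    then have "monomial (\<lambda>k. if k = j then m j + e else m k) t
        = \<alpha> j t powi (m j + e) * (\<Prod>k\<in>I - {j}. \<alpha> k t powi m k)"
      unfolding monomial_def split[of "\<lambda>k. \<alpha> k t powi (if k = j then m j + e else m k)"] by simp
    also have "\<dots> = monomial m t * \<alpha> j t powi e"
      unfolding monomial_def split[of "\<lambda>k. \<alpha> k t powi m k"] using power_int_add[of "\<alpha> j t" "m j" e] nz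
      by simp
    finally show ?thesis by (simp only: e_def)
  qed
  finally show ?thesis by (simp only: sum_negf diff_conv_add_uminus)
qed

definition positive :: "('a^'b^'b \<Rightarrow> 'a) \<Rightarrow> bool" where
  "positive \<beta> \<longleftrightarrow> (\<exists>m. (\<forall>i\<in>I. 0 \<le> m i) \<and> (\<forall>t\<in>T. \<beta> t = monomial m t))"

lemma root_sign:
  assumes "\<beta> \<in> \<Phi>"
  shows "positive \<beta> \<or> (\<exists>m. (\<forall>i\<in>I. m i \<le> 0) \<and> (\<forall>t\<in>T. \<beta> t = monomial m t))"
proof -
  have "\<forall>\<beta>\<in>\<Phi>. \<exists>m :: nat \<Rightarrow> nat.
      (\<forall>t\<in>T. \<beta> t = (\<Prod>i=1..rk R. \<alpha> i t ^ m i)) \<or> (\<forall>t\<in>T. \<beta> t = inverse (\<Prod>i=1..rk R. \<alpha> i t ^ m i))"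
    using realization unfolding is_realization_def is_base_def by (elim conjE)
  from bspec[OF this assms] obtain m :: "nat \<Rightarrow> nat" where m:
    "(\<forall>t\<in>T. \<beta> t = (\<Prod>i=1..rk R. \<alpha> i t ^ m i)) \<or> (\<forall>t\<in>T. \<beta> t = inverse (\<Prod>i=1..rk R. \<alpha> i t ^ m i))"
    by (elim exE)
  have 1: "(\<Prod>i=1..rk R. \<alpha> i t ^ m i) = monomial (\<lambda>i. int (m i)) t" for t
    by (simp add: monomial_def rank)
  have 2: "inverse (\<Prod>i=1..rk R. \<alpha> i t ^ m i) = monomial (\<lambda>i. - int (m i)) t" for t
    unfolding 1 by (rule monomial_minus[symmetric])
  from m show ?thesis
  proof
    assume "\<forall>t\<in>T. \<beta> t = (\<Prod>i=1..rk R. \<alpha> i t ^ m i)"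
    then have "positive \<beta>" unfolding positive_def 1 by (intro exI[of _ "\<lambda>i. int (m i)"]) simp
    then show ?thesis ..
  next
    assume "\<forall>t\<in>T. \<beta> t = inverse (\<Prod>i=1..rk R. \<alpha> i t ^ m i)"
    then show ?thesis unfolding 2 by (intro disjI2 exI[of _ "\<lambda>i. - int (m i)"]) simp
  qed
qed

lemma simple_positive: "i \<in> I \<Longrightarrow> positive (\<alpha> i)"
  unfolding positive_def
  by (intro exI[of _ "\<lambda>k. if k = i then 1 else 0"]) (simp add: monomial_single)

lemma neg_not_positive:
  assumes "\<beta> \<in> \<Phi>" "positive \<beta>"
  shows "\<not> positive (neg \<beta>)"
proof
  assume "positive (neg \<beta>)"
  then obtain m' where m': "\<forall>i\<in>I. 0 \<le> m' i" "\<forall>t\<in>T. neg \<beta> t = monomial m' t" by (auto simp: positive_def)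
  obtain m where m: "\<forall>i\<in>I. 0 \<le> m i" "\<forall>t\<in>T. \<beta> t = monomial m t" using assms(2) by (auto simp: positive_def)
  have "monomial m t = monomial (\<lambda>i. - m' i) t" if "t \<in> T" for t
  proof -
    have "monomial (\<lambda>i. - m' i) t = inverse (monomial m' t)"
      by (rule monomial_minus)
    also have "\<dots> = \<beta> t" using m' that neg_apply[OF assms(1) that] by simp
    finally show ?thesis using m that by simp
  qed
  then have eq: "m i = - m' i" if "i \<in> I" for i using monomial_unique[of m "\<lambda>i. - m' i"] that by simp
  have zero: "m i = 0" if "i \<in> I" for i
    using eq[OF that] bspec[OF m(1) that] bspec[OF m'(1) that] by simp
  then have "monomial m t = 1" for t unfolding monomial_def by simp
  then show False using rootE(3)[OF assms(1)] m(2) by auto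
qed

end

context realized_C_group
begin

text \<open>
  If \<open>s\<^sub>j\<close> makes the positive root \<open>\<beta>\<close> negative, only the exponent of \<open>\<alpha>\<^sub>j\<close> in \<open>\<beta>\<close> can be
  nonzero.  Being conjugate to a simple root, \<open>\<beta>\<close> is primitive, so it is \<open>\<alpha>\<^sub>j\<close>.
\<close>

lemma sign_change:
  assumes i: "i \<in> I" and g: "g \<in> N" and \<beta>: "\<beta> = act (\<alpha> i) g" and j: "j \<in> I"
    and pos: "positive \<beta>" and neg: "\<not> positive (act \<beta> (s j))"
  shows "\<beta> = \<alpha> j"
proof -
  have \<beta>\<Phi>: "\<beta> \<in> \<Phi>" unfolding \<beta> by (rule act_root[OF g simple_root[OF i]])
  obtain m where m: "\<forall>k\<in>I. 0 \<le> m k" "\<forall>t\<in>T. \<beta> t = monomial m t" using pos by (auto simp: positive_def)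
  obtain m' where m': "\<forall>k\<in>I. m' k \<le> 0" "\<forall>t\<in>T. act \<beta> (s j) t = monomial m' t"
    using root_sign[OF act_s_root[OF \<beta>\<Phi> j]] neg by blast
  let ?q = "\<lambda>k. if k = j then m j - (\<Sum>i\<in>I. m i * C_cartan n i j) else m k"
  have "monomial m' t = monomial ?q t" if "t \<in> T" for t
  proof -
    have "monomial m' t = \<beta> (s j ** t ** ginv (s j))" using m'(2) that act_apply[OF that, of \<beta> "s j"] by simp
    also have "\<dots> = monomial m (s j ** t ** ginv (s j))" using m(2) N_conj[OF s_in_N[OF j] that] by blast
    also have "\<dots> = monomial ?q t" by (rule monomial_conj[OF j that])
    finally show ?thesis .
  qed
  then have "m' k = ?q k" if "k \<in> I" for k using monomial_unique that by blast
  then have "m' k = m k" if "k \<in> I" "k \<noteq> j" for k using that by simp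
  then have zero: "m k = 0" if "k \<in> I" "k \<noteq> j" for k
    using that bspec[OF m(1) that(1)] bspec[OF m'(1) that(1)] by simp
  have \<beta>_pow: "\<beta> t = \<alpha> j t powi m j" if t: "t \<in> T" for t
  proof -
    have "\<beta> t = monomial m t" using m(2) t by blast
    also have "\<dots> = monomial (\<lambda>k. if k = j then m j else 0) t"
      unfolding monomial_def by (rule prod.cong) (use zero in auto)
    finally show ?thesis using monomial_single[OF j t] by simp
  qed
  have "act (\<alpha> j) (ginv g) \<in> \<Phi>" by (rule act_root[OF N_inv[OF g] simple_root[OF j]])
  then obtain p where p: "\<forall>t\<in>T. act (\<alpha> j) (ginv g) t = monomial p t"
    using root_sign unfolding positive_def by blast
  have "monomial (\<lambda>k. if k = i then 1 else 0) t = monomial (\<lambda>k. p k * m j) t" if t: "t \<in> T" for t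
  proof -
    let ?t = "ginv g ** t ** g"
    have gt: "?t \<in> T" using N_conj_inv[OF g t] .
    have "monomial (\<lambda>k. p k * m j) t = monomial p t powi m j"
      by (rule monomial_scale)
    also have "\<dots> = \<alpha> j ?t powi m j" using p t g by (simp add: act_apply)
    also have "\<dots> = \<beta> ?t" using \<beta>_pow[OF gt] by simp
    also have "\<dots> = \<alpha> i t" unfolding \<beta> act_apply[OF gt] using g by (simp add: mul_assoc)
    finally show ?thesis using monomial_single[OF i t, of 1] by simp
  qed
  from monomial_unique[OF this i] have "1 = p i * m j" by simp
  moreover have "0 \<le> m j" using m(1) j by blast
  ultimately have "m j = 1" using zmult_eq_1_iff[of "p i" "m j"] by auto
  then show ?thesis using \<beta>_pow by (intro root_eqI[OF \<beta>\<Phi> simple_root[OF j]]) simp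
qed

text \<open>
  The letter \<open>v\<close> is the one at which the image of \<open>\<alpha>\<^sub>i\<close> becomes negative.  Just before it, the image is
  \<open>\<alpha>\<^sub>v\<close>, so \<open>\<sigma>\<^sub>v\<close> is transported to \<open>\<sigma>\<^sub>i\<close> up to \<open>T\<close>.
\<close>

lemma exchange_word:
  assumes i: "i \<in> I" and ws: "set ws \<subseteq> I" and neg: "\<not> positive (act (\<alpha> i) (sw ws))"
  shows "\<exists>us v vs. ws = us @ v # vs \<and> word_prod W r (i # us) = word_prod W r (us @ [v])"
proof -
  let ?P = "\<lambda>k. positive (act (\<alpha> i) (sw (take k ws)))"
  have P0: "?P 0" using simple_positive[OF i] act_one[OF simple_root[OF i]] by simp
  have "\<exists>k<length ws. ?P k \<and> \<not> ?P (Suc k)"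
  proof (rule ccontr)
    assume nex: "\<not> (\<exists>k<length ws. ?P k \<and> \<not> ?P (Suc k))"
    have "?P k" if "k \<le> length ws" for k
      using that
    proof (induction k)
      case 0
      show ?case by (rule P0)
    next
      case (Suc k)
      then show ?case using nex by (meson Suc_le_lessD Suc_leD)
    qed
    from this[of "length ws"] neg show False by simp
  qed
  then obtain k where k: "k < length ws" "?P k" "\<not> ?P (Suc k)" by blast
  define us v vs where "us = take k ws" and "v = ws ! k" and "vs = drop (Suc k) ws"
  have dec: "ws = us @ v # vs" using k(1) by (simp add: us_def v_def vs_def id_take_nth_drop)
  have I: "set us \<subseteq> I" "v \<in> I" using ws dec by auto
  note usN = sw_in_N[OF I(1)]
  have "take (Suc k) ws = us @ [v]" using k(1) by (simp add: us_def v_def take_Suc_conv_app_nth)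
  then have "act (\<alpha> i) (sw (take (Suc k) ws)) = act (act (\<alpha> i) (sw us)) (s v)"
    using act_act[OF usN s_in_N[OF I(2)]] by (simp add: word_prod_GL_append)
  then have eq: "act (\<alpha> i) (sw us) = \<alpha> v"
    using sign_change[OF i usN refl I(2)] k(2,3) by (simp add: us_def)
  have "\<alpha> i t = \<alpha> v (ginv (sw us) ** t ** sw us)" if "t \<in> T" for t
    using act_apply[OF N_conj_inv[OF usN that], of "\<alpha> i" "sw us"] eq usN by (simp add: mul_assoc)
  from sigma_transport[OF simple_root[OF I(2)] simple_root[OF i] usN this]
  obtain c where c: "c \<noteq> 0" "sw us ** s v ** ginv (sw us) = cor (\<alpha> i) c ** s i" by blast
  have "sw (us @ [v]) = sw us ** s v ** ginv (sw us) ** sw us"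
    using usN by (simp add: word_prod_GL_append mul_assoc)
  also have "\<dots> = cor (\<alpha> i) c ** sw (i # us)" unfolding c(2) by (simp add: mul_assoc)
  finally have "\<pi> (sw (us @ [v])) = \<pi> (sw (i # us))"
    using weyl_proj_eq_iff[OF sw_in_N[of "i # us"]] coroot_in_T[OF simple_root[OF i] c(1)] i I by auto
  then have "word_prod W r (i # us) = word_prod W r (us @ [v])"
    using wp_eq_sw[of "i # us"] wp_eq_sw[of "us @ [v]"] i I by auto
  then show ?thesis using dec by blast
qed

lemma act_s_self: "i \<in> I \<Longrightarrow> act (\<alpha> i) (s i) = neg (\<alpha> i)"
proof (rule root_eqI)
  assume i: "i \<in> I"
  show "act (\<alpha> i) (s i) \<in> \<Phi>" "neg (\<alpha> i) \<in> \<Phi>"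
    using act_s_root[OF simple_root[OF i] i] neg_root[OF simple_root[OF i]] .
  fix t assume t: "t \<in> T"
  have "act (\<alpha> i) (s i) t = \<alpha> i t * \<alpha> i t powi (- 2)"
    using simple_conj[OF i i t] C_cartan_eq[OF i i] by (simp only: act_apply[OF t]) simp
  also have "\<dots> = inverse (\<alpha> i t)"
    using simple_nz[OF i t] by (simp add: power_int_minus field_simps power2_eq_square)
  finally show "act (\<alpha> i) (s i) t = neg (\<alpha> i) t"
    by (simp only: neg_apply[OF simple_root[OF i] t])
qed

lemma act_neg: "g \<in> N \<Longrightarrow> \<beta> \<in> \<Phi> \<Longrightarrow> act (neg \<beta>) g = neg (act \<beta> g)"
proof (rule root_eqI)
  assume g: "g \<in> N" and \<beta>: "\<beta> \<in> \<Phi>"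
  note act\<beta> = act_root[OF g \<beta>]
  show "act (neg \<beta>) g \<in> \<Phi>" "neg (act \<beta> g) \<in> \<Phi>"
    using act_root[OF g neg_root[OF \<beta>]] neg_root[OF act\<beta>] .
  fix t assume t: "t \<in> T"
  show "act (neg \<beta>) g t = neg (act \<beta> g) t"
    by (simp only: act_apply[OF t] neg_apply[OF act\<beta> t] neg_apply[OF \<beta> N_conj[OF g t]])
qed

lemma reduced_Cons:
  assumes i: "i \<in> I" and ws: "W.reduced ws" and pos: "positive (act (\<alpha> i) (sw ws))"
  shows "W.reduced (i # ws)"
proof (rule ccontr)
  assume not_red: "\<not> W.reduced (i # ws)"
  have I: "set ws \<subseteq> I" using W.reducedD[OF ws] .
  have Ii: "set (i # ws) \<subseteq> I" using i I by simp
  obtain vs where vs: "W.reduced vs" "W.wp vs = W.wp (i # ws)"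
    using W.exists_reduced[OF W.wp_closed[OF Ii]] by blast
  have Iv: "set vs \<subseteq> I" using W.reducedD[OF vs(1)] .
  have "length vs < length (i # ws)"
  proof (rule ccontr)
    assume "\<not> length vs < length (i # ws)"
    then have "length (i # ws) \<le> length vs" by simp
    then have "W.reduced (i # ws)" by (rule W.reduced_of_length[OF vs(1) Ii vs(2)[symmetric]])
    then show False using not_red by blast
  qed
  have "\<pi> (sw vs) = \<pi> (sw (i # ws))" using vs(2) wp_eq_sw[OF Iv] wp_eq_sw[OF Ii] by simp
  then obtain t where t: "t \<in> T" "sw vs = t ** sw (i # ws)"
    using weyl_proj_eq_iff[OF sw_in_N[OF Ii]] by blast
  have "act (\<alpha> i) (sw vs) = act (\<alpha> i) (sw (i # ws))"
    unfolding t(2) by (rule act_torus[OF simple_root[OF i] t(1) sw_in_N[OF Ii]])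
  also have "\<dots> = act (act (\<alpha> i) (s i)) (sw ws)" using act_act[OF s_in_N[OF i] sw_in_N[OF I]] by simp
  also have "\<dots> = neg (act (\<alpha> i) (sw ws))"
    by (simp only: act_s_self[OF i] act_neg[OF sw_in_N[OF I] simple_root[OF i]])
  finally have "\<not> positive (act (\<alpha> i) (sw vs))"
    using neg_not_positive[OF act_sw_root[OF I simple_root[OF i]] pos] by simp
  from exchange_word[OF i Iv this] obtain us v us' where
    dec: "vs = us @ v # us'" and ex: "W.wp (i # us) = W.wp (us @ [v])" by blast
  have Iu: "set us \<subseteq> I" "v \<in> I" "set us' \<subseteq> I" using Iv dec by auto
  have "W.wp (us @ us') = W.wp us \<otimes>\<^bsub>W\<^esub> W.wp us'" by (rule W.wp_append[OF Iu(1,3)])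
  also have "W.wp us = r i \<otimes>\<^bsub>W\<^esub> W.wp (us @ [v])" using W.wp_double[OF i Iu(1)] ex by simp
  also have "r i \<otimes>\<^bsub>W\<^esub> W.wp (us @ [v]) \<otimes>\<^bsub>W\<^esub> W.wp us' = r i \<otimes>\<^bsub>W\<^esub> W.wp vs"
  proof -
    have Iuv: "set (us @ [v]) \<subseteq> I" using Iu by simp
    have "W.wp vs = W.wp (us @ [v]) \<otimes>\<^bsub>W\<^esub> W.wp us'"
      using W.wp_append[OF Iuv Iu(3)] by (simp only: dec append.assoc append.simps)
    then show ?thesis
      using W.m_assoc[OF W.s_closed[OF i] W.wp_closed[OF Iuv] W.wp_closed[OF Iu(3)]] by (simp only:)
  qed
  also have "\<dots> = W.wp ws" unfolding vs(2) by (rule W.wp_double[OF i I])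
  finally have "length ws \<le> length (us @ us')"
    using W.reduced_le[OF ws, of "us @ us'"] Iu by simp
  then show False using \<open>length vs < length (i # ws)\<close> dec by simp
qed

sublocale W: exchange_generators W I r
proof unfold_locales
  fix ws i assume "W.reduced ws" "i \<in> I" "\<not> W.reduced (i # ws)"
  then show "\<exists>us v vs. ws = us @ v # vs \<and> W.wp (i # us) = W.wp (us @ [v])"
    using exchange_word W.reducedD reduced_Cons by blast
qed

section \<open>Braid relations\<close>

definition rank2 :: "nat \<Rightarrow> nat \<Rightarrow> int \<Rightarrow> int \<Rightarrow> 'a^'b^'b \<Rightarrow> 'a" where
  "rank2 i j a b = (\<lambda>t\<in>T. \<alpha> i t powi a * \<alpha> j t powi b)"

lemma rank2_simple:
  assumes "i \<in> I"
  shows "rank2 i j 1 0 = \<alpha> i"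
  by (rule extensionalityI[of _ T]) (simp_all add: rank2_def rootE(2)[OF simple_root[OF assms]])

lemma rank2_commute: "rank2 i j a b = rank2 j i b a"
  by (simp add: rank2_def mult.commute)

lemma rank2_act:
  assumes i: "i \<in> I" and j: "j \<in> I"
  shows "act (rank2 i j a b) (s i) = rank2 i j (- a - b * C_cartan n j i) b"
  unfolding act_def rank2_def
proof (rule restrict_ext)
  fix t assume t: "t \<in> T"
  have nz: "\<alpha> i t \<noteq> 0" "\<alpha> j t \<noteq> 0" using simple_nz i j t by auto
  have "s i ** t ** ginv (s i) \<in> T" using N_conj[OF s_in_N[OF i] t] .
  then have "(\<lambda>t\<in>T. \<alpha> i t powi a * \<alpha> j t powi b) (s i ** t ** ginv (s i))
    = (\<alpha> i t * \<alpha> i t powi (- 2)) powi a * (\<alpha> j t * \<alpha> i t powi (- C_cartan n j i)) powi b"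
    using simple_conj[OF i i t] simple_conj[OF j i t] C_cartan_eq[OF i i] by simp
  also have "\<alpha> i t * \<alpha> i t powi (- 2) = \<alpha> i t powi (- 1)"
    using nz by (simp add: power_int_minus field_simps power2_eq_square)
  also have "(\<alpha> i t powi (- 1)) powi a = \<alpha> i t powi (- a)"
    by (simp only: power_int_mult[symmetric]) simp
  also have "(\<alpha> j t * \<alpha> i t powi (- C_cartan n j i)) powi b
      = \<alpha> j t powi b * \<alpha> i t powi (- (b * C_cartan n j i))"
    by (simp add: power_int_mult_distrib power_int_mult[symmetric] mult.commute)
  also have "\<alpha> i t powi (- a) * (\<alpha> j t powi b * \<alpha> i t powi (- (b * C_cartan n j i)))
      = (\<alpha> i t powi (- a) * \<alpha> i t powi (- (b * C_cartan n j i))) * \<alpha> j t powi b"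
    by (simp add: algebra_simps)
  also have "\<alpha> i t powi (- a) * \<alpha> i t powi (- (b * C_cartan n j i)) = \<alpha> i t powi (- a - b * C_cartan n j i)"
    using nz power_int_add[of "\<alpha> i t" "- a" "- (b * C_cartan n j i)"] by simp
  finally show "(\<lambda>t\<in>T. \<alpha> i t powi a * \<alpha> j t powi b) (s i ** t ** ginv (s i))
    = \<alpha> i t powi (- a - b * C_cartan n j i) * \<alpha> j t powi b" .
qed

lemma rank2_act':
  "i \<in> I \<Longrightarrow> j \<in> I \<Longrightarrow> act (rank2 i j a b) (s j) = rank2 i j a (- b - a * C_cartan n i j)"
  using rank2_act[of j i b a] by (simp only: rank2_commute[of j i])

lemma rank2_positive:
  assumes "i \<in> I" "j \<in> I" "i \<noteq> j" "0 \<le> a" "0 \<le> b"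
  shows "positive (rank2 i j a b)"
  unfolding positive_def rank2_def
  by (intro exI[of _ "\<lambda>k. if k = i then a else if k = j then b else 0"])
    (use assms monomial_pair[OF assms(1-3)] in auto)

lemma act_sw_Cons: "i \<in> I \<Longrightarrow> set ws \<subseteq> I \<Longrightarrow> act \<beta> (sw (i # ws)) = act (act \<beta> (s i)) (sw ws)"
  using act_act[OF s_in_N sw_in_N] by simp

text \<open>
  A computation in the rank two system of \<open>\<alpha>\<^sub>i\<close> and \<open>\<alpha>\<^sub>j\<close>.  Positivity makes alternating words
  reduced; the final simple root is where \<open>sigma_transport\<close> applies.
\<close>

lemma act_alternating:
  assumes i: "i \<in> I" and j: "j \<in> I" and ij: "i \<noteq> j"
  shows "q < bond n i j \<Longrightarrow> positive (act (\<alpha> i) (sw (alternating q j i)))"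
    and "\<exists>x\<in>I. alternating (bond n i j) j i = alternating (bond n i j - 1) j i @ [x] \<and>
      act (\<alpha> i) (sw (alternating (bond n i j - 1) j i)) = \<alpha> x"
proof -
  have base: "act (rank2 i j a b) (sw []) = rank2 i j a b" for a b
    by (simp add: act_def rank2_def restrict_def fun_eq_iff)
  have step_i: "act (rank2 i j a b) (sw (i # ws)) = act (rank2 i j (- a - b * C_cartan n j i) b) (sw ws)"
    if "set ws \<subseteq> I" for a b ws
    using act_sw_Cons[OF i that] rank2_act[OF i j] by simp
  have step_j: "act (rank2 i j a b) (sw (j # ws)) = act (rank2 i j a (- b - a * C_cartan n i j)) (sw ws)"
    if "set ws \<subseteq> I" for a b ws
    using act_sw_Cons[OF j that] rank2_act'[OF i j] by simp
  have \<alpha>i: "\<alpha> i = rank2 i j 1 0" and \<alpha>j: "\<alpha> j = rank2 i j 0 1"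
    using rank2_simple[OF i, of j] rank2_simple[OF j, of i] by (simp_all only: rank2_commute[of i j 0])
  have le: "Suc 0 \<le> i" "i \<le> n" "Suc 0 \<le> j" "j \<le> n" using i j by auto
  note pos = rank2_positive[OF i j ij]
  consider (two) "bond n i j = 2" "C_cartan n i j = 0" "C_cartan n j i = 0"
    | (three) "bond n i j = 3" "C_cartan n i j = - 1" "C_cartan n j i = - 1"
    | (four) "bond n i j = 4" "C_cartan n i j = - 1" "C_cartan n j i = - 2"
    | (four') "bond n i j = 4" "C_cartan n i j = - 2" "C_cartan n j i = - 1"
    using C_cartan_eq[OF i j] C_cartan_eq[OF j i] ij i j unfolding bond_def by (auto split: if_splits)
  note cases = this
  have lt: "q = 0 \<or> q = 1" if "q < 2" for q :: nat using that by auto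
  have lt3: "q = 0 \<or> q = 1 \<or> q = 2" if "q < 3" for q :: nat using that by auto
  have lt4: "q = 0 \<or> q = 1 \<or> q = 2 \<or> q = 3" if "q < 4" for q :: nat using that by auto
  show "positive (act (\<alpha> i) (sw (alternating q j i)))" if q: "q < bond n i j"
    using cases
  proof cases
    case two
    then show ?thesis using lt[of q] q unfolding \<alpha>i
      by (auto simp del: word_prod_Cons word_prod_Nil simp: base step_i step_j le pos)
  next
    case three
    then show ?thesis using lt3[of q] q unfolding \<alpha>i
      by (auto simp del: word_prod_Cons word_prod_Nil simp: base step_i step_j le pos numeral_eq_Suc)
  next
    case four
    then show ?thesis using lt4[of q] q unfolding \<alpha>i
      by (auto simp del: word_prod_Cons word_prod_Nil simp: base step_i step_j le pos numeral_eq_Suc)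
  next
    case four'
    then show ?thesis using lt4[of q] q unfolding \<alpha>i
      by (auto simp del: word_prod_Cons word_prod_Nil simp: base step_i step_j le pos numeral_eq_Suc)
  qed
  show "\<exists>x\<in>I. alternating (bond n i j) j i = alternating (bond n i j - 1) j i @ [x] \<and>
      act (\<alpha> i) (sw (alternating (bond n i j - 1) j i)) = \<alpha> x"
    using cases
  proof cases
    case two
    then show ?thesis using i
      by (intro bexI[of _ i]) (simp_all del: word_prod_Cons word_prod_Nil
          add: \<alpha>i base step_i step_j le numeral_eq_Suc)
  next
    case three
    then show ?thesis using j
      by (intro bexI[of _ j]) (simp_all del: word_prod_Cons word_prod_Nil
          add: \<alpha>i \<alpha>j base step_i step_j le numeral_eq_Suc)
  next
    case four
    then show ?thesis using i
      by (intro bexI[of _ i]) (simp_all del: word_prod_Cons word_prod_Nil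
          add: \<alpha>i base step_i step_j le numeral_eq_Suc)
  next
    case four'
    then show ?thesis using i
      by (intro bexI[of _ i]) (simp_all del: word_prod_Cons word_prod_Nil
          add: \<alpha>i base step_i step_j le numeral_eq_Suc)
  qed
qed

lemma alternating_subset: "i \<in> I \<Longrightarrow> j \<in> I \<Longrightarrow> set (alternating q i j) \<subseteq> I"
  using set_alternating[of q i j] by blast

lemma alternating_reduced:
  assumes "i \<in> I" "j \<in> I" "i \<noteq> j" "q \<le> bond n i j"
  shows "W.reduced (alternating q i j)"
  using assms
proof (induction q arbitrary: i j)
  case 0
  show ?case by (simp only: alternating.simps W.reduced_Nil)
next
  case (Suc q)
  have "W.reduced (alternating q j i)"
    using Suc.IH[of j i] Suc.prems bond_commute[of n i j] by simp
  moreover have "positive (act (\<alpha> i) (sw (alternating q j i)))"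
    using act_alternating(1)[OF Suc.prems(1-3), of q] Suc.prems(4) by simp
  ultimately show ?case using reduced_Cons[OF Suc.prems(1)] by simp
qed

text \<open>
  The last letter \<open>x\<close> of the word belongs to the simple root that \<open>\<alpha>\<^sub>i\<close> has become, so \<open>\<sigma>\<^sub>x\<close> is
  transported to \<open>\<sigma>\<^sub>i\<close> at the front.
\<close>

lemma braid_up_to_coroot:
  assumes i: "i \<in> I" and j: "j \<in> I" and ij: "i \<noteq> j"
  shows "\<exists>c. c \<noteq> 0 \<and> sw (alternating (bond n i j) j i) = cor (\<alpha> i) c ** sw (alternating (bond n i j) i j)"
proof -
  define m where "m = bond n i j - 1"
  have m: "bond n i j = Suc m" by (simp add: m_def bond_def)
  obtain x where x: "x \<in> I" "alternating (Suc m) j i = alternating m j i @ [x]"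
    "act (\<alpha> i) (sw (alternating m j i)) = \<alpha> x"
    using act_alternating(2)[OF assms] unfolding m by auto
  let ?g = "sw (alternating m j i)"
  have g: "?g \<in> N" using sw_in_N[OF alternating_subset[OF j i]] .
  have "\<alpha> i t = \<alpha> x (ginv ?g ** t ** ?g)" if "t \<in> T" for t
    using act_apply[OF N_conj_inv[OF g that], of "\<alpha> i" ?g] x(3) g by (simp add: mul_assoc)
  from sigma_transport[OF simple_root[OF x(1)] simple_root[OF i] g this]
  obtain c where c: "c \<noteq> 0" "?g ** s x ** ginv ?g = cor (\<alpha> i) c ** s i" by blast
  have "sw (alternating (Suc m) j i) = ?g ** s x"
    unfolding x(2) by (simp add: word_prod_GL_append)
  also have "\<dots> = ?g ** s x ** ginv ?g ** ?g" using g by (simp add: mul_assoc)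
  also have "\<dots> = cor (\<alpha> i) c ** sw (alternating (Suc m) i j)" unfolding c(2) by (simp add: mul_assoc)
  finally show ?thesis using c(1) m by auto
qed

text \<open>
  Exchanging the roles of \<open>i\<close> and \<open>j\<close>, the two sides also differ by a value of \<open>\<alpha>\<^sub>j\<^sup>\<or>\<close>; the
  independence of the simple coroots makes both factors trivial.
\<close>

theorem tits_braid:
  assumes i: "i \<in> I" and j: "j \<in> I" and ij: "i \<noteq> j"
  shows "sw (alternating (bond n i j) i j) = sw (alternating (bond n i j) j i)"
proof -
  let ?A = "sw (alternating (bond n i j) i j)" and ?B = "sw (alternating (bond n i j) j i)"
  obtain c where c: "c \<noteq> 0" "?B = cor (\<alpha> i) c ** ?A" using braid_up_to_coroot[OF assms] by blast
  obtain d where d: "d \<noteq> 0" "?A = cor (\<alpha> j) d ** ?B"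
    using braid_up_to_coroot[OF j i] ij unfolding bond_commute[of n j i] by auto
  have A: "invertible ?A" using sw_in_N[OF alternating_subset[OF i j]] by simp
  have B: "invertible ?B" using sw_in_N[OF alternating_subset[OF j i]] by simp
  have "(cor (\<alpha> i) c ** cor (\<alpha> j) d) ** ?B = cor (\<alpha> i) c ** ?A" by (simp only: mul_assoc d(2)[symmetric])
  also have "\<dots> = mat 1 ** ?B" by (simp only: c(2)[symmetric] matrix_mul_lid)
  finally have "cor (\<alpha> i) c ** cor (\<alpha> j) d = mat 1"
    by (rule iffD1[OF mult_right_cancel_GL[OF B]])
  from coroots_independent(1)[OF i j ij c(1) d(1) this] have "c = 1" .
  then show ?thesis using c(2) coroot_one[OF simple_root[OF i]] by simp
qed

text \<open>
  By the assumed equality, the word may be continued after its first letter \<open>i\<close> with another \<open>i\<close>.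
\<close>

lemma alternating_not_reduced:
  assumes i: "i \<in> I" and j: "j \<in> I" and q: "0 < q"
    and eq: "W.wp (alternating q i j) = W.wp (alternating q j i)"
  shows "\<not> W.reduced (alternating (Suc q) i j)"
proof
  assume red: "W.reduced (alternating (Suc q) i j)"
  obtain p where p: "q = Suc p" using q by (cases q) auto
  have "W.wp (alternating (Suc q) i j) = r i \<otimes>\<^bsub>W\<^esub> W.wp (alternating q j i)" by simp
  also have "\<dots> = r i \<otimes>\<^bsub>W\<^esub> W.wp (i # alternating p j i)" using eq by (simp add: p)
  also have "\<dots> = W.wp (alternating p j i)" by (rule W.wp_double[OF i alternating_subset[OF j i]])
  finally have "length (alternating (Suc q) i j) \<le> length (alternating p j i)"
    using W.reduced_le[OF red alternating_subset[OF j i, of p]] by simp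
  then show False by (simp add: p)
qed

text \<open>
  For \<open>0 < q < bond n i j\<close> the next longer alternating word is reduced, which excludes an equality of
  length \<open>q\<close>.  For larger \<open>q\<close> the braid relation shortens the word.
\<close>

lemma alternating_equal_length:
  assumes i: "i \<in> I" and j: "j \<in> I" and ij: "i \<noteq> j"
    and red: "W.reduced (alternating q i j)" and eq: "W.wp (alternating q i j) = W.wp (alternating q j i)"
  shows "q = 0 \<or> q = bond n i j"
proof (rule ccontr)
  assume q: "\<not> (q = 0 \<or> q = bond n i j)"
  have pos: "0 < bond n i j" by (simp add: bond_def)
  consider "0 < q" "Suc q \<le> bond n i j" | "Suc (bond n i j) \<le> q" using q by linarith
  then show False
  proof cases
    case 1
    then show False using alternating_not_reduced[OF i j 1(1) eq] alternating_reduced[OF i j ij 1(2)] by blast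
  next
    case 2
    have "W.wp (alternating (bond n i j) i j) = W.wp (alternating (bond n i j) j i)"
      by (simp only: wp_eq_sw[OF alternating_subset[OF i j]] wp_eq_sw[OF alternating_subset[OF j i]]
          tits_braid[OF i j ij])
    from alternating_not_reduced[OF i j pos this]
    have "\<not> W.reduced (take (Suc (bond n i j)) (alternating q i j))"
      unfolding take_alternating[OF 2] .
    moreover have "W.reduced (take (Suc (bond n i j)) (alternating q i j))"
      by (rule W.reduced_appendD(1)[of _ "drop (Suc (bond n i j)) (alternating q i j)"])
        (simp only: append_take_drop_id red)
    ultimately show False by blast
  qed
qed

end

section \<open>The braid relations in coordinates\<close>

text \<open>The torus part of the product of the \<open>\<tau>\<^sub>i \<sigma>\<^sub>i\<close> along a word.\<close>

primrec torus_part :: "nat \<Rightarrow> (nat \<Rightarrow> nat \<Rightarrow> 'a::field) \<Rightarrow> nat list \<Rightarrow> nat \<Rightarrow> 'a" where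
  "torus_part n \<tau> [] = (\<lambda>_. 1)"
| "torus_part n \<tau> (i # ws) = (\<lambda>k. \<tau> i k * reflect n i (torus_part n \<tau> ws) k)"

lemma reflect_apply: "reflect n i x k = x k / (if k = i then root_value n i x else 1)"
  by (simp add: reflect_def)

lemma root_value_one [simp]: "root_value n i (\<lambda>_. 1) = 1"
  by (simp add: root_value_def)

lemma reflect_one [simp]: "reflect n i (\<lambda>_. 1) = (\<lambda>_. 1)"
  by (simp add: reflect_apply fun_eq_iff)

lemma root_value_mult: "root_value n i (\<lambda>k. x k * y k) = root_value n i x * root_value n i y"
  by (simp add: root_value_def power_mult_distrib)

lemma root_value_inverse: "root_value n i (\<lambda>k. inverse (x k)) = inverse (root_value n i x)"
  by (simp add: root_value_def power_inverse field_simps)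

lemma root_value_reflect:
  fixes x :: "nat \<Rightarrow> 'a::field"
  assumes i: "i \<in> {1..n}" and j: "j \<in> {1..n}" and n: "2 \<le> n" and x: "nonvanishing n x"
  shows "root_value n i (reflect n j x) = root_value n i x * root_value n j x powi (- C_cartan n i j)"
proof -
  let ?r = "root_value n j x"
  have "(\<Prod>k=1..n. reflect n j x k powi C_cartan n i k)
      = (\<Prod>k=1..n. x k powi C_cartan n i k * (if k = j then ?r powi (- C_cartan n i j) else 1))"
    by (rule prod.cong) (auto simp: reflect_apply divide_inverse power_int_mult_distrib power_int_inverse power_int_minus)
  also have "\<dots> = (\<Prod>k=1..n. x k powi C_cartan n i k) * ?r powi (- C_cartan n i j)"
    using j by (simp add: prod.distrib prod.delta)
  finally show ?thesis by (simp only: root_value_prod[OF i n])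
qed

lemma torus_part_nonvanishing:
  assumes "set ws \<subseteq> {1..n}" "2 \<le> n" "\<And>i. i \<in> {1..n} \<Longrightarrow> nonvanishing n (\<tau> i)"
  shows "nonvanishing n (torus_part n \<tau> ws)"
  using assms(1)
proof (induction ws)
  case (Cons i ws)
  then show ?case
    using nonvanishing_simps(2)[OF assms(3) nonvanishing_reflect[OF _ assms(2)], of i i] by simp
qed simp

lemma quotient_eq_self: "(A::'a::field) \<noteq> 0 \<Longrightarrow> B \<noteq> 0 \<Longrightarrow> A / B = A \<longleftrightarrow> B = 1"
  by (auto simp: field_simps)

text \<open>
  As the \<open>\<sigma>\<^sub>i\<close> satisfy the braid relations, this is the braid relation of the \<open>\<tau>\<^sub>i \<sigma>\<^sub>i\<close> for \<open>i\<close> and \<open>j\<close>.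
\<close>

definition coordinate_braid :: "nat \<Rightarrow> (nat \<Rightarrow> nat \<Rightarrow> 'a::field) \<Rightarrow> nat \<Rightarrow> nat \<Rightarrow> bool" where
  "coordinate_braid n \<tau> i j \<longleftrightarrow> (\<forall>k\<in>{1..n}. torus_part n \<tau> (alternating (bond n i j) i j) k =
     torus_part n \<tau> (alternating (bond n i j) j i) k)"

lemma coordinate_braid_commute: "coordinate_braid n \<tau> i j \<longleftrightarrow> coordinate_braid n \<tau> j i"
  by (auto simp: coordinate_braid_def bond_commute[of n i j])

text \<open>
  Every step of a braid word changes a single coordinate by a value of \<open>\<alpha>\<^sub>i\<close> or \<open>\<alpha>\<^sub>j\<close>, which is a
  monomial in the values of these two roots at \<open>\<tau>\<^sub>i\<close> and \<open>\<tau>\<^sub>j\<close>.  So the braid relation is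
  expressed by the four values \<open>p\<close>, \<open>q\<close>, \<open>P\<close>, \<open>Q\<close> and, for order \<open>3\<close>, the coordinates of \<open>\<tau>\<^sub>i\<close> and \<open>\<tau>\<^sub>j\<close>.
\<close>

context
  fixes n i j :: nat and \<tau> :: "nat \<Rightarrow> nat \<Rightarrow> 'a::field" and x y :: "nat \<Rightarrow> 'a" and p q P Q :: 'a
  assumes i: "i \<in> {1..n}" and j: "j \<in> {1..n}" and ij: "i \<noteq> j" and n: "2 \<le> n"
    and nv: "nonvanishing n (\<tau> i)" "nonvanishing n (\<tau> j)"
  defines "x \<equiv> \<tau> i" and "y \<equiv> \<tau> j"
    and "p \<equiv> root_value n i (\<tau> j)" and "q \<equiv> root_value n j (\<tau> i)"
    and "P \<equiv> root_value n i (\<tau> i)" and "Q \<equiv> root_value n j (\<tau> j)"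
begin

lemma braid_values_nz: "p \<noteq> 0" "q \<noteq> 0" "P \<noteq> 0" "Q \<noteq> 0"
  unfolding p_def q_def P_def Q_def
  using root_value_nz[OF i n nv(1)] root_value_nz[OF i n nv(2)]
    root_value_nz[OF j n nv(1)] root_value_nz[OF j n nv(2)] by auto

lemma braid_coords_nz: "k \<in> {1..n} \<Longrightarrow> x k \<noteq> 0" "k \<in> {1..n} \<Longrightarrow> y k \<noteq> 0"
  using nv by (simp_all add: nonvanishing_def x_def y_def)

lemma coordinate_braid_2:
  assumes "bond n i j = 2"
  shows "coordinate_braid n \<tau> i j \<longleftrightarrow> p = 1 \<and> q = 1"
proof -
  have l: "torus_part n \<tau> (alternating 2 i j) k = x k * y k / (if k = i then p else 1)" for k
    by (simp add: numeral_2_eq_2 reflect_apply[of n i y] x_def[symmetric] y_def[symmetric])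
      (simp add: p_def y_def)
  have r: "torus_part n \<tau> (alternating 2 j i) k = x k * y k / (if k = j then q else 1)" for k
    by (simp add: numeral_2_eq_2 reflect_apply[of n j x] x_def[symmetric] y_def[symmetric])
      (simp add: q_def x_def)
  show ?thesis
  proof
    assume "coordinate_braid n \<tau> i j"
    then have eq: "x k * y k / (if k = i then p else 1) = x k * y k / (if k = j then q else 1)"
      if "k \<in> {1..n}" for k using that unfolding coordinate_braid_def assms l r by blast
    show "p = 1 \<and> q = 1"
      using eq[OF i] eq[OF j] ij braid_values_nz braid_coords_nz[OF i] braid_coords_nz[OF j]
      by (simp add: field_simps)
  next
    assume "p = 1 \<and> q = 1"
    then show "coordinate_braid n \<tau> i j" unfolding coordinate_braid_def assms l r by simp
  qed
qed

lemma coordinate_braid_3: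
  assumes b: "bond n i j = 3" and C: "C_cartan n i j = - 1" "C_cartan n j i = - 1"
  shows "coordinate_braid n \<tau> i j \<longleftrightarrow>
    (\<forall>k\<in>{1..n} - {i, j}. x k = y k) \<and> x i = y i * P * q \<and> y j = x j * Q * p"
proof -
  have p1: "root_value n i (\<lambda>k. y k * reflect n j x k) = p * P * q"
    using root_value_reflect[OF i j n nv(1)] C
    by (simp add: root_value_mult x_def y_def p_def q_def P_def)
  have q1: "root_value n j (\<lambda>k. x k * reflect n i y k) = q * Q * p"
    using root_value_reflect[OF j i n nv(2)] C
    by (simp add: root_value_mult x_def y_def p_def q_def Q_def)
  have l: "torus_part n \<tau> (alternating 3 i j) k
      = x k * (y k * (x k / (if k = j then q else 1)) / (if k = i then p * P * q else 1))" for k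
    unfolding numeral_3_eq_3 alternating.simps torus_part.simps reflect_one mult_1_right
      x_def[symmetric] y_def[symmetric] reflect_apply[of n i "\<lambda>k. y k * reflect n j x k"] p1
    by (simp add: reflect_apply[of n j x]) (simp add: q_def x_def)
  have r: "torus_part n \<tau> (alternating 3 j i) k
      = y k * (x k * (y k / (if k = i then p else 1)) / (if k = j then q * Q * p else 1))" for k
    unfolding numeral_3_eq_3 alternating.simps torus_part.simps reflect_one mult_1_right
      x_def[symmetric] y_def[symmetric] reflect_apply[of n j "\<lambda>k. x k * reflect n i y k"] q1
    by (simp add: reflect_apply[of n i y]) (simp add: p_def y_def)
  have at: "torus_part n \<tau> (alternating 3 i j) k = torus_part n \<tau> (alternating 3 j i) k \<longleftrightarrow>
    (if k = i then x i = y i * P * q else if k = j then y j = x j * Q * p else x k = y k)"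
    if k: "k \<in> {1..n}" for k
  proof -
    note nz = braid_values_nz braid_coords_nz[OF k]
    consider "k = i" | "k = j" | "k \<noteq> i" "k \<noteq> j" by blast
    then show ?thesis
    proof cases
      case 1
      have "x i * (y i * x i / (p * P * q)) = y i * (x i * (y i / p)) \<longleftrightarrow>
          (x i * y i / (p * P * q)) * x i = (x i * y i / (p * P * q)) * (y i * P * q)"
        using nz by (simp add: field_simps)
      also have "\<dots> \<longleftrightarrow> x i = y i * P * q"
        using nz 1 by (subst mult_cancel_left) simp
      finally show ?thesis unfolding l r using 1 ij by simp
    next
      case 2
      have "x j * (y j * (x j / q)) = y j * (x j * y j / (q * Q * p)) \<longleftrightarrow>
          (x j * y j / (q * Q * p)) * (x j * Q * p) = (x j * y j / (q * Q * p)) * y j"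
        using nz by (simp add: field_simps)
      also have "\<dots> \<longleftrightarrow> y j = x j * Q * p"
        using nz 2 by (subst mult_cancel_left) auto
      finally show ?thesis unfolding l r using 2 ij by simp
    next
      case 3
      then show ?thesis unfolding l r using nz by simp
    qed
  qed
  show ?thesis unfolding coordinate_braid_def b using at i j ij by auto
qed

lemma coordinate_braid_4:
  assumes b: "bond n i j = 4" and C: "C_cartan n i j = - 1" "C_cartan n j i = - 2"
  shows "coordinate_braid n \<tau> i j \<longleftrightarrow> Q * p ^ 2 = 1 \<and> (P * q) ^ 2 = 1"
proof -
  have nvr: "nonvanishing n (reflect n i y)" "nonvanishing n (reflect n j x)"
    using nonvanishing_reflect i j n nv unfolding x_def y_def by blast+
  define z1 where "z1 = (\<lambda>k. x k * reflect n i y k)"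
  define w1 where "w1 = (\<lambda>k. y k * reflect n j x k)"
  have nv1: "nonvanishing n z1" "nonvanishing n w1"
    unfolding z1_def w1_def using nvr nv unfolding x_def y_def by (simp_all add: nonvanishing_def)
  have self: "C_cartan n i i = 2" "C_cartan n j j = 2" using C_cartan_eq i j by auto
  have jz1: "root_value n j z1 = q * Q * p ^ 2"
    using root_value_reflect[OF j i n nv(2)] C
    by (simp add: z1_def root_value_mult x_def y_def p_def q_def Q_def)
  have iz1: "root_value n i z1 = P / p"
    using root_value_reflect[OF i i n nv(2)] self braid_values_nz
    by (simp add: z1_def root_value_mult x_def y_def p_def P_def power_int_minus power2_eq_square field_simps)
  have iw1: "root_value n i w1 = p * P * q"
    using root_value_reflect[OF i j n nv(1)] C
    by (simp add: w1_def root_value_mult x_def y_def p_def q_def P_def)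
  have jw1: "root_value n j w1 = Q / q"
    using root_value_reflect[OF j j n nv(1)] self braid_values_nz
    by (simp add: w1_def root_value_mult x_def y_def q_def Q_def power_int_minus power2_eq_square field_simps)
  have z2: "root_value n i (\<lambda>k. y k * reflect n j z1 k) = P * q * Q * p ^ 2"
    using root_value_reflect[OF i j n nv1(1)] C braid_values_nz
    by (simp add: root_value_mult iz1 jz1 y_def p_def[symmetric])
  have w2: "root_value n j (\<lambda>k. x k * reflect n i w1 k) = Q * (p * P * q) ^ 2"
    using root_value_reflect[OF j i n nv1(2)] C braid_values_nz
    by (simp add: root_value_mult iw1 jw1 x_def q_def[symmetric])
  have four: "(4::nat) = Suc (Suc (Suc (Suc 0)))" by simp
  have l: "torus_part n \<tau> (alternating 4 i j) k = x k * (y k * (x k * (y k / (if k = i then p else 1))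
      / (if k = j then q * Q * p ^ 2 else 1)) / (if k = i then P * q * Q * p ^ 2 else 1))" for k
    unfolding four alternating.simps torus_part.simps reflect_one mult_1_right
      x_def[symmetric] y_def[symmetric] z1_def[symmetric]
      reflect_apply[of n i "\<lambda>k. y k * reflect n j z1 k"] z2
    unfolding reflect_apply[of n j z1] jz1
    by (simp add: z1_def reflect_apply[of n i y]) (simp add: p_def y_def)
  have r: "torus_part n \<tau> (alternating 4 j i) k = y k * (x k * (y k * (x k / (if k = j then q else 1))
      / (if k = i then p * P * q else 1)) / (if k = j then Q * (p * P * q) ^ 2 else 1))" for k
    unfolding four alternating.simps torus_part.simps reflect_one mult_1_right
      x_def[symmetric] y_def[symmetric] w1_def[symmetric]
      reflect_apply[of n j "\<lambda>k. x k * reflect n i w1 k"] w2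
    unfolding reflect_apply[of n i w1] iw1
    by (simp add: w1_def reflect_apply[of n j x]) (simp add: q_def x_def)
  have at: "torus_part n \<tau> (alternating 4 i j) k = torus_part n \<tau> (alternating 4 j i) k \<longleftrightarrow>
    (if k = i then Q * p ^ 2 = 1 else if k = j then (P * q) ^ 2 = 1 else True)"
    if k: "k \<in> {1..n}" for k
  proof -
    note nz = braid_values_nz braid_coords_nz[OF k]
    consider "k = i" | "k = j" | "k \<noteq> i" "k \<noteq> j" by blast
    then show ?thesis
    proof cases
      case 1
      define A where "A = (x i * y i) ^ 2 / (p * P * q)"
      have A: "A \<noteq> 0" using nz 1 by (simp add: A_def)
      have e: "torus_part n \<tau> (alternating 4 i j) k = A / (Q * p ^ 2)"
        "torus_part n \<tau> (alternating 4 j i) k = A"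
        unfolding l r A_def using 1 ij nz by (simp_all add: field_simps power2_eq_square)
      show ?thesis unfolding e using quotient_eq_self[OF A, of "Q * p ^ 2"] nz 1 by simp
    next
      case 2
      define A where "A = (x j * y j) ^ 2 / (q * Q * p ^ 2)"
      have A: "A \<noteq> 0" using nz 2 by (simp add: A_def)
      have e: "torus_part n \<tau> (alternating 4 i j) k = A"
        "torus_part n \<tau> (alternating 4 j i) k = A / (P * q) ^ 2"
        unfolding l r A_def using 2 ij nz by (simp_all add: field_simps power2_eq_square)
      show ?thesis unfolding e
        using quotient_eq_self[OF A, of "(P * q) ^ 2"] eq_commute[of A] nz 2 ij by simp
    next
      case 3
      then show ?thesis unfolding l r by simp
    qed
  qed
  show ?thesis unfolding coordinate_braid_def b using at i j ij by auto
qed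

end

section \<open>Solving the braid relations\<close>

text \<open>
  The conjuncts come from commuting reflections, from the braid relations of order \<open>3\<close>, and, in the
  last two lines, from the braid relation of order \<open>4\<close>.
\<close>

definition braid_equations :: "nat \<Rightarrow> (nat \<Rightarrow> nat \<Rightarrow> 'a::field) \<Rightarrow> bool" where
  "braid_equations n \<tau> \<longleftrightarrow>
     (\<forall>i\<in>{1..n}. \<forall>j\<in>{1..n}. Suc i < j \<or> Suc j < i \<longrightarrow> root_value n i (\<tau> j) = 1) \<and>
     (\<forall>i. 1 \<le> i \<and> Suc i < n \<longrightarrow> (\<forall>k\<in>{1..n} - {i, Suc i}. \<tau> i k = \<tau> (Suc i) k) \<and>
        \<tau> i (Suc i) * \<tau> (Suc i) i = coord0 (\<tau> i) (i - 1) * \<tau> i (i + 2)) \<and>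
     \<tau> n (n - 1) ^ 2 = coord0 (\<tau> n) (n - 2) ^ 2 \<and>
     \<tau> (n - 1) n ^ 2 = coord0 (\<tau> (n - 1)) (n - 2) ^ 2"

lemma braid_3_explicit:
  fixes \<tau> :: "nat \<Rightarrow> nat \<Rightarrow> 'a::field"
  assumes i: "1 \<le> i" "Suc i < n" and nv: "nonvanishing n (\<tau> i)" "nonvanishing n (\<tau> (Suc i))"
  shows "coordinate_braid n \<tau> i (Suc i) \<longleftrightarrow> (\<forall>k\<in>{1..n} - {i, Suc i}. \<tau> i k = \<tau> (Suc i) k) \<and>
        \<tau> i (Suc i) * \<tau> (Suc i) i = coord0 (\<tau> i) (i - 1) * \<tau> i (i + 2)" (is "?B \<longleftrightarrow> ?E \<and> ?F")
proof -
  let ?x = "\<tau> i" and ?y = "\<tau> (Suc i)"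
  have iI: "i \<in> {1..n}" "Suc i \<in> {1..n}" "i \<noteq> Suc i" "2 \<le> n" using i by auto
  have "bond n i (Suc i) = 3" "C_cartan n i (Suc i) = - 1" "C_cartan n (Suc i) i = - 1"
    using i iI by (auto simp: bond_def C_cartan_eq)
  from coordinate_braid_3[where \<tau>=\<tau>, OF iI(1-4) nv this]
  have B: "?B \<longleftrightarrow> ?E \<and> ?x i = ?y i * root_value n i ?x * root_value n (Suc i) ?x \<and>
      ?y (Suc i) = ?x (Suc i) * root_value n (Suc i) ?y * root_value n i ?y" .
  have x: "coord0 z (i - 1) \<noteq> 0" "z i \<noteq> 0" "z (Suc i) \<noteq> 0" "z (i + 2) \<noteq> 0"
    if "nonvanishing n z" for z :: "nat \<Rightarrow> 'a"
    using that i coord0_nz[OF that, of "i - 1"] by (auto simp: nonvanishing_def)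
  have rv: "root_value n i z * root_value n (Suc i) z = z i * z (Suc i) / (coord0 z (i - 1) * z (i + 2))"
    if "nonvanishing n z" for z :: "nat \<Rightarrow> 'a"
  proof -
    have r1: "root_value n i z = z i ^ 2 / (coord0 z (i - 1) * z (Suc i))"
      using root_value_inner[of i n z] i by simp
    have r2: "root_value n (Suc i) z = z (Suc i) ^ 2 / (z i * z (i + 2))"
      using root_value_inner[of "Suc i" n z] i by (simp add: coord0_def)
    show ?thesis unfolding r1 r2 using x[OF that] by (simp add: power2_eq_square field_simps)
  qed
  have 1: "?x i = ?y i * root_value n i ?x * root_value n (Suc i) ?x \<longleftrightarrow> ?F"
  proof -
    have "?x i = ?y i * (root_value n i ?x * root_value n (Suc i) ?x) \<longleftrightarrow>
        ?x i * (coord0 ?x (i - 1) * ?x (i + 2)) = ?x i * (?x (Suc i) * ?y i)"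
      unfolding rv[OF nv(1)] using x[OF nv(1)] by (simp add: field_simps)
    also have "\<dots> \<longleftrightarrow> ?F" using x[OF nv(1)] by (subst mult_cancel_left) auto
    finally show ?thesis by (simp only: mult.assoc)
  qed
  have 2: "?y (Suc i) = ?x (Suc i) * root_value n (Suc i) ?y * root_value n i ?y \<longleftrightarrow>
      ?x (Suc i) * ?y i = coord0 ?y (i - 1) * ?y (i + 2)"
  proof -
    have "?y (Suc i) = ?x (Suc i) * (root_value n i ?y * root_value n (Suc i) ?y) \<longleftrightarrow>
        ?y (Suc i) * (coord0 ?y (i - 1) * ?y (i + 2)) = ?y (Suc i) * (?x (Suc i) * ?y i)"
      unfolding rv[OF nv(2)] using x[OF nv(2)] by (simp add: field_simps)
    also have "\<dots> \<longleftrightarrow> ?x (Suc i) * ?y i = coord0 ?y (i - 1) * ?y (i + 2)"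
      using x[OF nv(2)] by (subst mult_cancel_left) auto
    finally show ?thesis by (simp only: mult_ac)
  qed
  have "coord0 ?x (i - 1) = coord0 ?y (i - 1)" "?x (i + 2) = ?y (i + 2)" if ?E
  proof -
    show "?x (i + 2) = ?y (i + 2)" using that i by auto
    show "coord0 ?x (i - 1) = coord0 ?y (i - 1)"
    proof (cases "i = 1")
      case False
      then have "i - 1 \<in> {1..n} - {i, Suc i}" using i by auto
      then show ?thesis using that by (simp add: coord0_def)
    qed (simp add: coord0_def)
  qed
  then show ?thesis unfolding B 1 2 by auto
qed

lemma braid_4_explicit:
  fixes \<tau> :: "nat \<Rightarrow> nat \<Rightarrow> 'a::field"
  assumes n: "3 \<le> n" and nv: "nonvanishing n (\<tau> (n - 1))" "nonvanishing n (\<tau> n)"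
  shows "coordinate_braid n \<tau> (n - 1) n \<longleftrightarrow> \<tau> n (n - 1) ^ 2 = coord0 (\<tau> n) (n - 2) ^ 2 \<and>
     \<tau> (n - 1) n ^ 2 = coord0 (\<tau> (n - 1)) (n - 2) ^ 2"
proof -
  obtain m where m: "n = Suc (Suc m)" "1 \<le> m" using n by (metis Suc_le_D Suc_le_mono numeral_3_eq_3 One_nat_def)
  let ?i = "n - 1"
  have iI: "?i \<in> {1..n}" "n \<in> {1..n}" "?i \<noteq> n" "2 \<le> n" using n by auto
  have "bond n ?i n = 4" "C_cartan n ?i n = - 1" "C_cartan n n ?i = - 2"
    using n iI by (auto simp: bond_def C_cartan_eq)
  from coordinate_braid_4[where \<tau>=\<tau>, OF iI(1-4) nv this]
  have B: "coordinate_braid n \<tau> ?i n \<longleftrightarrow> root_value n n (\<tau> n) * root_value n ?i (\<tau> n) ^ 2 = 1 \<and>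
      (root_value n ?i (\<tau> ?i) * root_value n n (\<tau> ?i)) ^ 2 = 1" .
  have x: "coord0 z m \<noteq> 0" "z (Suc m) \<noteq> 0" "z n \<noteq> 0" if "nonvanishing n z" for z :: "nat \<Rightarrow> 'a"
    using that m coord0_nz[OF that, of m] by (auto simp: nonvanishing_def)
  have rv: "root_value n ?i z = z (Suc m) ^ 2 / (coord0 z m * z n)" "root_value n n z = z n ^ 2 / z (Suc m) ^ 2"
    for z :: "nat \<Rightarrow> 'a"
    using root_value_inner[of ?i n z] root_value_last[of n z] m by simp_all
  have "root_value n n (\<tau> n) * root_value n ?i (\<tau> n) ^ 2 = \<tau> n (Suc m) ^ 2 / coord0 (\<tau> n) m ^ 2"
    unfolding rv using x[OF nv(2)] by (simp add: power2_eq_square field_simps)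
  moreover have "root_value n ?i (\<tau> ?i) * root_value n n (\<tau> ?i) = \<tau> ?i n / coord0 (\<tau> ?i) m"
    unfolding rv using x[OF nv(1)] by (simp add: power2_eq_square field_simps)
  ultimately show ?thesis unfolding B using x[OF nv(1)] x[OF nv(2)] m
    by (simp add: power_divide)
qed

lemma braid_equations_iff:
  fixes \<tau> :: "nat \<Rightarrow> nat \<Rightarrow> 'a::field"
  assumes n: "3 \<le> n" and nv: "\<And>i. i \<in> {1..n} \<Longrightarrow> nonvanishing n (\<tau> i)"
  shows "(\<forall>i\<in>{1..n}. \<forall>j\<in>{1..n}. i \<noteq> j \<longrightarrow> coordinate_braid n \<tau> i j) \<longleftrightarrow> braid_equations n \<tau>"
    (is "?L \<longleftrightarrow> ?R")
proof -
  have two: "coordinate_braid n \<tau> i j \<longleftrightarrow> root_value n i (\<tau> j) = 1 \<and> root_value n j (\<tau> i) = 1"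
    if "i \<in> {1..n}" "j \<in> {1..n}" "Suc i < j \<or> Suc j < i" for i j
  proof -
    have "i \<noteq> j" "2 \<le> n" "bond n i j = 2" using that n by (auto simp: bond_def)
    then show ?thesis using coordinate_braid_2[where \<tau>=\<tau>, OF that(1,2) _ _ nv[OF that(1)] nv[OF that(2)]] by simp
  qed
  have three: "coordinate_braid n \<tau> i (Suc i) \<longleftrightarrow> (\<forall>k\<in>{1..n} - {i, Suc i}. \<tau> i k = \<tau> (Suc i) k) \<and>
        \<tau> i (Suc i) * \<tau> (Suc i) i = coord0 (\<tau> i) (i - 1) * \<tau> i (i + 2)"
    if "1 \<le> i" "Suc i < n" for i
    by (rule braid_3_explicit[OF that]) (use nv that in auto)
  have four: "coordinate_braid n \<tau> (n - 1) n \<longleftrightarrow> \<tau> n (n - 1) ^ 2 = coord0 (\<tau> n) (n - 2) ^ 2 \<and>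
     \<tau> (n - 1) n ^ 2 = coord0 (\<tau> (n - 1)) (n - 2) ^ 2"
    by (rule braid_4_explicit[OF n]) (use nv n in auto)
  show ?thesis
  proof
    assume L: ?L
    have "root_value n i (\<tau> j) = 1" if "i \<in> {1..n}" "j \<in> {1..n}" "Suc i < j \<or> Suc j < i" for i j
    proof -
      have "i \<noteq> j" using that(3) by auto
      then show ?thesis using L two[OF that] that(1,2) by blast
    qed
    moreover have "coordinate_braid n \<tau> i (Suc i)" if "1 \<le> i" "Suc i < n" for i using L that by simp
    moreover have "coordinate_braid n \<tau> (n - 1) n" using L n by simp
    ultimately show ?R unfolding braid_equations_def using three four by blast
  next
    assume R: ?R
    have adj: "coordinate_braid n \<tau> i (Suc i)" if "1 \<le> i" "Suc i \<le> n" for i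
    proof (cases "Suc i = n")
      case True
      then have "i = n - 1" by simp
      then show ?thesis using four R True unfolding braid_equations_def by metis
    next
      case False
      then have "Suc i < n" using that by simp
      then show ?thesis using three[OF that(1)] R that(1) unfolding braid_equations_def by blast
    qed
    show ?L
    proof (intro ballI impI)
      fix i j assume ij: "i \<in> {1..n}" "j \<in> {1..n}" "i \<noteq> j"
      consider "Suc i < j \<or> Suc j < i" | "j = Suc i" | "i = Suc j" using ij(3) by linarith
      then show "coordinate_braid n \<tau> i j"
      proof cases
        case 1
        then have "root_value n i (\<tau> j) = 1" "root_value n j (\<tau> i) = 1"
          using R ij unfolding braid_equations_def by blast+
        then show ?thesis using two[OF ij(1,2) 1] by simp
      next
        case 2
        then show ?thesis using adj[of i] ij by simp
      next
        case 3
        then show ?thesis using adj[of j] ij coordinate_braid_commute[of n \<tau> i j] by simp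
      qed
    qed
  qed
qed

lemma power_parity: "r ^ 2 = (1::'a::field) \<Longrightarrow> r ^ k = (if odd k then r else 1)"
  by (auto elim!: evenE oddE simp: power_mult)

text \<open>
  For \<open>i < n\<close> the \<open>k\<close>-th coordinate of \<open>\<tau>\<^sub>i\<close> depends on \<open>i\<close> only through the sign of \<open>k - i\<close>: it is
  \<open>u r\<^sup>k\<close> for \<open>k > i\<close> and \<open>r\<^sup>k\<close> for \<open>k < i\<close>, where \<open>u\<^sup>2 = r\<^sup>2 = 1\<close>.  The parameters are recovered from
  \<open>r = ab\<close> and from \<open>u\<close>, which is \<open>b\<close> for even \<open>n\<close> and \<open>a\<close> for odd \<open>n\<close>.
\<close>

theorem braid_equations_solution:
  fixes \<tau> :: "nat \<Rightarrow> nat \<Rightarrow> 'a::field"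
  assumes n: "3 \<le> n" and nv: "\<And>i. i \<in> {1..n} \<Longrightarrow> nonvanishing n (\<tau> i)" and eqs: "braid_equations n \<tau>"
  shows "\<exists>a b c. a ^ 2 = 1 \<and> b ^ 2 = 1 \<and> c ^ 2 = 1 \<and>
    (\<forall>i\<in>{1..n}. \<forall>k\<in>{1..n}. \<tau> i k = t_coord n a b c (\<lambda>i. \<tau> i i) i k)"
proof -
  have nz: "\<tau> i k \<noteq> 0" if "i \<in> {1..n}" "k \<in> {1..n}" for i k
    using nv[OF that(1)] that(2) by (simp add: nonvanishing_def)
  have two: "root_value n i (\<tau> j) = 1" if "i \<in> {1..n}" "j \<in> {1..n}" "Suc i < j \<or> Suc j < i" for i j
    using eqs that unfolding braid_equations_def by blast
  have three: "\<tau> i k = \<tau> (Suc i) k" if "1 \<le> i" "Suc i < n" "k \<in> {1..n}" "k \<noteq> i" "k \<noteq> Suc i" for i k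
    using eqs that unfolding braid_equations_def by blast
  have three': "\<tau> i (Suc i) * \<tau> (Suc i) i = coord0 (\<tau> i) (i - 1) * \<tau> i (i + 2)"
    if "1 \<le> i" "Suc i < n" for i
    using eqs that unfolding braid_equations_def by blast
  have four: "\<tau> n (n - 1) ^ 2 = coord0 (\<tau> n) (n - 2) ^ 2" "\<tau> (n - 1) n ^ 2 = coord0 (\<tau> (n - 1)) (n - 2) ^ 2"
    using eqs unfolding braid_equations_def by blast+
  \<comment> \<open>The short simple roots that commute with \<open>\<alpha>\<^sub>n\<close> make the entries \<open>k < n\<close> of row \<open>n\<close> a geometric
      progression; its ratio has square \<open>1\<close> by the braid relation of order \<open>4\<close>.\<close>
  define c where "c = \<tau> n 1"
  have c0: "c \<noteq> 0" using nz[of n 1] n by (simp add: c_def)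
  have n_row: "\<tau> n k = c ^ k" if "1 \<le> k" "k \<le> n - 1" for k
    unfolding c_def
  proof (rule geometric_progression[OF _ _ that])
    fix i assume i: "1 \<le> i" "i < n - 1"
    then have "root_value n i (\<tau> n) = 1" using two[of i n] n by auto
    moreover have "coord0 (\<tau> n) (i - 1) \<noteq> 0" "\<tau> n (i + 1) \<noteq> 0"
      using coord0_nz[OF nv, of n "i - 1"] nz[of n "i + 1"] i n by auto
    ultimately show "\<tau> n i ^ 2 = coord0 (\<tau> n) (i - 1) * \<tau> n (i + 1)"
      using root_value_inner[of i n "\<tau> n"] i by simp
  qed (use nz n in auto)
  have c2: "c ^ 2 = 1"
  proof -
    have "coord0 (\<tau> n) (n - 2) = c ^ (n - 2)" using n_row[of "n - 2"] n by (simp add: coord0_def)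
    moreover have "\<tau> n (n - 1) = c ^ (n - 2) * c"
    proof -
      have "n - 1 = Suc (n - 2)" using n by simp
      then show ?thesis using n_row[of "n - 1"] n by (simp add: mult.commute)
    qed
    ultimately show ?thesis using four(1) c0 by (simp add: power_mult_distrib)
  qed
  \<comment> \<open>The entries \<open>k \<ge> 2\<close> of row \<open>1\<close> form a geometric progression; its ratio has square \<open>1\<close> since
      \<open>s\<^sub>1\<close> and \<open>s\<^sub>n\<close> commute.  The relations of order \<open>3\<close> copy these entries to the rows below.\<close>
  define u0 where "u0 = \<tau> 1 2"
  define r where "r = \<tau> 1 3 / u0"
  have u0: "u0 \<noteq> 0" "r \<noteq> 0" using nz[of 1 2] nz[of 1 3] n by (auto simp: u0_def r_def)
  have ratio: "\<tau> 1 (Suc k) = \<tau> 1 k * r" if "2 \<le> k" "k < n" for k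
    using that
  proof (induction k rule: dec_induct)
    case base
    show ?case using u0 by (simp add: r_def u0_def eval_nat_numeral)
  next
    case (step k)
    have "root_value n (Suc k) (\<tau> 1) = 1" using two[of "Suc k" 1] step n by auto
    moreover have "\<tau> 1 k \<noteq> 0" "\<tau> 1 (Suc (Suc k)) \<noteq> 0" using nz[of 1] step n by auto
    ultimately have "\<tau> 1 (Suc k) ^ 2 = \<tau> 1 k * \<tau> 1 (Suc (Suc k))"
      using root_value_inner[of "Suc k" n "\<tau> 1"] step by (simp add: coord0_def)
    moreover have "\<tau> 1 k * (\<tau> 1 (Suc k) * r) = \<tau> 1 (Suc k) ^ 2"
      using step by (simp add: power2_eq_square)
    ultimately have "\<tau> 1 k * (\<tau> 1 (Suc k) * r) = \<tau> 1 k * \<tau> 1 (Suc (Suc k))" by simp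
    then have "\<tau> 1 (Suc k) * r = \<tau> 1 (Suc (Suc k))"
      using \<open>\<tau> 1 k \<noteq> 0\<close> by (subst (asm) mult_cancel_left) simp
    then show ?case by simp
  qed
  have r2: "r ^ 2 = 1"
  proof -
    have "root_value n n (\<tau> 1) = 1" using two[of n 1] n by auto
    moreover have nz1: "\<tau> 1 (n - 1) \<noteq> 0" using nz[of 1 "n - 1"] n by auto
    ultimately have "\<tau> 1 n ^ 2 = \<tau> 1 (n - 1) ^ 2" using root_value_last[of n "\<tau> 1"] by simp
    moreover have "\<tau> 1 n = \<tau> 1 (n - 1) * r" using ratio[of "n - 1"] n by simp
    ultimately show ?thesis using nz1 by (simp add: power_mult_distrib)
  qed
  have row1: "\<tau> 1 k = u0 * r ^ k" if "2 \<le> k" "k \<le> n" for k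
    using that
  proof (induction k rule: dec_induct)
    case base
    show ?case using r2 by (simp add: u0_def)
  next
    case (step k)
    then show ?case using ratio[of k] by simp
  qed
  have upper: "\<tau> i k = u0 * r ^ k" if "1 \<le> i" "i < k" "k \<le> n" for i k
    using that
  proof (induction i rule: dec_induct)
    case base
    then show ?case using row1[of k] by simp
  next
    case (step i)
    then show ?case using three[of i k] by simp
  qed
  \<comment> \<open>Below the diagonal an entry depends only on its column, and the relations of order \<open>3\<close>
      determine each column from the one before.\<close>
  have lower_aux: "\<tau> i k = \<tau> (Suc k) k" if "Suc k \<le> i" "i < n" "1 \<le> k" for i k
    using that
  proof (induction i rule: dec_induct)
    case (step i)
    then show ?case using three[of i k] by simp
  qed simp
  have diag: "\<tau> (Suc i) i = r ^ i" if "1 \<le> i" "Suc i < n" for i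
    using that
  proof (induction i rule: dec_induct)
    case base
    have "u0 * \<tau> 2 1 = u0 * r ^ 3"
      using three'[of 1] row1[of 2] row1[of 3] n r2 base by (simp add: coord0_def eval_nat_numeral u0_def)
    then show ?case using u0 r2 by (simp add: power3_eq_cube power2_eq_square eval_nat_numeral)
  next
    case (step i)
    have "coord0 (\<tau> (Suc i)) (Suc i - 1) = r ^ i" using step by (simp add: coord0_def)
    then have "u0 * r ^ Suc (Suc i) * \<tau> (Suc (Suc i)) (Suc i) = r ^ i * (u0 * r ^ Suc (Suc (Suc i)))"
      using three'[of "Suc i"] step upper[of "Suc i" "Suc (Suc i)"] upper[of "Suc i" "Suc (Suc (Suc i))"] by simp
    also have "\<dots> = u0 * r ^ Suc (Suc i) * r ^ Suc i" by (simp add: algebra_simps)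
    finally show ?case using u0 by (subst (asm) mult_cancel_left) auto
  qed
  have lower: "\<tau> i k = r ^ k" if "1 \<le> k" "k < i" "i < n" for i k
    using lower_aux[of k i] diag[of k] that by simp
  have u2: "u0 ^ 2 = 1"
  proof -
    have "coord0 (\<tau> (n - 1)) (n - 2) = r ^ (n - 2)" using lower[of "n - 2" "n - 1"] n by (simp add: coord0_def)
    moreover have "\<tau> (n - 1) n = u0 * r ^ n" using upper[of "n - 1" n] n by simp
    ultimately have "(u0 * r ^ n) ^ 2 = (r ^ (n - 2)) ^ 2" using four(2) by simp
    moreover have "(r ^ k) ^ 2 = 1" for k using r2 by (metis power_commutes power_mult power_one mult.commute)
    ultimately show ?thesis by (simp add: power_mult_distrib)
  qed
  have r_pow: "r ^ k = (if odd k then r else 1)" for k using power_parity[OF r2] .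
  have c_pow: "c ^ k = (if odd k then c else 1)" for k using power_parity[OF c2] .
  define a where "a = (if even n then u0 * r else u0)"
  define b where "b = (if even n then u0 else u0 * r)"
  have "a * b = r" using u2 by (simp add: a_def b_def power2_eq_square algebra_simps)
  have "\<tau> i k = t_coord n a b c (\<lambda>i. \<tau> i i) i k" if ik: "i \<in> {1..n}" "k \<in> {1..n}" for i k
  proof -
    consider "k = i" | "k \<noteq> i" "i = n" | "k < i" "i < n" | "i < k" "i < n" using ik by fastforce
    then show ?thesis
    proof cases
      case 1
      then show ?thesis by (simp add: t_coord_def)
    next
      case 2
      then show ?thesis using n_row[of k] c_pow ik by (auto simp: t_coord_def)
    next
      case 3
      then show ?thesis using lower[of k i] r_pow \<open>a * b = r\<close> ik by (auto simp: t_coord_def)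
    next
      case 4
      then show ?thesis using upper[of i k] r_pow ik by (auto simp: t_coord_def a_def b_def)
    qed
  qed
  moreover have "a ^ 2 = 1" "b ^ 2 = 1" using u2 r2 by (simp_all add: a_def b_def power_mult_distrib)
  ultimately show ?thesis using c2 by blast
qed

lemma t_coord_nonvanishing:
  assumes "a ^ 2 = 1" "b ^ 2 = 1" "c ^ 2 = 1" "\<forall>i\<in>{1..n}. d i \<noteq> (0::'a::field)" "i \<in> {1..n}"
  shows "nonvanishing n (t_coord n a b c d i)"
proof -
  have "a \<noteq> 0" "b \<noteq> 0" "c \<noteq> 0" using assms by auto
  then show ?thesis using assms by (auto simp: nonvanishing_def t_coord_def)
qed

lemma t_coord_square:
  assumes "a ^ 2 = 1" "b ^ 2 = 1" "c ^ 2 = (1::'a::field)" "k \<noteq> i"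
  shows "t_coord n a b c d i k ^ 2 = 1"
  using assms by (simp add: t_coord_def power_mult_distrib)

lemma t_coord_sides:
  assumes "a ^ 2 = 1" "b ^ 2 = 1" "i < n" "1 \<le> i"
  shows "coord0 (t_coord n a b c d i) (i - 1) * t_coord n a b c d i (i + 1) = (if even n then b else (a::'a::field))"
proof -
  have "a * a = 1" "b * b = 1" using assms by (simp_all add: power2_eq_square)
  moreover obtain j where "i = Suc j" using assms(4) by (cases i) auto
  ultimately show ?thesis using assms(3)
    by (cases "even j"; cases "even n"; cases "j = 0") (simp_all add: t_coord_def coord0_def mult_ac flip: mult.assoc)
qed

theorem t_coord_braid_equations:
  assumes n: "3 \<le> n" and sq: "a ^ 2 = 1" "b ^ 2 = 1" "c ^ 2 = (1::'a::field)"
  shows "braid_equations n (t_coord n a b c d)"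
proof -
  have aa: "a * a = 1" "b * b = 1" "c * c = 1" using sq by (simp_all add: power2_eq_square)
  let ?\<tau> = "t_coord n a b c d"
  have coord0_sq: "coord0 (?\<tau> i) k ^ 2 = 1" if "k \<noteq> i" for i k
    using t_coord_square[OF sq that] by (simp add: coord0_def)
  have two: "root_value n i (?\<tau> j) = 1" if "i \<in> {1..n}" "j \<in> {1..n}" "Suc i < j \<or> Suc j < i" for i j
  proof (cases "i = n")
    case True
    then show ?thesis
      using that t_coord_square[OF sq, of n j] t_coord_square[OF sq, of "n - 1" j] by (auto simp: root_value_last)
  next
    case False
    have "coord0 (?\<tau> j) (i - 1) = ?\<tau> j (i + 1) \<or> (i = 1 \<and> ?\<tau> j (i + 1) = 1)"
    proof (cases "i = 1")
      case True
      then show ?thesis using that by (auto simp: t_coord_def)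
    next
      case False
      then obtain l where l: "i = Suc l" "1 \<le> l" using \<open>i \<in> {1..n}\<close> by (cases i) auto
      then have "coord0 (?\<tau> j) l = ?\<tau> j l" by (simp add: coord0_def)
      moreover have "?\<tau> j l = ?\<tau> j (Suc (Suc l))" using that l by (auto simp: t_coord_def)
      ultimately show ?thesis using l by simp
    qed
    then have "coord0 (?\<tau> j) (i - 1) * ?\<tau> j (i + 1) = 1"
      using t_coord_square[OF sq, of "i + 1" j n d] that by (auto simp: power2_eq_square coord0_def)
    moreover have "?\<tau> j i ^ 2 = 1" using t_coord_square[OF sq, of i j] that by auto
    ultimately show ?thesis using root_value_inner[of i n "?\<tau> j"] that False by simp
  qed
  have three: "?\<tau> i k = ?\<tau> (Suc i) k" if "1 \<le> i" "Suc i < n" "k \<noteq> i" "k \<noteq> Suc i" for i k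
    using that by (auto simp: t_coord_def)
  have three': "?\<tau> i (Suc i) * ?\<tau> (Suc i) i = coord0 (?\<tau> i) (i - 1) * ?\<tau> i (i + 2)"
    if "1 \<le> i" "Suc i < n" for i
  proof -
    obtain j where "i = Suc j" using \<open>1 \<le> i\<close> by (cases i) auto
    then show ?thesis using that aa
      by (cases "even j"; cases "even n"; cases "j = 0") (simp_all add: t_coord_def coord0_def mult_ac flip: mult.assoc)
  qed
  have "?\<tau> n (n - 1) ^ 2 = coord0 (?\<tau> n) (n - 2) ^ 2" "?\<tau> (n - 1) n ^ 2 = coord0 (?\<tau> (n - 1)) (n - 2) ^ 2"
    using coord0_sq[of "n - 2" n] coord0_sq[of "n - 2" "n - 1"]
      t_coord_square[OF sq, of "n - 1" n n d] t_coord_square[OF sq, of n "n - 1" n d] n by simp_all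
  then show ?thesis unfolding braid_equations_def using two three three' by blast
qed

text \<open>
  In the coordinates \<open>z\<^sub>k = x\<^sub>k / x\<^sub>k\<^sub>-\<^sub>1\<close> the equations read
  \<open>z\<^sub>i / z\<^sub>i\<^sub>+\<^sub>1 = y\<^sub>i\<close> for \<open>i < n\<close> and \<open>z\<^sub>n\<^sup>2 = y\<^sub>n\<close>.
\<close>

lemma root_values_surj:
  fixes y :: "nat \<Rightarrow> 'a::alg_closed_field"
  assumes n: "2 \<le> n" and y: "\<forall>i\<in>{1..n}. y i \<noteq> 0"
  shows "\<exists>x. nonvanishing n x \<and> (\<forall>i\<in>{1..n}. root_value n i x = y i)"
proof -
  obtain e where e: "e ^ 2 = y n" using square_root_exists by blast
  have e0: "e \<noteq> 0" using e y n by auto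
  define z where "z k = (\<Prod>j\<in>{k..<n}. y j) * e" for k
  define x where "x k = (\<Prod>j\<in>{1..k}. z j)" for k
  have z0: "z k \<noteq> 0" if "1 \<le> k" for k using that y e0 by (auto simp: z_def)
  have x0: "x k \<noteq> 0" for k using z0 by (simp add: x_def)
  have xs: "x (Suc k) = x k * z (Suc k)" for k by (simp add: x_def)
  have xc: "coord0 x k = x k" for k by (simp add: coord0_def x_def)
  have "root_value n i x = y i" if i: "i \<in> {1..n}" for i
  proof -
    obtain j where j: "i = Suc j" using i by (cases i) auto
    show ?thesis
    proof (cases "i = n")
      case True
      have "root_value n n x = z n ^ 2"
        using xs[of j] x0[of j] True j diff_Suc_1[of j] by (auto simp: root_value_last power_mult_distrib)
      then show ?thesis using True e by (simp add: z_def)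
    next
      case False
      have "z i = y i * z (Suc i)"
        using i False by (simp add: z_def prod.atLeast_Suc_lessThan)
      moreover have "root_value n i x = z i / z (Suc i)"
        using root_value_inner[of i n x] i False xs[of j] xs[of i] x0[of j] z0[of i] z0[of "Suc i"]
        by (simp add: xc j power2_eq_square)
      ultimately show ?thesis using z0[of "Suc i"] by simp
    qed
  qed
  moreover have "nonvanishing n x" using x0 by (simp add: nonvanishing_def)
  ultimately show ?thesis by blast
qed

section \<open>Sections and their squares\<close>

lemma minus_one_neq_one:
  assumes "CHAR('a::field) \<noteq> 2"
  shows "(- 1 :: 'a) \<noteq> 1"
proof
  assume eq: "(- 1 :: 'a) = 1"
  have "(- 1 :: 'a) + 1 = 0" by (rule left_minus)
  then have "(1 :: 'a) + 1 = 0" unfolding eq .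
  then have "of_nat 2 = (0 :: 'a)" by simp
  then have "CHAR('a) dvd 2" by (simp only: of_nat_eq_0_iff_char_dvd)
  moreover have "CHAR('a) \<noteq> 1" by simp
  ultimately show False using assms prime_nat_iff[of 2] two_is_prime_nat by blast
qed

lemma elt_order_2:
  assumes "invertible g" "g \<noteq> mat 1" "g ** g = mat 1"
  shows "elt_order g = 2"
proof -
  have "GL.ord g dvd 2" using GL.pow_eq_id[of g 2] assms by (simp add: numeral_2_eq_2)
  moreover have "GL.ord g \<noteq> 1" using GL.ord_eq_1[of g] assms by simp
  ultimately have "GL.ord g = 2" using prime_nat_iff[of 2] two_is_prime_nat by blast
  then show ?thesis by (simp add: elt_order_def numeral_eq_enat)
qed

lemma elt_order_4:
  assumes "invertible g" "g ** g \<noteq> mat 1" "(g ** g) ** (g ** g) = mat 1"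
  shows "elt_order g = 4"
proof -
  have "g [^]\<^bsub>GL\<^esub> (4::nat) = (g ** g) ** (g ** g)"
    by (simp add: numeral_eq_Suc mul_assoc)
  then have "GL.ord g dvd 4" using GL.pow_eq_id[of g 4] assms by simp
  moreover have "\<not> GL.ord g dvd 2" using GL.pow_eq_id[of g 2] assms by (simp add: numeral_2_eq_2)
  moreover have "d = 1 \<or> d = 2 \<or> d = 4" if "d dvd 4" for d :: nat
  proof -
    have "d \<le> 4" using that by (rule dvd_imp_le) simp
    then have "d = 0 \<or> d = 1 \<or> d = 2 \<or> d = 3 \<or> d = 4" by linarith
    then show ?thesis using that by auto
  qed
  ultimately have "GL.ord g = 4" by fastforce
  then show ?thesis by (simp add: elt_order_def numeral_eq_enat)
qed

context realized_C_group
begin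

lemma reduced_word_iff: "reduced_word R ws \<longleftrightarrow> W.reduced ws"
  by (simp only: reduced_word_def W.reduced_def rank)

lemma singleton_reduced:
  assumes i: "i \<in> I"
  shows "W.reduced [i]"
proof (rule reduced_Cons[OF i W.reduced_Nil])
  show "positive (act (\<alpha> i) (sw []))"
    using simple_positive[OF i] act_one[OF simple_root[OF i]] by simp
qed

lemma wp_singleton: "i \<in> I \<Longrightarrow> W.wp [i] = r i"
  using W.s_closed by simp

lemma r_closed: "i \<in> I \<Longrightarrow> r i \<in> carrier W"
  by (rule W.s_closed)

text \<open>
  By Matsumoto's theorem the product of the lifts along a reduced word depends only on the element
  of the Weyl group.
\<close>

lemma exists_section:
  assumes f: "\<And>i. i \<in> I \<Longrightarrow> f i \<in> N \<and> \<pi> (f i) = r i"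
    and braid: "\<And>i j. i \<in> I \<Longrightarrow> j \<in> I \<Longrightarrow> i \<noteq> j \<Longrightarrow>
      word_prod GL f (alternating (bond n i j) i j) = word_prod GL f (alternating (bond n i j) j i)"
  shows "\<exists>S. is_section R S \<and> (\<forall>i\<in>I. S (r i) = f i)"
proof -
  have fN: "word_prod GL f ws \<in> N" if "set ws \<subseteq> I" for ws
    by (rule word_in_N[OF that]) (use f in blast)
  have matsumoto: "word_prod GL f ws = word_prod GL f vs"
    if "W.reduced ws" "W.reduced vs" "W.wp ws = W.wp vs" for ws vs
  proof (rule W.matsumoto[OF _ _ _ that])
    show "Group.monoid GL" by (rule GL.monoid_axioms)
    show "f i \<in> carrier GL" if "i \<in> I" for i using f[OF that] by simp
    fix q i j
    assume ij: "i \<in> I" "j \<in> I" "i \<noteq> j" and red: "W.reduced (alternating q i j)"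
      and eq: "W.wp (alternating q i j) = W.wp (alternating q j i)"
    from alternating_equal_length[OF ij red eq] braid[OF ij]
    show "word_prod GL f (alternating q i j) = word_prod GL f (alternating q j i)" by auto
  qed
  define word where "word w = (SOME ws. W.reduced ws \<and> W.wp ws = w)" for w
  have word: "W.reduced (word w)" "W.wp (word w) = w" if "w \<in> carrier W" for w
    using someI_ex[OF W.exists_reduced[OF that]] unfolding word_def by blast+
  define S where "S = (\<lambda>w\<in>carrier W. word_prod GL f (word w))"
  have S: "S (W.wp ws) = word_prod GL f ws" if ws: "W.reduced ws" for ws
  proof -
    have c: "W.wp ws \<in> carrier W" by (rule W.wp_closed[OF W.reducedD[OF ws]])
    have "S (W.wp ws) = word_prod GL f (word (W.wp ws))" using c by (simp only: S_def restrict_apply if_True)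
    also have "\<dots> = word_prod GL f ws" by (rule matsumoto[OF word(1)[OF c] ws word(2)[OF c]])
    finally show ?thesis .
  qed
  have Sr: "S (r i) = f i" if i: "i \<in> I" for i
    using S[OF singleton_reduced[OF i]] unfolding wp_singleton[OF i] by simp
  have "is_section R S"
    unfolding is_section_def
  proof (intro conjI ballI allI impI)
    show "S \<in> carrier W \<rightarrow>\<^sub>E N"
      unfolding S_def using fN[OF W.reducedD[OF word(1)]] by (intro restrict_PiE_iff[THEN iffD2] ballI)
    fix w assume w: "w \<in> carrier W"
    have "\<pi> (S w) = \<pi> (word_prod GL f (word w))" using w by (simp only: S_def restrict_apply if_True)
    also have "\<dots> = W.wp (word w)" by (rule word_prod_W[OF f W.reducedD[OF word(1)[OF w]], symmetric])
    finally show "\<pi> (S w) = w" using word(2)[OF w] by simp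
  next
    fix ws assume "reduced_word R ws"
    then have red: "W.reduced ws" by (simp only: reduced_word_iff)
    have "word_prod GL f ws = word_prod GL (\<lambda>i. S (r i)) ws"
      by (rule word_prod_cong) (use Sr W.reducedD[OF red] in auto)
    then show "S (W.wp ws) = word_prod GL (\<lambda>i. S (r i)) ws" using S[OF red] by simp
  qed
  then show ?thesis using Sr by blast
qed

lemma section_word:
  "is_section R S \<Longrightarrow> W.reduced ws \<Longrightarrow> S (W.wp ws) = word_prod GL (\<lambda>i. S (r i)) ws"
  by (simp only: is_section_def reduced_word_iff)

lemma section_eqI:
  assumes S: "is_section R S" "is_section R S'" and eq: "\<And>i. i \<in> I \<Longrightarrow> S (r i) = S' (r i)"
  shows "S = S'"
proof (rule extensionalityI[of _ "carrier W"])
  show "S \<in> extensional (carrier W)" "S' \<in> extensional (carrier W)"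
    using S by (auto simp: is_section_def PiE_def)
  fix w assume w: "w \<in> carrier W"
  obtain ws where ws: "W.reduced ws" "W.wp ws = w" using W.exists_reduced[OF w] by blast
  have "word_prod GL (\<lambda>i. S (r i)) ws = word_prod GL (\<lambda>i. S' (r i)) ws"
    by (rule word_prod_cong) (use eq W.reducedD[OF ws(1)] in auto)
  then show "S w = S' w" using section_word[OF S(1) ws(1)] section_word[OF S(2) ws(1)] ws(2) by simp
qed

lemma section_lift:
  assumes S: "is_section R S" and i: "i \<in> I"
  shows "S (r i) \<in> N" "\<pi> (S (r i)) = r i" "\<exists>x. nv x \<and> S (r i) = h x ** s i"
proof -
  show N: "S (r i) \<in> N" and p: "\<pi> (S (r i)) = r i"
    using S r_closed[OF i] unfolding is_section_def by (blast dest: PiE_mem)+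
  from p have "\<pi> (S (r i)) = \<pi> (s i)" by (simp only: r_eq)
  then obtain t where "t \<in> T" "S (r i) = t ** s i"
    using weyl_proj_eq_iff[OF s_in_N[OF i]] by blast
  then show "\<exists>x. nv x \<and> S (r i) = h x ** s i" using torus_coordinates_surj by blast
qed

lemma word_prod_coordinates:
  assumes nvt: "\<And>i. i \<in> I \<Longrightarrow> nv (\<tau> i)" and ws: "set ws \<subseteq> I"
  shows "word_prod GL (\<lambda>i. h (\<tau> i) ** s i) ws = h (torus_part n \<tau> ws) ** sw ws"
  using ws
proof (induction ws)
  case Nil
  then show ?case by (simp add: h_one)
next
  case (Cons i ws)
  then have i: "i \<in> I" and ws: "set ws \<subseteq> I" by auto
  let ?t = "torus_part n \<tau> ws"
  have nv: "nv ?t" by (rule torus_part_nonvanishing[OF ws n_ge_2 nvt])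
  have nvr: "nv (reflect n i ?t)" by (rule nonvanishing_reflect[OF i n_ge_2 nv])
  have "word_prod GL (\<lambda>i. h (\<tau> i) ** s i) (i # ws) = h (\<tau> i) ** (s i ** h ?t) ** sw ws"
    using Cons.IH[OF ws] by (simp add: mul_assoc)
  also have "\<dots> = (h (\<tau> i) ** h (reflect n i ?t)) ** (s i ** sw ws)"
    unfolding s_h_commute[OF i nv] by (simp only: mul_assoc)
  also have "h (\<tau> i) ** h (reflect n i ?t) = h (torus_part n \<tau> (i # ws))"
    using h_mult[OF nvt[OF i] nvr] by simp
  finally show ?case by simp
qed

lemma braid_iff_coordinates:
  assumes nvt: "\<And>i. i \<in> I \<Longrightarrow> nv (\<tau> i)" and ij: "i \<in> I" "j \<in> I" "i \<noteq> j"
  shows "word_prod GL (\<lambda>i. h (\<tau> i) ** s i) (alternating (bond n i j) i j)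
      = word_prod GL (\<lambda>i. h (\<tau> i) ** s i) (alternating (bond n i j) j i) \<longleftrightarrow> coordinate_braid n \<tau> i j"
proof -
  let ?A = "alternating (bond n i j) i j" and ?B = "alternating (bond n i j) j i"
  have A: "set ?A \<subseteq> I" "set ?B \<subseteq> I" using alternating_subset ij by blast+
  have nv: "nv (torus_part n \<tau> ?A)" "nv (torus_part n \<tau> ?B)"
    using torus_part_nonvanishing[where \<tau>=\<tau>, OF A(1) n_ge_2 nvt]
      torus_part_nonvanishing[where \<tau>=\<tau>, OF A(2) n_ge_2 nvt] by blast+
  have inv: "invertible (sw ?B)" using sw_in_N[OF A(2)] by simp
  have "h (torus_part n \<tau> ?A) ** sw ?B = h (torus_part n \<tau> ?B) ** sw ?B \<longleftrightarrow>
      h (torus_part n \<tau> ?A) = h (torus_part n \<tau> ?B)" by (rule mult_right_cancel_GL[OF inv])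
  also have "\<dots> \<longleftrightarrow> coordinate_braid n \<tau> i j"
    unfolding coordinate_braid_def using h_inj[OF nv] h_cong[OF nv(2)] by blast
  finally show ?thesis
    by (simp only: word_prod_coordinates[where \<tau>=\<tau>, OF nvt A(1)]
        word_prod_coordinates[where \<tau>=\<tau>, OF nvt A(2)] tits_braid[OF ij])
qed

text \<open>
  Alternating words of length \<open>bond n i j\<close> are reduced, so a section satisfies the braid relations, and
  these determine the coordinates of its values at the \<open>s\<^sub>i\<close> up to \<open>a\<close>, \<open>b\<close>, \<open>c\<close> and the diagonal.
\<close>

lemma section_has_params:
  assumes S: "is_section R S"
  shows "\<exists>a b c d. section_params R a b c d S"
proof -
  define \<tau> where "\<tau> i = (SOME x. nv x \<and> S (r i) = h x ** s i)" for i
  have \<tau>: "nv (\<tau> i) \<and> S (r i) = h (\<tau> i) ** s i" if "i \<in> I" for i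
    using someI_ex[OF section_lift(3)[OF S that]] unfolding \<tau>_def .
  then have nvt: "\<And>i. i \<in> I \<Longrightarrow> nv (\<tau> i)" by blast
  have "coordinate_braid n \<tau> i j" if ij: "i \<in> I" "j \<in> I" "i \<noteq> j" for i j
  proof -
    let ?A = "alternating (bond n i j) i j" and ?B = "alternating (bond n i j) j i"
    have A: "set ?A \<subseteq> I" "set ?B \<subseteq> I" using alternating_subset ij by blast+
    have red: "W.reduced ?A" "W.reduced ?B"
      using alternating_reduced[OF ij order_refl] alternating_reduced[OF ij(2,1) ij(3)[symmetric], of "bond n i j"]
      by (simp_all only: bond_commute[of n j i] order_refl simp_thms)
    have "W.wp ?A = W.wp ?B" by (simp only: wp_eq_sw[OF A(1)] wp_eq_sw[OF A(2)] tits_braid[OF ij])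
    then have "word_prod GL (\<lambda>i. S (r i)) ?A = word_prod GL (\<lambda>i. S (r i)) ?B"
      using section_word[OF S red(1)] section_word[OF S red(2)] by simp
    moreover have "word_prod GL (\<lambda>i. S (r i)) ws = word_prod GL (\<lambda>i. h (\<tau> i) ** s i) ws"
      if "set ws \<subseteq> I" for ws
      by (rule word_prod_cong) (use \<tau> that in blast)
    ultimately show ?thesis using braid_iff_coordinates[where \<tau>=\<tau>, OF nvt ij] A by simp
  qed
  then have "braid_equations n \<tau>" using braid_equations_iff[where \<tau>=\<tau>, OF n_ge_3 nvt] by blast
  from braid_equations_solution[OF n_ge_3 nvt this]
  obtain a b c where sq: "a ^ 2 = 1" "b ^ 2 = 1" "c ^ 2 = 1"
    and eq: "\<forall>i\<in>I. \<forall>k\<in>I. \<tau> i k = t_coord n a b c (\<lambda>i. \<tau> i i) i k" by blast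
  have d: "\<forall>i\<in>I. \<tau> i i \<noteq> 0" using nvt by (auto simp: nonvanishing_def)
  have "S (r i) = h (t_coord n a b c (\<lambda>i. \<tau> i i) i) ** s i" if i: "i \<in> I" for i
  proof -
    have "h (\<tau> i) = h (t_coord n a b c (\<lambda>i. \<tau> i i) i)"
      by (rule h_cong[OF t_coord_nonvanishing[OF sq d i]]) (use eq i in blast)
    then show ?thesis using \<tau>[OF i] by simp
  qed
  then have "section_params R a b c (\<lambda>i. \<tau> i i) S"
    unfolding section_params_def rank using S sq d by simp
  then show ?thesis by blast
qed

lemma section_paramsD:
  assumes "section_params R a b c d S"
  shows "is_section R S" "a ^ 2 = 1" "b ^ 2 = 1" "c ^ 2 = 1" "\<forall>i\<in>I. d i \<noteq> 0"
    "i \<in> I \<Longrightarrow> S (r i) = h (t_coord n a b c d i) ** s i" "i \<in> I \<Longrightarrow> nv (t_coord n a b c d i)"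
proof -
  show 1: "is_section R S" "a ^ 2 = 1" "b ^ 2 = 1" "c ^ 2 = 1" "\<forall>i\<in>I. d i \<noteq> 0"
    "i \<in> I \<Longrightarrow> S (r i) = h (t_coord n a b c d i) ** s i"
    using assms unfolding section_params_def rank by simp_all
  show "i \<in> I \<Longrightarrow> nv (t_coord n a b c d i)" by (rule t_coord_nonvanishing[OF 1(2-5)])
qed

lemma exists_section_params:
  assumes sq: "a ^ 2 = 1" "b ^ 2 = 1" "c ^ 2 = 1" and d: "\<forall>i\<in>I. d i \<noteq> 0"
  shows "\<exists>!S. section_params R a b c d S"
proof -
  let ?\<tau> = "t_coord n a b c d"
  let ?f = "\<lambda>i. h (?\<tau> i) ** s i"
  have nvt: "nv (?\<tau> i)" if "i \<in> I" for i by (rule t_coord_nonvanishing[OF sq d that])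
  have f: "?f i \<in> N \<and> \<pi> (?f i) = r i" if i: "i \<in> I" for i
  proof
    have t: "h (?\<tau> i) \<in> T" by (rule h_in_T[OF nvt[OF i]])
    show "?f i \<in> N" by (rule N_mult[OF T_in_N[OF t] s_in_N[OF i]])
    show "\<pi> (?f i) = r i" unfolding r_eq weyl_proj_eq_iff[OF s_in_N[OF i]] using t by blast
  qed
  have "braid_equations n ?\<tau>" by (rule t_coord_braid_equations[OF n_ge_3 sq])
  then have cb: "coordinate_braid n ?\<tau> i j" if "i \<in> I" "j \<in> I" "i \<noteq> j" for i j
    using braid_equations_iff[where \<tau>="?\<tau>", OF n_ge_3 nvt] that by blast
  have "\<exists>S. is_section R S \<and> (\<forall>i\<in>I. S (r i) = ?f i)"
  proof (rule exists_section)
    show "?f i \<in> N \<and> \<pi> (?f i) = r i" if "i \<in> I" for i by (rule f[OF that])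
    fix i j assume ij: "i \<in> I" "j \<in> I" "i \<noteq> j"
    show "word_prod GL ?f (alternating (bond n i j) i j) = word_prod GL ?f (alternating (bond n i j) j i)"
      using braid_iff_coordinates[where \<tau>="?\<tau>", OF nvt ij] cb[OF ij] by blast
  qed
  then obtain S where S: "is_section R S" "\<forall>i\<in>I. S (r i) = ?f i" by blast
  show ?thesis
  proof (rule ex1I)
    show "section_params R a b c d S" unfolding section_params_def rank using S sq d by simp
    fix S' assume S': "section_params R a b c d S'"
    show "S' = S"
      by (rule section_eqI[OF section_paramsD(1)[OF S'] S(1)])
        (use section_paramsD(6)[OF S'] S(2) in simp)
  qed
qed

lemma tits_section_iff: "tits_section R S \<longleftrightarrow> section_params R 1 1 1 (\<lambda>_. 1) S"
proof -
  have "t_coord n 1 1 1 (\<lambda>_. 1) i = (\<lambda>_. 1 :: 'a)" for i by (auto simp: t_coord_def fun_eq_iff)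
  then show ?thesis by (simp add: tits_section_def section_params_def rank h_one)
qed

lemma coroot_eq_one_iff: "i \<in> I \<Longrightarrow> z \<noteq> 0 \<Longrightarrow> cor (\<alpha> i) z = mat 1 \<longleftrightarrow> z = 1"
proof
  assume i: "i \<in> I" and z: "z \<noteq> 0" and eq: "cor (\<alpha> i) z = mat 1"
  have "h (\<lambda>k. if k = i then z else 1) = mat 1" by (simp only: h_single[OF i z] eq)
  from h_eq_one[OF nonvanishing_simps(4)[OF z] this i] show "z = 1" by simp
qed (simp add: coroot_one[OF simple_root])

text \<open>
  The square of \<open>t\<^sub>i \<sigma>\<^sub>i\<close> is \<open>t\<^sub>i s\<^sub>i(t\<^sub>i) \<alpha>\<^sub>i\<^sup>\<or>(-1)\<close>.  Only its \<open>i\<close>-th coordinate can differ from \<open>1\<close>, and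
  there the free entry of \<open>t\<^sub>i\<close> cancels.
\<close>

lemma section_square:
  assumes S: "section_params R a b c d S" and i: "i \<in> I"
  shows "S (r i) ** S (r i) = cor (\<alpha> i) (- (if i = n then 1 else if even n then b else a))"
proof -
  let ?x = "t_coord n a b c d i"
  let ?e = "- (if i = n then 1 else if even n then b else a)"
  note sq = section_paramsD(2-4)[OF S]
  note nv = section_paramsD(7)[OF S i]
  have nvr: "nv (reflect n i ?x)" by (rule nonvanishing_reflect[OF i n_ge_2 nv])
  have e0: "?e \<noteq> 0" using sq by auto
  have m1: "(- 1 :: 'a) \<noteq> 0" by simp
  have "S (r i) ** S (r i) = h ?x ** (s i ** h ?x) ** s i"
    by (simp only: section_paramsD(6)[OF S i] mul_assoc)
  also have "\<dots> = h ?x ** h (reflect n i ?x) ** (s i ** s i)"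
    by (simp only: s_h_commute[OF i nv] mul_assoc)
  also have "\<dots> = h (\<lambda>k. ?x k * reflect n i ?x k) ** h (\<lambda>k. if k = i then - 1 else 1)"
    by (simp only: h_mult[OF nv nvr] s_square[OF i] h_single[OF i m1])
  also have "\<dots> = h (\<lambda>k. ?x k * reflect n i ?x k * (if k = i then - 1 else 1))"
    by (rule h_mult[symmetric]) (use nv nvr in \<open>simp_all add: nonvanishing_def\<close>)
  also have "\<dots> = h (\<lambda>k. if k = i then ?e else 1)"
  proof (rule h_cong)
    show "nv (\<lambda>k. if k = i then ?e else 1)" by (rule nonvanishing_simps(4)[OF e0])
    fix k assume k: "k \<in> I"
    have xi: "?x i \<noteq> 0" using nv i by (simp add: nonvanishing_def)
    have diag: "?x i * (?x i / root_value n i ?x) * - 1 = ?e"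
    proof (cases "i = n")
      case True
      have "?x (n - 1) ^ 2 = 1" by (rule t_coord_square[OF sq]) (use True n_ge_3 in auto)
      then show ?thesis using True xi root_value_last[of n ?x] by (simp add: power2_eq_square)
    next
      case False
      then have "i < n" "1 \<le> i" using i by auto
      then have "root_value n i ?x = ?x i ^ 2 / (if even n then b else a)"
        using t_coord_sides[OF sq(1,2), of i n c d] root_value_inner[of i n ?x] by simp
      then show ?thesis using False xi sq by (auto simp: power2_eq_square)
    qed
    show "?x k * reflect n i ?x k * (if k = i then - 1 else 1) = (if k = i then ?e else 1)"
    proof (cases "k = i")
      case True
      then show ?thesis using diag by (simp add: reflect_apply)
    next
      case False
      then show ?thesis using t_coord_square[OF sq False, of n d] by (simp add: reflect_apply power2_eq_square)
    qed
  qed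
  also have "\<dots> = cor (\<alpha> i) ?e" by (rule h_single[OF i e0])
  finally show ?thesis .
qed

lemma section_not_one:
  assumes S: "is_section R S" and i: "i \<in> I"
  shows "S (r i) \<noteq> mat 1"
proof
  assume "S (r i) = mat 1"
  then have "W.wp [] = W.wp [i]"
    using section_lift(2)[OF S i] by (simp only: wp_singleton[OF i] word_prod_Nil weyl_proj_one)
  then have "length [i] \<le> length ([] :: nat list)"
    by (intro W.reduced_le[OF singleton_reduced[OF i]]) simp_all
  then show False by simp
qed

section \<open>Order profiles and conjugacy\<close>

lemma sign_cases: "(x :: 'a) ^ 2 = 1 \<Longrightarrow> x = 1 \<or> x = - 1"
  by (simp add: power2_eq_1_iff)

text \<open>
  By the formula for the square, \<open>S(s\<^sub>i)\<^sup>2\<close> is \<open>1\<close> or \<open>\<alpha>\<^sub>i\<^sup>\<or>(-1)\<close>, and the latter has order \<open>2\<close> because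
  the characteristic is not \<open>2\<close>.
\<close>

lemma section_profile:
  assumes S: "section_params R a b c d S" and char: "CHAR('a) \<noteq> 2"
  shows "order_profile R S = (\<lambda>i\<in>I. if i < n \<and> (if even n then b else a) = - 1 then 2 else 4)"
proof -
  have ne: "(- 1 :: 'a) \<noteq> 1" by (rule minus_one_neq_one[OF char])
  have "elt_order (S (r i)) = (if i < n \<and> (if even n then b else a) = - 1 then 2 else 4)" if i: "i \<in> I" for i
  proof -
    let ?u = "if even n then b else a"
    have u: "?u = 1 \<or> ?u = - 1" using sign_cases section_paramsD(2,3)[OF S] by auto
    note secS = section_paramsD(1)[OF S]
    have inv: "invertible (S (r i))" using section_lift(1)[OF secS i] by simp
    note one = coroot_one[OF simple_root[OF i]]
    show ?thesis
    proof (cases "i < n \<and> ?u = - 1")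
      case True
      then have "S (r i) ** S (r i) = mat 1" using section_square[OF S i] one by simp
      then show ?thesis using elt_order_2[OF inv section_not_one[OF secS i]] True by simp
    next
      case False
      then have sq: "S (r i) ** S (r i) = cor (\<alpha> i) (- 1)"
        using section_square[OF S i] u i by auto
      have "cor (\<alpha> i) (- 1) ** cor (\<alpha> i) (- 1) = mat 1"
        using coroot_mult[OF simple_root[OF i], of "- 1" "- 1"] one by simp
      moreover have "cor (\<alpha> i) (- 1) \<noteq> mat 1" using coroot_eq_one_iff[OF i, of "- 1"] ne by simp
      ultimately have "elt_order (S (r i)) = 4"
        by (intro elt_order_4[OF inv]) (simp_all only: sq not_False_eq_True)
      then show ?thesis using False by simp
    qed
  qed
  then show ?thesis unfolding order_profile_def rank by (intro restrict_ext)
qed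

abbreviation "profile_split \<equiv> (\<lambda>i\<in>I. if i < n then 2 else 4 :: enat)"
abbreviation "profile_tits \<equiv> (\<lambda>i\<in>I. 4 :: enat)"

lemma profiles_distinct: "profile_split \<noteq> profile_tits"
proof
  assume "profile_split = profile_tits"
  from fun_cong[OF this, of 1] show False using n_ge_3 by simp
qed

lemma section_profile_eq:
  assumes S: "section_params R a b c d S" and char: "CHAR('a) \<noteq> 2"
  shows "order_profile R S = (if (if even n then b else a) = - 1 then profile_split else profile_tits)"
  unfolding section_profile[OF assms] by simp

lemma order_profiles_eq:
  assumes char: "CHAR('a) \<noteq> 2"
  shows "order_profiles R = {profile_split, profile_tits}"
proof
  have ne: "(1 :: 'a) \<noteq> - 1" using minus_one_neq_one[OF char] by metis
  show "order_profiles R \<subseteq> {profile_split, profile_tits}"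
  proof
    fix p assume "p \<in> order_profiles R"
    then obtain S where S: "is_section R S" "p = order_profile R S" by (auto simp: order_profiles_def)
    obtain a b c d where "section_params R a b c d S" using section_has_params[OF S(1)] by blast
    from section_profile_eq[OF this char] show "p \<in> {profile_split, profile_tits}" unfolding S(2) by simp
  qed
  have ex: "\<exists>S. section_params R u u 1 (\<lambda>_. 1) S" if "u ^ 2 = 1" for u
    using exists_section_params[OF that that, of 1 "\<lambda>_. 1"] by auto
  obtain S1 S2 where S: "section_params R (- 1) (- 1) 1 (\<lambda>_. 1) S1" "section_params R 1 1 1 (\<lambda>_. 1) S2"
    using ex[of "- 1"] ex[of 1] by auto
  have "order_profile R S1 = profile_split" "order_profile R S2 = profile_tits"
    using section_profile_eq[OF S(1) char] section_profile_eq[OF S(2) char] ne by simp_all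
  moreover have "order_profile R S1 \<in> order_profiles R" "order_profile R S2 \<in> order_profiles R"
    unfolding order_profiles_def
    by (intro imageI CollectI section_paramsD(1)[OF S(1)], intro imageI CollectI section_paramsD(1)[OF S(2)])
  ultimately show "{profile_split, profile_tits} \<subseteq> order_profiles R" by simp
qed

lemma maximal_profiles:
  assumes char: "CHAR('a) \<noteq> 2"
  shows "{p \<in> order_profiles R. \<forall>q \<in> order_profiles R. profile_le (rk R) p q \<longrightarrow> q = p} = {profile_split}"
proof -
  have "profile_le n profile_tits profile_split" by (simp add: profile_le_def)
  moreover have "\<not> profile_le n profile_split profile_tits"
    using n_ge_3 by (auto simp: profile_le_def intro!: bexI[of _ 1])
  ultimately show ?thesis unfolding order_profiles_eq[OF char] rank using profiles_distinct by auto
qed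

lemma optimal_iff:
  assumes S: "section_params R a b c d S" and char: "CHAR('a) \<noteq> 2"
  shows "optimal R S \<longleftrightarrow> (if even n then b else a) = - 1"
  unfolding optimal_def maximal_profiles[OF char] section_profile_eq[OF assms]
  using section_paramsD(1)[OF S] profiles_distinct by auto

lemma conj_lift:
  assumes x: "nv x" and y: "nv y" and i: "i \<in> I"
  shows "h x ** (h y ** s i) ** ginv (h x) = h (\<lambda>k. y k * (if k = i then root_value n i x else 1)) ** s i"
proof -
  define z where "z k = inverse (x k)" for k
  have z: "nv z" unfolding z_def using x by simp
  have zr: "nv (reflect n i z)" by (rule nonvanishing_reflect[OF i n_ge_2 z])
  have xy: "nv (\<lambda>k. x k * y k)" using x y by simp
  have "h x ** (h y ** s i) ** ginv (h x) = h x ** h y ** (s i ** h z)"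
    by (simp only: h_inverse[OF x] z_def[abs_def] mul_assoc)
  also have "\<dots> = h x ** h y ** h (reflect n i z) ** s i" by (simp only: s_h_commute[OF i z] mul_assoc)
  also have "h x ** h y ** h (reflect n i z) = h (\<lambda>k. x k * y k * reflect n i z k)"
    by (simp only: h_mult[OF x y] h_mult[OF xy zr])
  also have "\<dots> = h (\<lambda>k. y k * (if k = i then root_value n i x else 1))"
  proof (rule h_cong)
    have rx: "root_value n i x \<noteq> 0" by (rule root_value_nz[OF i n_ge_2 x])
    show "nv (\<lambda>k. y k * (if k = i then root_value n i x else 1))"
      by (rule nonvanishing_simps(2)[OF y nonvanishing_simps(4)[OF rx]])
    fix k assume k: "k \<in> I"
    have "root_value n i z = inverse (root_value n i x)" unfolding z_def by (rule root_value_inverse)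
    moreover have "x k \<noteq> 0" using x k by (simp add: nonvanishing_def)
    ultimately show "x k * y k * reflect n i z k = y k * (if k = i then root_value n i x else 1)"
      by (auto simp: reflect_apply z_def divide_inverse)
  qed
  finally show ?thesis .
qed

lemma conj_word:
  assumes t: "invertible t" and f: "\<And>i. i \<in> I \<Longrightarrow> t ** f i ** ginv t = g i" and ws: "set ws \<subseteq> I"
  shows "t ** word_prod GL f ws ** ginv t = word_prod GL g ws"
  using ws
proof (induction ws)
  case Nil
  then show ?case using t by simp
next
  case (Cons i ws)
  have "t ** word_prod GL f (i # ws) ** ginv t = (t ** f i ** ginv t) ** (t ** word_prod GL f ws ** ginv t)"
    using t by (simp add: mul_assoc)
  then show ?case using Cons f[of i] by simp
qed

text \<open>
  Conjugation by \<open>t\<close> multiplies the \<open>i\<close>-th coordinate of \<open>t\<^sub>i\<close> by \<open>\<alpha>\<^sub>i(t)\<close> and fixes the others.  So \<open>a\<close>, \<open>b\<close>,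
  \<open>c\<close> are invariants, and the diagonal entries can be changed arbitrarily because the values
  \<open>\<alpha>\<^sub>i(t)\<close> can be prescribed.
\<close>

theorem T_conjugate_iff:
  assumes S: "section_params R a b c d S" and S': "section_params R a' b' c' d' S'"
  shows "T_conjugate R S S' \<longleftrightarrow> a = a' \<and> b = b' \<and> c = c'"
proof
  assume "T_conjugate R S S'"
  then obtain t where t: "t \<in> T" "\<forall>w\<in>carrier W. t ** S w ** ginv t = S' w"
    unfolding T_conjugate_def by auto
  obtain x where x: "nv x" "h x = t" using torus_coordinates_surj[OF t(1)] by blast
  have eq: "t_coord n a b c d i k = t_coord n a' b' c' d' i k"
    if i: "i \<in> I" and k: "k \<in> I" "k \<noteq> i" for i k
  proof -
    let ?y = "t_coord n a b c d i" and ?y' = "t_coord n a' b' c' d' i"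
    let ?z = "\<lambda>k. ?y k * (if k = i then root_value n i x else 1)"
    note nv = section_paramsD(7)[OF S i] section_paramsD(7)[OF S' i]
    have rx: "root_value n i x \<noteq> 0" by (rule root_value_nz[OF i n_ge_2 x(1)])
    have nvz: "nv ?z" by (rule nonvanishing_simps(2)[OF nv(1) nonvanishing_simps(4)[OF rx]])
    have "h ?z ** s i = t ** S (r i) ** ginv t"
      by (simp only: section_paramsD(6)[OF S i] conj_lift[OF x(1) nv(1) i, symmetric] x(2))
    also have "\<dots> = h ?y' ** s i" using t(2) r_closed[OF i] section_paramsD(6)[OF S' i] by simp
    finally have "h ?z = h ?y'" by (rule iffD1[OF mult_right_cancel_GL[OF s_invertible[OF i]]])
    from h_inj[OF nvz nv(2) this k(1)] show ?thesis using k(2) by simp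
  qed
  show "a = a' \<and> b = b' \<and> c = c'"
    using eq[of 1 2] eq[of 1 3] eq[of n 1] n_ge_3 by (auto simp: t_coord_def split: if_splits)
next
  assume abc: "a = a' \<and> b = b' \<and> c = c'"
  note d = section_paramsD(5)[OF S] section_paramsD(5)[OF S']
  have "\<forall>i\<in>I. d' i / d i \<noteq> 0" using d by simp
  from root_values_surj[OF n_ge_2 this] obtain x where
    x: "nv x" and rx: "\<forall>i\<in>I. root_value n i x = d' i / d i" by blast
  have gen: "h x ** S (r i) ** ginv (h x) = S' (r i)" if i: "i \<in> I" for i
  proof -
    note nv = section_paramsD(7)[OF S i] section_paramsD(7)[OF S' i]
    have "h (\<lambda>k. t_coord n a b c d i k * (if k = i then root_value n i x else 1)) = h (t_coord n a' b' c' d' i)"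
      by (rule h_cong[OF nv(2)]) (use abc rx d i in \<open>auto simp: t_coord_def\<close>)
    then show ?thesis
      by (simp only: section_paramsD(6)[OF S i] section_paramsD(6)[OF S' i] conj_lift[OF x nv(1) i])
  qed
  have "h x ** S w ** ginv (h x) = S' w" if w: "w \<in> carrier W" for w
  proof -
    obtain ws where ws: "W.reduced ws" "W.wp ws = w" using W.exists_reduced[OF w] by blast
    have inv: "invertible (h x)" using h_in_T[OF x] by (rule T_simps(1))
    show ?thesis
      using conj_word[OF inv gen W.reducedD[OF ws(1)]]
        section_word[OF section_paramsD(1)[OF S] ws(1)] section_word[OF section_paramsD(1)[OF S'] ws(1)] ws(2)
      by simp
  qed
  then show "T_conjugate R S S'" unfolding T_conjugate_def using h_in_T[OF x] by auto
qed

end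

theorem proposition3p9:
  fixes R :: "('a::alg_closed_field, 'm::finite) realization" and n :: nat
  assumes "is_realization R" "almost_simple (grp R)"
    and "simply_connected_grp R" "type_C R"
    and "rk R = n" "n \<ge> 6"
    and "CHAR('a) \<noteq> 2"
  shows
    "(\<forall>a b c :: 'a. \<forall>d. a ^ 2 = 1 \<and> b ^ 2 = 1 \<and> c ^ 2 = 1 \<and> (\<forall>i\<in>{1..n}. d i \<noteq> 0) \<and>
        (if even n then b = - 1 else a = - 1) \<longrightarrow>
        (\<exists>!S. section_params R a b c d S) \<and>
        (\<forall>S. section_params R a b c d S \<longrightarrow>
           optimal R S \<and>
           (\<forall>i\<in>{1..n - 1}. S (simple_reflection R i) \<otimes>\<^bsub>GL\<^esub> S (simple_reflection R i) = \<one>\<^bsub>GL\<^esub>) \<and>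
           S (simple_reflection R n) \<otimes>\<^bsub>GL\<^esub> S (simple_reflection R n) \<noteq> \<one>\<^bsub>GL\<^esub>))
     \<and> (\<exists>!S. tits_section R S)
     \<and> (\<forall>S. tits_section R S \<longrightarrow> \<not> optimal R S \<and>
          (\<forall>i\<in>{1..n}. S (simple_reflection R i) \<otimes>\<^bsub>GL\<^esub> S (simple_reflection R i) \<noteq> \<one>\<^bsub>GL\<^esub>))
     \<and> card (order_profiles R) = 2
     \<and> (\<forall>S. is_section R S \<longrightarrow> (\<exists>a b c d. section_params R a b c d S))
     \<and> (\<forall>S S' a b c d a' b' c' d'.
          section_params R a b c d S \<and> section_params R a' b' c' d' S' \<longrightarrow>
          (T_conjugate R S S' \<longleftrightarrow> a = a' \<and> b = b' \<and> c = c'))"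
proof -
  interpret realized_C_group R n
    by unfold_locales (use assms in simp_all)
  note char = assms(7)
  have ne: "(- 1 :: 'a) \<noteq> 1" "(1 :: 'a) \<noteq> - 1" using minus_one_neq_one[OF char] by metis+
  have nI: "n \<in> {1..n}" using assms(6) by simp
  have minus_coroot: "coroot R (sroot R i) (- 1) \<noteq> mat 1" if "i \<in> {1..n}" for i
    using coroot_eq_one_iff[OF that, of "- 1"] ne by simp
  show ?thesis
  proof (intro conjI allI impI)
    fix a b c :: 'a and d :: "nat \<Rightarrow> 'a"
    assume A: "a ^ 2 = 1 \<and> b ^ 2 = 1 \<and> c ^ 2 = 1 \<and> (\<forall>i\<in>{1..n}. d i \<noteq> 0) \<and>
        (if even n then b = - 1 else a = - 1)"
    then show "\<exists>!S. section_params R a b c d S" by (intro exists_section_params) blast+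
    fix S assume S: "section_params R a b c d S"
    have u: "(if even n then b else a) = - 1" using A by (simp split: if_splits)
    then show "optimal R S" using optimal_iff[OF S char] by blast
    show "\<forall>i\<in>{1..n - 1}. S (simple_reflection R i) \<otimes>\<^bsub>GL\<^esub> S (simple_reflection R i) = \<one>\<^bsub>GL\<^esub>"
    proof
      fix i assume i: "i \<in> {1..n - 1}"
      then have iI: "i \<in> {1..n}" "i \<noteq> n" using assms(6) by auto
      have "S (simple_reflection R i) ** S (simple_reflection R i) = coroot R (sroot R i) 1"
        using section_square[OF S iI(1)] iI(2) u by simp
      then show "S (simple_reflection R i) \<otimes>\<^bsub>GL\<^esub> S (simple_reflection R i) = \<one>\<^bsub>GL\<^esub>"
        using coroot_one[OF simple_root[OF iI(1)]] by simp
    qed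
    show "S (simple_reflection R n) \<otimes>\<^bsub>GL\<^esub> S (simple_reflection R n) \<noteq> \<one>\<^bsub>GL\<^esub>"
      using section_square[OF S nI] minus_coroot[OF nI] by simp
  next
    show "\<exists>!S. tits_section R S"
      unfolding tits_section_iff by (rule exists_section_params) simp_all
  next
    fix S assume "tits_section R S"
    then have S: "section_params R 1 1 1 (\<lambda>_. 1) S" by (simp only: tits_section_iff)
    show "\<not> optimal R S" using optimal_iff[OF S char] ne by simp
    show "\<forall>i\<in>{1..n}. S (simple_reflection R i) \<otimes>\<^bsub>GL\<^esub> S (simple_reflection R i) \<noteq> \<one>\<^bsub>GL\<^esub>"
      using section_square[OF S] minus_coroot by simp
  next
    show "card (order_profiles R) = 2"
      unfolding order_profiles_eq[OF char] using profiles_distinct by simp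
  next
    fix S assume "is_section R S"
    then show "\<exists>a b c d. section_params R a b c d S" by (rule section_has_params)
  next
    fix S S' a b c d a' b' c' d'
    assume "section_params R a b c d S \<and> section_params R a' b' c' d' S'"
    then show "T_conjugate R S S' \<longleftrightarrow> a = a' \<and> b = b' \<and> c = c'" using T_conjugate_iff by blast
  qed
qed

end
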